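(* Let $n$ and $m$ be integers with $0<m<n$. (i) For every positive integer $q$, every $A\in\mathbb R^{q\times n}$ with $\operatorname{rank}(A)=m$, and every $b\in\mathbb R^q$ such that $P(A,b)=\{x\in\{0,1\}^n : Ax=b\}$ is nonempty, $$\operatorname{sd}\bigl(\mathcal R(A,b)\bigr)\le \min\{m,\,n-m\}.$$ (ii) This bound is attained: there exist a matrix $A$ with $n$ columns and $\operatorname{rank}(A)=m$, and a vector $b$, with $P(A,b)\neq\emptyset$ and $\operatorname{sd}(\mathcal R(A,b))=\min\{m,n-m\}$.
   Context: $\mathbb S^p$ is the space of real symmetric $p\times p$ matrices with inner product $\langle X,Y\rangle=\operatorname{tr}(XY)$, and $\mathbb S^p_+$ is the positive semidefinite cone. Matrices in $\mathbb S^{n+1}$ have rows and columns indexed by $0,1,\dots,n$. Equality-generated SDP--RLT relaxation: for $A\in\mathbb R^{q\times n}$, $b\in\mathbb R^q$, $$\mathcal R(A,b)=\left\{Y=\begin{pmatrix} 1 & x^T \\ x & X \end{pmatrix}\in\mathbb S^{n+1}_+ : \operatorname{diag}(X)=x,\ Ax=b,\ AX=bx^T\right\}=L\cap\mathbb S^{n+1}_+,$$ where $L\subseteq\mathbb S^{n+1}$ is the affine subspace defined by $Y_{00}=1$, $Y_{ii}=Y_{0i}$ ($i=1,\dots,n$) and $\begin{pmatrix}-b&A\end{pmatrix}Y=0$. Singularity degree: for a set $S$, $S^\perp=\{z:\langle z,s\rangle=0\ \forall s\in S\}$; for a cone $K$, $K^*=\{z:\langle z,x\rangle\ge0\ \forall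 x\in K\}$. Let $L\subseteq\mathbb S^p$ be an affine subspace with $L\cap\mathbb S^p_+\ne\emptyset$ and let $F_{\min}$ be the minimal face of $\mathbb S^p_+$ containing $L\cap\mathbb S^p_+$. A facial-reduction sequence of length $d\ge0$ consists of faces $F_0=\mathbb S^p_+,F_1,\dots,F_d$ and matrices $W_j\in L^\perp\cap(F_{j-1}^*\setminus F_{j-1}^\perp)$ with $F_j=F_{j-1}\cap W_j^\perp$ ($j=1,\dots,d$), and $F_d=F_{\min}$. The singularity degree $\operatorname{sd}(L\cap\mathbb S^p_+)$ is the minimum length of a facial-reduction sequence; it is taken with respect to the affine subspace $L$ given by the defining equality constraints. *)

theory Defs
  imports
    Complex_Main
    "HOL-Library.Extended_Nat"
    "Jordan_Normal_Form.DL_Rank"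
begin

section \<open>Symmetric matrices and the positive semidefinite cone\<close>

definition sym_mats :: "nat \<Rightarrow> real mat set" where
  "sym_mats p = {X \<in> carrier_mat p p. transpose_mat X = X}"

definition mat_trace :: "real mat \<Rightarrow> real" where
  "mat_trace X = (\<Sum>i<dim_row X. X $$ (i, i))"

definition mat_inner :: "real mat \<Rightarrow> real mat \<Rightarrow> real" where
  "mat_inner X Y = mat_trace (X * Y)"

definition psd_cone :: "nat \<Rightarrow> real mat set" where
  "psd_cone p = {X \<in> sym_mats p. \<forall>v\<in>carrier_vec p. 0 \<le> v \<bullet> (X *\<^sub>v v)}"

definition perp :: "nat \<Rightarrow> real mat set \<Rightarrow> real mat set" where
  "perp p S = {Z \<in> sym_mats p. \<forall>X\<in>S. mat_inner Z X = 0}"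

definition dual_cone :: "nat \<Rightarrow> real mat set \<Rightarrow> real mat set" where
  "dual_cone p K = {Z \<in> sym_mats p. \<forall>X\<in>K. 0 \<le> mat_inner Z X}"

section \<open>Faces\<close>

(* The library's face_of and convex need a real vector space type, which real mat
   (matrices of all sizes) is not; these are the same conditions written out. *)

definition mat_convex :: "real mat set \<Rightarrow> bool" where
  "mat_convex F \<longleftrightarrow>
    (\<forall>X\<in>F. \<forall>Y\<in>F. \<forall>t. 0 \<le> t \<and> t \<le> 1 \<longrightarrow> (1 - t) \<cdot>\<^sub>m X + t \<cdot>\<^sub>m Y \<in> F)"

definition mat_face_of :: "real mat set \<Rightarrow> real mat set \<Rightarrow> bool" where
  "mat_face_of F K \<longleftrightarrow> F \<subseteq> K \<and> mat_convex F \<and>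
    (\<forall>X\<in>K. \<forall>Y\<in>K. \<forall>t. 0 < t \<and> t < 1 \<and> (1 - t) \<cdot>\<^sub>m X + t \<cdot>\<^sub>m Y \<in> F \<longrightarrow> X \<in> F \<and> Y \<in> F)"

definition min_face :: "nat \<Rightarrow> real mat set \<Rightarrow> real mat set" where
  "min_face p S = \<Inter> {F. mat_face_of F (psd_cone p) \<and> S \<subseteq> F}"

section \<open>Singularity degree\<close>

definition facial_reduction_seq ::
  "nat \<Rightarrow> real mat set \<Rightarrow> nat \<Rightarrow> (nat \<Rightarrow> real mat set) \<Rightarrow> (nat \<Rightarrow> real mat) \<Rightarrow> bool" where
  "facial_reduction_seq p L d F W \<longleftrightarrow>
    F 0 = psd_cone p \<and>
    (\<forall>j\<le>d. mat_face_of (F j) (psd_cone p)) \<and>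
    (\<forall>j\<in>{1..d}.
       W j \<in> perp p L \<inter> (dual_cone p (F (j - 1)) - perp p (F (j - 1))) \<and>
       F j = F (j - 1) \<inter> perp p {W j}) \<and>
    F d = min_face p (L \<inter> psd_cone p)"

(* The argument is the affine subspace L itself: the degree is not determined by
   the intersection of L with the cone. The value is \<infinity> exactly when no
   facial reduction sequence exists, so any finite bound asserts existence. *)

definition singularity_degree :: "nat \<Rightarrow> real mat set \<Rightarrow> enat" where
  "singularity_degree p L = (INF d\<in>{d. \<exists>F W. facial_reduction_seq p L d F W}. enat d)"

section \<open>The equality-generated SDP-RLT relaxation\<close>

definition binary_points :: "real mat \<Rightarrow> real vec \<Rightarrow> real vec set" where
  "binary_points A b =
    {x \<in> carrier_vec (dim_col A). (\<forall>i<dim_col A. x $ i \<in> {0, 1}) \<and> A *\<^sub>v x = b}"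

definition rlt_relaxation :: "real mat \<Rightarrow> real vec \<Rightarrow> real mat set" where
  "rlt_relaxation A b =
    {four_block_mat (1\<^sub>m 1) (mat_of_rows (dim_col A) [x]) (mat_of_cols (dim_col A) [x]) X | x X.
      x \<in> carrier_vec (dim_col A) \<and> X \<in> carrier_mat (dim_col A) (dim_col A) \<and>
      four_block_mat (1\<^sub>m 1) (mat_of_rows (dim_col A) [x]) (mat_of_cols (dim_col A) [x]) X
        \<in> psd_cone (dim_col A + 1) \<and>
      (\<forall>i<dim_col A. X $$ (i, i) = x $ i) \<and>
      A *\<^sub>v x = b \<and>
      A * X = mat_of_cols (dim_row A) [b] * mat_of_rows (dim_col A) [x]}"

definition rlt_affine :: "real mat \<Rightarrow> real vec \<Rightarrow> real mat set" where
  "rlt_affine A b =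
    {Y \<in> sym_mats (dim_col A + 1).
      Y $$ (0, 0) = 1 \<and>
      (\<forall>i\<in>{1..dim_col A}. Y $$ (i, i) = Y $$ (0, i)) \<and>
      mat_of_cols (dim_row A) ((- b) # cols A) * Y = 0\<^sub>m (dim_row A) (dim_col A + 1)}"

lemma aug_mult_entry:
  fixes A Y :: "real mat" and b :: "real vec"
  assumes A: "A \<in> carrier_mat q n" and b: "b \<in> carrier_vec q"
    and Y: "Y \<in> carrier_mat (Suc n) (Suc n)" and i: "i < q" and j: "j < Suc n"
  shows "(mat_of_cols q ((- b) # cols A) * Y) $$ (i, j) =
    (\<Sum>k<n. A $$ (i, k) * Y $$ (Suc k, j)) - b $ i * Y $$ (0, j)"
proof -
  have "(mat_of_cols q ((- b) # cols A) * Y) $$ (i, j) =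
      (\<Sum>k<Suc n. mat_of_cols q ((- b) # cols A) $$ (i, k) * Y $$ (k, j))"
    using assms by (simp add: scalar_prod_def atLeast0LessThan del: sum.lessThan_Suc)
  also have "\<dots> = mat_of_cols q ((- b) # cols A) $$ (i, 0) * Y $$ (0, j)
      + (\<Sum>k<n. mat_of_cols q ((- b) # cols A) $$ (i, Suc k) * Y $$ (Suc k, j))"
    by (rule sum.lessThan_Suc_shift)
  also have "(\<Sum>k<n. mat_of_cols q ((- b) # cols A) $$ (i, Suc k) * Y $$ (Suc k, j))
      = (\<Sum>k<n. A $$ (i, k) * Y $$ (Suc k, j))"
    using assms by (intro sum.cong) (auto simp: mat_of_cols_def)
  also have "mat_of_cols q ((- b) # cols A) $$ (i, 0) = - b $ i"
    using assms by (auto simp: mat_of_cols_def)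
  finally show ?thesis by simp
qed

lemma aug_mult_eq_0_iff:
  fixes A Y :: "real mat" and b :: "real vec"
  assumes A: "A \<in> carrier_mat q n" and b: "b \<in> carrier_vec q"
    and Y: "Y \<in> carrier_mat (Suc n) (Suc n)"
  shows "mat_of_cols q ((- b) # cols A) * Y = 0\<^sub>m q (Suc n) \<longleftrightarrow>
    (\<forall>i<q. \<forall>j<Suc n. (\<Sum>k<n. A $$ (i, k) * Y $$ (Suc k, j)) = b $ i * Y $$ (0, j))"
    (is "?M = _ \<longleftrightarrow> ?R")
proof -
  have "?M = 0\<^sub>m q (Suc n) \<longleftrightarrow> (\<forall>i<q. \<forall>j<Suc n. ?M $$ (i, j) = 0)"
  proof
    assume "\<forall>i<q. \<forall>j<Suc n. ?M $$ (i, j) = 0"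
    then show "?M = 0\<^sub>m q (Suc n)"
      using assms by (intro eq_matI) (auto simp del: index_mult_mat(1))
  qed auto
  also have "\<dots> \<longleftrightarrow> ?R"
    using aug_mult_entry[OF A b Y] by auto
  finally show ?thesis .
qed

lemma rlt_relaxation_eq:
  assumes A: "A \<in> carrier_mat q n" and b: "b \<in> carrier_vec q"
  shows "rlt_relaxation A b = rlt_affine A b \<inter> psd_cone (n + 1)"
proof -
  define B where "B x X = four_block_mat (1\<^sub>m 1) (mat_of_rows n [x]) (mat_of_cols n [x]) X"
    for x :: "real vec" and X
  have dims: "dim_row A = q" "dim_col A = n" using A by auto
  have Bc: "B x X \<in> carrier_mat (Suc n) (Suc n)" if "X \<in> carrier_mat n n" for x X
    using that by (auto simp: B_def)
  have B00: "B x X $$ (0, 0) = 1" if "X \<in> carrier_mat n n" for x X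
    using that by (auto simp: B_def)
  have B0: "B x X $$ (0, Suc j) = x $ j" if "X \<in> carrier_mat n n" "j < n" for x X j
    using that by (auto simp: B_def mat_of_rows_def)
  have B1: "B x X $$ (Suc j, 0) = x $ j" if "X \<in> carrier_mat n n" "j < n" for x X j
    using that by (auto simp: B_def mat_of_cols_def)
  have B2: "B x X $$ (Suc i, Suc j) = X $$ (i, j)"
    if "X \<in> carrier_mat n n" "i < n" "j < n" for x X i j
    using that by (auto simp: B_def)
  have split: "(\<forall>j<Suc n. P j) \<longleftrightarrow> P 0 \<and> (\<forall>j<n. P (Suc j))" for P
    by (auto simp: less_Suc_eq_0_disj)
  have iff: "B x X \<in> rlt_affine A b \<longleftrightarrow> B x X \<in> sym_mats (n + 1) \<and>
      (\<forall>i<n. X $$ (i, i) = x $ i) \<and> A *\<^sub>v x = b \<and>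
      A * X = mat_of_cols q [b] * mat_of_rows n [x]"
    if x: "x \<in> carrier_vec n" and X: "X \<in> carrier_mat n n" for x X
  proof -
    have 1: "A *\<^sub>v x = b \<longleftrightarrow> (\<forall>i<q. (\<Sum>k<n. A $$ (i, k) * x $ k) = b $ i)"
      using A b x by (auto simp: vec_eq_iff scalar_prod_def atLeast0LessThan)
    have 2: "A * X = mat_of_cols q [b] * mat_of_rows n [x] \<longleftrightarrow>
        (\<forall>i<q. \<forall>j<n. (\<Sum>k<n. A $$ (i, k) * X $$ (k, j)) = b $ i * x $ j)"
      using A b x X
      by (auto simp: mat_eq_iff scalar_prod_def atLeast0LessThan mat_of_cols_def mat_of_rows_def)
    have 3: "(\<forall>i\<in>{1..n}. B x X $$ (i, i) = B x X $$ (0, i)) \<longleftrightarrow> (\<forall>i<n. X $$ (i, i) = x $ i)"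
    proof -
      have "(\<forall>i\<in>{1..n}. Q i) \<longleftrightarrow> (\<forall>i<n. Q (Suc i))" for Q
        by (metis atLeastAtMost_iff less_eq_Suc_le One_nat_def Suc_le_D Suc_le_mono le0)
      then show ?thesis using B0[OF X] B2[OF X] by auto
    qed
    show ?thesis
      unfolding rlt_affine_def dims mem_Collect_eq
      using aug_mult_eq_0_iff[OF A b Bc[OF X]] 3 B00[OF X]
      by (auto simp: split B0[OF X] B1[OF X] B2[OF X] B00[OF X] 1 2)
  qed
  have ex: "\<exists>x X. x \<in> carrier_vec n \<and> X \<in> carrier_mat n n \<and> Y = B x X"
    if Y: "Y \<in> rlt_affine A b" for Y
  proof -
    have Yc: "Y \<in> carrier_mat (Suc n) (Suc n)" and sym: "transpose_mat Y = Y" and "Y $$ (0, 0) = 1"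
      using Y by (auto simp: rlt_affine_def sym_mats_def dims)
    have symY: "Y $$ (i, j) = Y $$ (j, i)" if "i < Suc n" "j < Suc n" for i j
      using that Yc sym by (metis carrier_matD index_transpose_mat(1))
    let ?x = "vec n (\<lambda>i. Y $$ (0, Suc i))" and ?X = "mat n n (\<lambda>(i, j). Y $$ (Suc i, Suc j))"
    have X: "?X \<in> carrier_mat n n" by simp
    have "Y = B ?x ?X"
    proof (rule eq_matI)
      fix i j assume "i < dim_row (B ?x ?X)" "j < dim_col (B ?x ?X)"
      then have ij: "i < Suc n" "j < Suc n" using Bc[OF X, of ?x] by auto
      show "Y $$ (i, j) = B ?x ?X $$ (i, j)"
        using ij \<open>Y $$ (0, 0) = 1\<close> symY
        by (cases i; cases j) (auto simp: B00[OF X] B0[OF X] B1[OF X] B2[OF X])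
    qed (use Yc Bc[OF X, of ?x] in auto)
    then show ?thesis by (metis X vec_carrier)
  qed
  have R: "rlt_relaxation A b = {B x X | x X. x \<in> carrier_vec n \<and> X \<in> carrier_mat n n \<and>
      B x X \<in> psd_cone (n + 1) \<and> (\<forall>i<n. X $$ (i, i) = x $ i) \<and> A *\<^sub>v x = b \<and>
      A * X = mat_of_cols q [b] * mat_of_rows n [x]}"
    by (simp only: rlt_relaxation_def dims B_def)
  have psd_sym: "Y \<in> sym_mats (n + 1)" if "Y \<in> psd_cone (n + 1)" for Y
    using that by (simp add: psd_cone_def)
  show ?thesis
  proof (intro subset_antisym subsetI)
    fix Y assume "Y \<in> rlt_relaxation A b"
    then show "Y \<in> rlt_affine A b \<inter> psd_cone (n + 1)"
      unfolding R using iff psd_sym by auto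
  next
    fix Y assume Y: "Y \<in> rlt_affine A b \<inter> psd_cone (n + 1)"
    then obtain x X where "x \<in> carrier_vec n" "X \<in> carrier_mat n n" "Y = B x X"
      using ex by blast
    then show "Y \<in> rlt_relaxation A b"
      unfolding R using iff Y by blast
  qed
qed

end

theory Submission
  imports Defs "HOL-Library.Function_Algebras"
begin

text \<open>Faces of the semidefinite cone correspond to subspaces of \<open>\<real>\<^sup>n\<^sup>+\<^sup>1\<close>, and after reduction to the
  kernel \<open>V\<close> of \<open>(-b A)\<close>, of dimension \<open>n + 1 - m\<close>, the remaining certificates are the diagonal forms of
  trace zero in the coordinates \<open>u\<^sub>0 = v\<^sub>0\<close>, \<open>u\<^sub>i = 2 v\<^sub>i - v\<^sub>0\<close>. A first certificate for \<open>V\<close> can be combined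
  with the reduction to \<open>V\<close> into one step, so only the length of chains of diagonal certificates on
  \<open>V\<close> matters. A feasible binary point is a \<open>\<plusminus>1\<close> vector that survives all steps, which bounds the
  length by \<open>dim V - 1 = n - m\<close>. For the bound \<open>m\<close>, a partition of the coordinates and a subspace
  \<open>A \<supseteq> V\<close> that is a product over the blocks are carried along: each certificate merges the blocks that
  it meets, and \<open>2 * dim A - dim V\<close> minus the number of blocks strictly decreases from its initial value
  \<open>m\<close> while staying nonnegative.

  The bound is attained when the feasible \<open>x\<close> are the values at \<open>1, \<dots>, 2 * k\<close> of the polynomials of degree
  at most \<open>k\<close> vanishing at \<open>0\<close>: a certificate restricts to a positive semidefinite Hankel matrix whose
  first antidiagonals vanish, hence all of them but the last, so each step lowers the degree by at most
  one.\<close>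

subsection \<open>Dimensions of subspaces\<close>

text \<open>Written in the coordinates \<open>u\<close>, every matrix of the affine space has unit
  diagonal, so a diagonal form pairs with it to give its trace; orthogonality therefore forces trace
  zero. A plus-minus-one vector gives the same value, which is why it survives. Counting dimensions
  of \<open>V\<close> alone yields only \<open>n - m\<close>. For \<open>m\<close>, the rank of a
  form must be compared with its number of nonzero coefficients, and on \<open>V\<close> this fails
  because \<open>V\<close> is not a product over the coordinates. On the larger space
  \<open>A\<close> the form splits over the blocks, so its rank there is at least the number of
  blocks it meets, and this pays for the blocks lost by merging. With \<open>A\<close> the whole
  space and singleton blocks the potential is 2N - (N - m) - N = m, where N = n + 1. In the example,
  the 2k values together with the value 0 at 0 determine a polynomial of degree at most 2k. The
  diagonal constraints thus become an identity between a sum of squares and a linear combination of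
  the same polynomials, which forces all of them to vanish: the minimal face is small, while the
  constraint subspace contains all degrees from 1 to k, to be removed one at a time.\<close>

instantiation "fun" :: (type, real_vector) real_vector
begin

definition scaleR_fun :: "real \<Rightarrow> ('a \<Rightarrow> 'b) \<Rightarrow> 'a \<Rightarrow> 'b" where
  "scaleR_fun c f = (\<lambda>x. c *\<^sub>R f x)"

instance
  by standard (simp_all add: scaleR_fun_def fun_eq_iff scaleR_add_right scaleR_add_left)

end

lemma scaleR_fun_apply [simp]: "(c *\<^sub>R f) x = c *\<^sub>R f x"
  by (simp add: scaleR_fun_def)

hide_const (open) VectorSpace.subspace

lemma sum_fun_apply: "(\<Sum>a\<in>A. f a) x = (\<Sum>a\<in>A. f a x)"
  by (induction A rule: infinite_finite_induct) auto

text \<open>The type \<open>nat \<Rightarrow> real\<close> is infinite-dimensional, where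
  \<open>dim\<close> is not even monotone; this predicate takes the place of a finite-dimensional
  type.\<close>

definition fin_dim :: "'a::real_vector set \<Rightarrow> bool" where
  "fin_dim U \<longleftrightarrow> (\<exists>F. finite F \<and> U \<subseteq> span F)"

lemma fin_dim_subset: "fin_dim V \<Longrightarrow> U \<subseteq> V \<Longrightarrow> fin_dim U"
  unfolding fin_dim_def by blast

lemma independent_fin_dim:
  assumes "fin_dim V" "B \<subseteq> V" "independent B"
  shows "finite B" "card B \<le> dim V"
proof -
  obtain F where F: "finite F" "V \<subseteq> span F" using assms by (auto simp: fin_dim_def)
  show fB: "finite B"
    using independent_span_bound[OF F(1) assms(3)] assms(2) F(2) by auto
  obtain C where C: "B \<subseteq> C" "C \<subseteq> V" "independent C" "V \<subseteq> span C"
    using maximal_independent_subset_extend[OF assms(2,3)] by blast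
  have "finite C" using independent_span_bound[OF F(1) C(3)] C F by auto
  then show "card B \<le> dim V" using basis_card_eq_dim[of C V] C card_mono by metis
qed

lemma fin_dim_basis:
  assumes "fin_dim V"
  obtains B where "B \<subseteq> V" "independent B" "V \<subseteq> span B" "card B = dim V" "finite B"
  using basis_exists[of V] independent_fin_dim[OF assms] by metis

lemma dim_mono_fin: "fin_dim V \<Longrightarrow> U \<subseteq> V \<Longrightarrow> dim U \<le> dim V"
  by (metis fin_dim_basis dim_le_card order_trans)

lemma dim_less_fin:
  assumes "fin_dim V" "subspace U" "U \<subseteq> V" "x \<in> V" "x \<notin> U"
  shows "dim U < dim V"
proof -
  obtain B where B: "B \<subseteq> U" "independent B" "U \<subseteq> span B" "card B = dim U" "finite B"
    using fin_dim_basis[OF fin_dim_subset[OF assms(1,3)]] .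
  have "span B = U" using B assms(2) by (metis span_minimal subset_antisym)
  then have "x \<notin> span B" using assms by simp
  then have "independent (insert x B)" "x \<notin> B"
    using B(2) real_vector.independent_insertI[of x B] span_base[of x B] by auto
  then show ?thesis
    using independent_fin_dim(2)[of V "insert x B"] assms B by fastforce
qed

lemma dim_hyperplane_le:
  fixes f :: "'a::real_vector \<Rightarrow> real"
  assumes fd: "fin_dim U" and U: "subspace U" and f: "linear f"
  shows "dim U \<le> dim {u\<in>U. f u = 0} + 1"
proof (cases "\<exists>u\<in>U. f u \<noteq> 0")
  case False
  then have "{u\<in>U. f u = 0} = U" by auto
  then show ?thesis by simp
next
  case True
  then obtain w where w: "w \<in> U" "f w \<noteq> 0" by auto
  have fd0: "fin_dim {u\<in>U. f u = 0}" by (rule fin_dim_subset[OF fd]) auto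
  obtain B where B: "{u\<in>U. f u = 0} \<subseteq> span B" "card B = dim {u\<in>U. f u = 0}" "finite B"
    by (rule fin_dim_basis[OF fd0]) (rule that)
  have "U \<subseteq> span (insert w B)"
  proof
    fix u assume u: "u \<in> U"
    define c where "c = f u / f w"
    have "u - c *\<^sub>R w \<in> {u\<in>U. f u = 0}"
      using u w U f by (auto simp: c_def subspace_diff subspace_scale linear_diff linear_scale)
    then have "u - c *\<^sub>R w \<in> span B" using B by blast
    then show "u \<in> span (insert w B)" unfolding span_insert by auto
  qed
  then have "dim U \<le> card (insert w B)" using B(3) by (intro dim_le_card) auto
  also have "\<dots> \<le> card B + 1" using B(3) by (simp add: card_insert_if)
  finally show ?thesis using B(2) by simp
qed

text \<open>By the modular law dim (V' + Z) - dim V' = dim Z - dim (V' \<inter> Z), and likewise for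
  \<open>V\<close>; the hypotheses make the two intersections with \<open>Z\<close> equal. The proof
  exhibits vectors of \<open>Z\<close> that complete a basis of \<open>V'\<close> and stay
  independent next to a basis of \<open>V\<close>.\<close>

lemma dim_sum_diff_le:
  fixes V :: "'a::real_vector set"
  assumes fd: "fin_dim P" and V: "subspace V" "V \<subseteq> P" and V': "subspace V'" "V' \<subseteq> V"
    and Z: "subspace Z" "Z \<subseteq> P" and VZ: "V \<inter> Z \<subseteq> V'" and P: "subspace P"
  shows "dim {x + y |x y. x \<in> V' \<and> y \<in> Z} + dim V \<le> dim {x + y |x y. x \<in> V \<and> y \<in> Z} + dim V'"
proof -
  obtain B where B: "B \<subseteq> V'" "independent B" "V' \<subseteq> span B" "card B = dim V'" "finite B"
    using fin_dim_basis[OF fin_dim_subset[OF fd, of V']] V V' by auto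
  obtain C where C: "B \<subseteq> C" "C \<subseteq> B \<union> Z" "independent C" "B \<union> Z \<subseteq> span C"
    using maximal_independent_subset_extend[of B "B \<union> Z"] B(2) by blast
  have fC: "finite C"
    using independent_fin_dim(1)[OF fd _ C(3)] C B Z V V' by blast
  define F where "F = C - B"
  have FZ: "F \<subseteq> Z" using C by (auto simp: F_def)
  have fF: "finite F" using fC by (simp add: F_def)
  have s1: "{x + y |x y. x \<in> V' \<and> y \<in> Z} \<subseteq> span C"
  proof clarify
    fix x y assume "x \<in> V'" "y \<in> Z"
    then have "x \<in> span C" "y \<in> span C" using B(3) span_mono[OF C(1)] C(4) by auto
    then show "x + y \<in> span C" by (rule span_add)
  qed
  then have "dim {x + y |x y. x \<in> V' \<and> y \<in> Z} \<le> card C" using fC by (rule dim_le_card)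
  also have "\<dots> = card F + card B"
    using C(1) fC B(5) by (simp add: F_def card_Diff_subset card_mono)
  finally have 1: "dim {x + y |x y. x \<in> V' \<and> y \<in> Z} \<le> card F + dim V'" using B by simp
  obtain D where D: "D \<subseteq> V" "independent D" "V \<subseteq> span D" "card D = dim V" "finite D"
    using fin_dim_basis[OF fin_dim_subset[OF fd V(2)]] .
  have spD: "span D = V" using D V by (metis span_minimal subset_antisym)
  have ind: "G \<subseteq> F \<Longrightarrow> independent (G \<union> D) \<and> G \<inter> D = {}" if "finite G" for G
    using that
  proof (induction G)
    case empty
    then show ?case using D by simp
  next
    case (insert g G)
    \<comment> \<open>A relation g = h + d with \<open>h\<close> in the span of \<open>G\<close> and
      \<open>d\<close> in \<open>V\<close> puts \<open>d\<close> into \<open>V \<inter> Z\<close>,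
      hence into the span of \<open>B\<close>; this would make \<open>g\<close> depend on other
      members of the basis \<open>C\<close>.\<close>
    have "g \<notin> span (G \<union> D)"
    proof
      assume "g \<in> span (G \<union> D)"
      then obtain h d where h: "h \<in> span G" "d \<in> V" "g = h + d"
        unfolding span_Un spD by auto
      have "h \<in> Z" using h(1) insert.prems FZ Z span_minimal[of G Z] by auto
      moreover have "g \<in> Z" using insert.prems FZ by auto
      ultimately have "g - h \<in> Z" using Z by (intro subspace_diff)
      then have "d \<in> V \<inter> Z" using h by simp
      then have "d \<in> span B" using VZ B by auto
      then have "g \<in> span (G \<union> B)" using h unfolding span_Un by auto
      moreover have "G \<union> B \<subseteq> C - {g}" using insert.prems insert.hyps C by (auto simp: F_def)
      ultimately have "g \<in> span (C - {g})" using span_mono by blast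
      moreover have "g \<in> C" using insert.prems by (auto simp: F_def)
      ultimately show False using C(3) by (auto simp: real_vector.dependent_def)
    qed
    moreover from this have "g \<notin> D" using span_base[of g "G \<union> D"] by auto
    moreover have IH: "independent (G \<union> D)" "G \<inter> D = {}" using insert by auto
    ultimately show ?case using real_vector.independent_insertI[of g "G \<union> D"] by auto
  qed
  have "independent (F \<union> D)" "F \<inter> D = {}" using ind[OF fF] by auto
  moreover have "F \<union> D \<subseteq> {x + y |x y. x \<in> V \<and> y \<in> Z}"
  proof -
    have "0 \<in> Z" "0 \<in> V" using Z V by (auto simp: subspace_0)
    then show ?thesis using FZ D(1) by force
  qed
  moreover have "{x + y |x y. x \<in> V \<and> y \<in> Z} \<subseteq> P"
  proof clarify
    fix x y assume "x \<in> V" "y \<in> Z"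
    then show "x + y \<in> P" using V Z P subspace_add[of P x y] by blast
  qed
  ultimately have "card (F \<union> D) \<le> dim {x + y |x y. x \<in> V \<and> y \<in> Z}"
    using independent_fin_dim(2)[OF fin_dim_subset[OF fd]] by blast
  moreover have "card (F \<union> D) = card F + dim V"
    using \<open>F \<inter> D = {}\<close> fF D by (simp add: card_Un_disjoint)
  ultimately show ?thesis using 1 by linarith
qed

text \<open>Extend a basis of \<open>W\<close> to one of \<open>A\<close> by a set \<open>F\<close>.
  A vector of \<open>X\<close> already annihilates \<open>W\<close>, so it lies in the radical once
  it annihilates \<open>F\<close>, and each of the dim A - dim W elements of \<open>F\<close> costs
  at most one dimension.\<close>

lemma dim_annihilator_le:
  fixes \<beta> :: "'a::real_vector \<Rightarrow> 'a \<Rightarrow> real"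
  assumes fd: "fin_dim A" and A: "subspace A" and W: "subspace W" "W \<subseteq> A"
    and X: "subspace X" "X \<subseteq> A"
    and lin1: "\<And>y. linear (\<lambda>x. \<beta> x y)" and lin2: "\<And>x. linear (\<beta> x)"
    and perp: "\<And>x w. x \<in> X \<Longrightarrow> w \<in> W \<Longrightarrow> \<beta> x w = 0"
  shows "dim X + dim W \<le> dim A + dim {a\<in>A. \<forall>y\<in>A. \<beta> a y = 0}"
proof -
  obtain B where B: "B \<subseteq> W" "independent B" "W \<subseteq> span B" "card B = dim W" "finite B"
    using fin_dim_basis[OF fin_dim_subset[OF fd W(2)]] .
  obtain C where C: "B \<subseteq> C" "C \<subseteq> A" "independent C" "A \<subseteq> span C"
    using maximal_independent_subset_extend[OF order_trans[OF B(1) W(2)] B(2)] by blast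
  have fC: "finite C" and cC: "card C = dim A"
    using independent_fin_dim(1)[OF fd C(2,3)] basis_card_eq_dim[OF C(2,4,3)] by auto
  define F where "F = C - B"
  have fF: "finite F" using fC by (simp add: F_def)
  have ker: "subspace {x\<in>X. \<forall>y\<in>G. \<beta> x y = 0}" for G
    using X by (auto simp: real_vector.subspace_def linear_add[OF lin1] linear_scale[OF lin1] linear_0[OF lin1])
  have *: "dim X \<le> dim {x\<in>X. \<forall>y\<in>G. \<beta> x y = 0} + card G" if "finite G" for G
    using that
  proof (induction G)
    case (insert g G)
    have "dim {x\<in>X. \<forall>y\<in>G. \<beta> x y = 0} \<le> dim {u \<in> {x\<in>X. \<forall>y\<in>G. \<beta> x y = 0}. \<beta> u g = 0} + 1"
      using fin_dim_subset[OF fd, of "{x\<in>X. \<forall>y\<in>G. \<beta> x y = 0}"] X ker lin1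
      by (intro dim_hyperplane_le) auto
    moreover have "{u \<in> {x\<in>X. \<forall>y\<in>G. \<beta> x y = 0}. \<beta> u g = 0} = {x\<in>X. \<forall>y\<in>insert g G. \<beta> x y = 0}"
      by auto
    ultimately show ?case using insert by simp
  qed simp
  have "{x\<in>X. \<forall>y\<in>F. \<beta> x y = 0} \<subseteq> {a\<in>A. \<forall>y\<in>A. \<beta> a y = 0}"
  proof clarify
    fix x assume x: "x \<in> X" "\<forall>y\<in>F. \<beta> x y = 0"
    have "\<beta> x y = 0" if "y \<in> span C" for y
    proof (rule linear_eq_0_on_span[OF lin2 _ that])
      show "\<beta> x y = 0" if "y \<in> C" for y
        using x that perp B(1) unfolding F_def by blast
    qed
    then show "x \<in> A \<and> (\<forall>y\<in>A. \<beta> x y = 0)" using x X C by blast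
  qed
  then have "dim {x\<in>X. \<forall>y\<in>F. \<beta> x y = 0} \<le> dim {a\<in>A. \<forall>y\<in>A. \<beta> a y = 0}"
    using fin_dim_subset[OF fd, of "{a\<in>A. \<forall>y\<in>A. \<beta> a y = 0}"] by (intro dim_mono_fin) auto
  moreover have "card F + dim W = dim A"
    using card_mono[OF fC C(1)] card_Diff_subset[OF B(5) C(1)] B(4) cC by (simp add: F_def)
  ultimately show ?thesis using *[OF fF] by linarith
qed

text \<open>The vectors \<open>x l\<close> are independent modulo the radical, because their pairing
  with the \<open>y l\<close> is a diagonal matrix with nonzero diagonal. So the rank of the form is
  at least \<open>card S\<close>.\<close>

lemma dim_radical_le:
  fixes \<beta> :: "'a::real_vector \<Rightarrow> 'a \<Rightarrow> real"
  assumes fd: "fin_dim A" and A: "subspace A"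
    and lin1: "\<And>y. linear (\<lambda>x. \<beta> x y)"
    and xy: "\<And>l. l \<in> S \<Longrightarrow> x l \<in> A \<and> y l \<in> A \<and> \<beta> (x l) (y l) \<noteq> 0"
    and off: "\<And>l l'. l \<in> S \<Longrightarrow> l' \<in> S \<Longrightarrow> l \<noteq> l' \<Longrightarrow> \<beta> (x l) (y l') = 0"
    and fS: "finite S"
  shows "dim {a\<in>A. \<forall>y\<in>A. \<beta> a y = 0} + card S \<le> dim A"
proof -
  define R where "R = {a\<in>A. \<forall>y\<in>A. \<beta> a y = 0}"
  have "T \<subseteq> S \<Longrightarrow> dim R + card T \<le> dim (span (R \<union> x ` T))" if "finite T" for T
    using that
  proof (induction T)
    case empty
    then show ?case by simp
  next
    case (insert l T)
    have "\<beta> z (y l) = 0" if "z \<in> span (R \<union> x ` T)" for z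
    proof (rule linear_eq_0_on_span[OF lin1 _ that])
      show "\<beta> z (y l) = 0" if "z \<in> R \<union> x ` T" for z
      proof (cases "z \<in> R")
        case True
        then show ?thesis using xy[of l] insert.prems by (auto simp: R_def)
      next
        case False
        then obtain l' where "l' \<in> T" "z = x l'" using \<open>z \<in> R \<union> x ` T\<close> by auto
        then show ?thesis using off[of l' l] insert by auto
      qed
    qed
    then have "x l \<notin> span (R \<union> x ` T)" using xy[of l] insert.prems by auto
    moreover have "span (R \<union> x ` insert l T) \<subseteq> A"
      using insert.prems xy A by (intro span_minimal) (auto simp: R_def)
    moreover have "fin_dim (span (R \<union> x ` insert l T))"
      by (rule fin_dim_subset[OF fd]) fact
    ultimately have "dim (span (R \<union> x ` T)) < dim (span (R \<union> x ` insert l T))"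
      by (intro dim_less_fin[where x = "x l"]) (auto intro!: span_base span_mono simp: subspace_span)
    then show ?case using insert by simp
  qed
  from this[OF fS] have "dim R + card S \<le> dim (span (R \<union> x ` S))" by simp
  also have "\<dots> \<le> dim A"
    using xy A by (intro dim_mono_fin[OF fd] span_minimal) (auto simp: R_def)
  finally show ?thesis by (simp add: R_def)
qed

lemma rank_nullity:
  fixes f :: "'a::real_vector \<Rightarrow> 'b::real_vector"
  assumes fd: "fin_dim U" and U: "subspace U" and f: "linear f"
  shows "dim U = dim {u\<in>U. f u = 0} + dim (f ` U)"
proof -
  define K where "K = {u\<in>U. f u = 0}"
  have K: "subspace K" "K \<subseteq> U"
    using U f by (auto simp: K_def real_vector.subspace_def linear_add linear_scale linear_0)
  obtain B where B: "B \<subseteq> K" "independent B" "K \<subseteq> span B" "card B = dim K" "finite B"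
    using fin_dim_basis[OF fin_dim_subset[OF fd K(2)]] .
  obtain C where C: "B \<subseteq> C" "C \<subseteq> U" "independent C" "U \<subseteq> span C"
    using maximal_independent_subset_extend[OF order_trans[OF B(1) K(2)] B(2)] by blast
  have fC: "finite C" and cC: "card C = dim U"
    using independent_fin_dim(1)[OF fd C(2,3)] basis_card_eq_dim[OF C(2,4,3)] by auto
  define F where "F = C - B"
  have fF: "finite F" using fC by (simp add: F_def)
  have ind: "G \<subseteq> F \<Longrightarrow> independent (f ` G) \<and> card (f ` G) = card G" if "finite G" for G
    using that
  proof (induction G)
    case empty
    show ?case by (simp add: real_vector.independent_empty)
  next
    case (insert g G)
    have "f g \<notin> span (f ` G)"
    proof
      assume "f g \<in> span (f ` G)"
      then obtain h where h: "h \<in> span G" "f g = f h" using linear_span_image[OF f, of G] by auto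
      have "h \<in> U" using h(1) insert.prems C(2) span_minimal[OF _ U, of G] by (auto simp: F_def)
      moreover have "g \<in> U" using insert.prems C(2) by (auto simp: F_def)
      ultimately have "g - h \<in> U" using U by (intro subspace_diff)
      moreover have "f (g - h) = 0" using h f by (simp add: linear_diff)
      ultimately have "g - h \<in> span B" using B(3) by (auto simp: K_def)
      then have "h + (g - h) \<in> span (G \<union> B)" using h(1) unfolding span_Un by blast
      moreover have "G \<union> B \<subseteq> C - {g}" using insert.prems insert.hyps C by (auto simp: F_def)
      ultimately have "g \<in> span (C - {g})" using span_mono[of "G \<union> B" "C - {g}"] by auto
      moreover have "g \<in> C" using insert.prems by (auto simp: F_def)
      ultimately show False using C(3) by (auto simp: real_vector.dependent_def)
    qed
    moreover from this have "f g \<notin> f ` G" using span_base by blast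
    moreover have "independent (f ` G)" "card (f ` G) = card G" using insert by auto
    ultimately show ?case
      using real_vector.independent_insertI[of "f g" "f ` G"] insert.hyps by auto
  qed
  have "f ` U \<subseteq> span (f ` F)"
  proof clarify
    fix u assume "u \<in> U"
    then have "u \<in> span (F \<union> B)" using C by (auto simp: F_def Un_absorb2)
    then obtain a b where ab: "a \<in> span F" "b \<in> span B" "u = a + b" unfolding span_Un by auto
    have "b \<in> K" using ab B K span_minimal by blast
    then have "f u = f a" using ab f by (simp add: linear_add K_def)
    then show "f u \<in> span (f ` F)" using ab f by (simp add: linear_span_image)
  qed
  then have "card (f ` F) = dim (f ` U)"
    using C ind[OF fF] by (intro basis_card_eq_dim) (auto simp: F_def)
  moreover have "card (f ` F) = card F" using ind[OF fF] by simp
  moreover have "card F + card B = card C"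
    using card_mono[OF fC C(1)] card_Diff_subset[OF B(5) C(1)] by (simp add: F_def)
  ultimately show ?thesis using B cC by (simp add: K_def)
qed

subsection \<open>Finitely supported functions and semidefinite forms\<close>

text \<open>A copy of N-dimensional space inside one fixed type, so that \<open>span\<close>,
  \<open>dim\<close> and \<open>subspace\<close> apply for every N.\<close>

definition supp :: "nat \<Rightarrow> (nat \<Rightarrow> real) set" where
  "supp N = {f. \<forall>i\<ge>N. f i = 0}"

definition unit_fun :: "nat \<Rightarrow> nat \<Rightarrow> real" where
  "unit_fun i = (\<lambda>j. if j = i then 1 else 0)"

lemma subspace_supp: "subspace (supp N)"
  by (auto simp: supp_def real_vector.subspace_def)

lemma supp_expand:
  assumes "f \<in> supp N"
  shows "f = (\<Sum>i<N. f i *\<^sub>R unit_fun i)"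
proof
  fix j
  have "(\<Sum>i<N. f i *\<^sub>R unit_fun i) j = (\<Sum>i<N. if i = j then f i else 0)"
    unfolding sum_fun_apply by (intro sum.cong) (auto simp: unit_fun_def)
  also have "\<dots> = f j" using assms by (auto simp: supp_def)
  finally show "f j = (\<Sum>i<N. f i *\<^sub>R unit_fun i) j" by simp
qed

lemma supp_span: "supp N \<subseteq> span (unit_fun ` {..<N})"
proof
  fix f assume "f \<in> supp N"
  then have "f = (\<Sum>i<N. f i *\<^sub>R unit_fun i)" by (rule supp_expand)
  also have "\<dots> \<in> span (unit_fun ` {..<N})"
    by (intro span_sum span_scale span_base) auto
  finally show "f \<in> span (unit_fun ` {..<N})" .
qed

lemma fin_dim_supp: "fin_dim (supp N)"
  using supp_span unfolding fin_dim_def by blast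

lemma dim_supp: "dim (supp N) = N"
proof (rule antisym)
  have "dim (supp N) \<le> card (unit_fun ` {..<N})"
    using supp_span by (rule dim_le_card) auto
  also have "\<dots> \<le> N" using card_image_le[of "{..<N}" unit_fun] by simp
  finally show "dim (supp N) \<le> N" .
  show "N \<le> dim (supp N)"
  proof (induction N)
    case (Suc N)
    have "dim (supp N) < dim (supp (Suc N))"
      by (rule dim_less_fin[OF fin_dim_supp subspace_supp, where x = "unit_fun N"])
        (auto simp: supp_def unit_fun_def)
    then show ?case using Suc by simp
  qed simp
qed

lemma psd_form_null:
  fixes \<beta> :: "'a::real_vector \<Rightarrow> 'a \<Rightarrow> real"
  assumes U: "subspace U" and lin1: "\<And>y. linear (\<lambda>x. \<beta> x y)" and lin2: "\<And>x. linear (\<beta> x)"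
    and sym: "\<And>x y. \<beta> x y = \<beta> y x"
    and psd: "\<And>u. u \<in> U \<Longrightarrow> 0 \<le> \<beta> u u"
    and u: "u \<in> U" "\<beta> u u = 0" and v: "v \<in> U"
  shows "\<beta> u v = 0"
proof (rule ccontr)
  assume nz: "\<beta> u v \<noteq> 0"
  \<comment> \<open>As \<open>u\<close> is isotropic, the value at \<open>v + c *\<^sub>R u\<close>
    is affine in \<open>c\<close> with slope \<open>2 * \<beta> u v\<close>; this \<open>c\<close>
    makes it -1.\<close>
  define c where "c = - (\<beta> v v + 1) / (2 * \<beta> u v)"
  have "v + c *\<^sub>R u \<in> U" using U u v by (intro subspace_add subspace_scale)
  then have "0 \<le> \<beta> (v + c *\<^sub>R u) (v + c *\<^sub>R u)" by (rule psd)
  also have "\<dots> = \<beta> v v + 2 * c * \<beta> u v"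
    using u sym[of v u]
    by (simp add: linear_add[OF lin1] linear_add[OF lin2] linear_scale[OF lin1] linear_scale[OF lin2])
  also have "\<dots> = -1" using nz by (simp add: c_def field_simps)
  finally show False by simp
qed

lemma subspace_psd_null:
  fixes \<beta> :: "'a::real_vector \<Rightarrow> 'a \<Rightarrow> real"
  assumes U: "subspace U" and lin1: "\<And>y. linear (\<lambda>x. \<beta> x y)" and lin2: "\<And>x. linear (\<beta> x)"
    and sym: "\<And>x y. \<beta> x y = \<beta> y x"
    and psd: "\<And>u. u \<in> U \<Longrightarrow> 0 \<le> \<beta> u u"
  shows "{u\<in>U. \<beta> u u = 0} = {u\<in>U. \<forall>v\<in>U. \<beta> v u = 0}" "subspace {u\<in>U. \<beta> u u = 0}"
proof -
  show 1: "{u\<in>U. \<beta> u u = 0} = {u\<in>U. \<forall>v\<in>U. \<beta> v u = 0}"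
    using psd_form_null[OF U lin1 lin2 sym psd] sym by (metis (lifting))
  show "subspace {u\<in>U. \<beta> u u = 0}"
    unfolding 1 using U
    by (auto simp: real_vector.subspace_def linear_add[OF lin2] linear_scale[OF lin2] linear_0[OF lin2])
qed

subsection \<open>Diagonal forms\<close>

definition diag_form :: "nat \<Rightarrow> (nat \<Rightarrow> real) \<Rightarrow> (nat \<Rightarrow> real) \<Rightarrow> (nat \<Rightarrow> real) \<Rightarrow> real" where
  "diag_form N d x y = (\<Sum>i<N. d i * x i * y i)"

lemma linear_diag_form: "linear (diag_form N d x)" "linear (\<lambda>x. diag_form N d x y)"
  by (auto intro!: linearI simp: diag_form_def algebra_simps sum.distrib sum_distrib_left)

lemma diag_form_sym: "diag_form N d x y = diag_form N d y x"
  by (simp add: diag_form_def mult_ac)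

text \<open>A facial reduction step seen on subspaces: \<open>d\<close> is the certificate, and the
  condition on its sum is what orthogonality to the affine space leaves of a diagonal form.\<close>

definition diag_reduces :: "nat \<Rightarrow> (nat \<Rightarrow> real) set \<Rightarrow> (nat \<Rightarrow> real) set \<Rightarrow> bool" where
  "diag_reduces N U U' \<longleftrightarrow> (\<exists>d. (\<Sum>i<N. d i) = 0 \<and> (\<forall>u\<in>U. 0 \<le> diag_form N d u u) \<and>
     U' = {u\<in>U. diag_form N d u u = 0} \<and> U' \<noteq> U)"

text \<open>At a vector with entries plus or minus one the form takes the value of its trace, which
  is zero. This is how a feasible binary point survives every step.\<close>

lemma diag_reducesD:
  assumes "diag_reduces N U U'" "subspace U"
  shows "subspace U'" "U' \<subset> U" "e \<in> U \<Longrightarrow> \<forall>i<N. (e i)\<^sup>2 = 1 \<Longrightarrow> e \<in> U'"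
proof -
  obtain d where d: "(\<Sum>i<N. d i) = 0" "\<forall>u\<in>U. 0 \<le> diag_form N d u u"
    "U' = {u\<in>U. diag_form N d u u = 0}" "U' \<noteq> U"
    using assms by (auto simp: diag_reduces_def)
  show "subspace U'" unfolding d(3)
    by (rule subspace_psd_null[OF assms(2) linear_diag_form(2) linear_diag_form(1) diag_form_sym]) (use d in auto)
  show "U' \<subset> U" using d by auto
  assume e: "e \<in> U" "\<forall>i<N. (e i)\<^sup>2 = 1"
  have "diag_form N d e e = (\<Sum>i<N. d i)"
    unfolding diag_form_def using e(2) by (intro sum.cong) (auto simp: power2_eq_square mult.assoc)
  then show "e \<in> U'" using d e by auto
qed

text \<open>The blocks are the fibres of \<open>lab\<close>; a space closed under all these
  restrictions is a product over the blocks.\<close>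

definition restr :: "(nat \<Rightarrow> nat) \<Rightarrow> nat set \<Rightarrow> (nat \<Rightarrow> real) \<Rightarrow> nat \<Rightarrow> real" where
  "restr lab T a = (\<lambda>i. if lab i \<in> T then a i else 0)"

lemma diag_form_restr_sum:
  "diag_form N d x y = (\<Sum>l\<in>lab ` {..<N}. diag_form N d (restr lab {l} x) y)"
proof -
  have "diag_form N d x y = (\<Sum>l\<in>lab ` {..<N}. \<Sum>i | i \<in> {..<N} \<and> lab i = l. d i * x i * y i)"
    unfolding diag_form_def by (rule sum.image_gen) simp
  also have "\<dots> = (\<Sum>l\<in>lab ` {..<N}. diag_form N d (restr lab {l} x) y)"
  proof (intro sum.cong refl)
    fix l
    have "(\<Sum>i | i \<in> {..<N} \<and> lab i = l. d i * x i * y i)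
        = (\<Sum>i<N. if lab i = l then d i * x i * y i else 0)"
      by (rule sum.inter_filter) simp
    also have "\<dots> = diag_form N d (restr lab {l} x) y"
      unfolding diag_form_def restr_def by (intro sum.cong) auto
    finally show "(\<Sum>i | i \<in> {..<N} \<and> lab i = l. d i * x i * y i) = diag_form N d (restr lab {l} x) y" .
  qed
  finally show ?thesis .
qed

text \<open>The labels partition the coordinates into blocks and \<open>A\<close> is a product over the blocks. The
  potential \<open>2 * dim A - dim V - card (lab ` {..<N})\<close> drops in every step when the blocks on which
  the form does not vanish are merged into one, on which \<open>A\<close> is replaced by the projection of the
  new \<open>V\<close>.\<close>

lemma chain_potential:
  assumes "\<forall>j<k. diag_reduces N (f j) (f (Suc j))" "subspace (f 0)" "f 0 \<subseteq> A"
    "subspace A" "A \<subseteq> supp N" "\<And>a T. a \<in> A \<Longrightarrow> restr lab T a \<in> A"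
    "e \<in> f 0" "\<forall>i<N. (e i)\<^sup>2 = 1"
  shows "k + card (lab ` {..<N}) + dim (f 0) \<le> 2 * dim A"
  using assms
proof (induction k arbitrary: f A lab)
  case 0
  have fdA: "fin_dim A" using fin_dim_subset[OF fin_dim_supp] 0 by blast
  \<comment> \<open>The potential is nonnegative: the restrictions of \<open>e\<close> to the blocks
    are nonzero, lie in \<open>A\<close> and are orthogonal for the standard form, so
    \<open>A\<close> has at least as many dimensions as there are blocks.\<close>
  have "dim {a\<in>A. \<forall>y\<in>A. diag_form N (\<lambda>_. 1) a y = 0} + card (lab ` {..<N}) \<le> dim A"
  proof (rule dim_radical_le[OF fdA \<open>subspace A\<close> linear_diag_form(2), where
        x = "\<lambda>l. restr lab {l} e" and y = "\<lambda>l. restr lab {l} e"])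
    fix l assume "l \<in> lab ` {..<N}"
    then obtain i where i: "i < N" "lab i = l" by auto
    have eA: "e \<in> A" using 0 by auto
    have "0 < diag_form N (\<lambda>_. 1) (restr lab {l} e) (restr lab {l} e)"
      unfolding diag_form_def
    proof (rule sum_pos2[of _ i])
      have "(e i)\<^sup>2 = 1" using 0 i by auto
      then show "0 < 1 * restr lab {l} e i * restr lab {l} e i"
        using i by (simp add: restr_def power2_eq_square)
    qed (use i in auto)
    then show "restr lab {l} e \<in> A \<and> restr lab {l} e \<in> A
        \<and> diag_form N (\<lambda>_. 1) (restr lab {l} e) (restr lab {l} e) \<noteq> 0"
      using 0(6)[OF eA] by auto
  next
    fix l l' :: nat assume "l \<noteq> l'"
    then show "diag_form N (\<lambda>_. 1) (restr lab {l} e) (restr lab {l'} e) = 0"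
      unfolding diag_form_def by (intro sum.neutral) (auto simp: restr_def)
  qed simp
  moreover have "dim (f 0) \<le> dim A" using dim_mono_fin[OF fdA] 0 by blast
  ultimately show ?case by linarith
next
  case (Suc k)
  define V where "V = f 0"
  define V' where "V' = f 1"
  have red: "diag_reduces N V V'" using Suc.prems(1) by (simp add: V_def V'_def)
  then obtain d where d: "(\<Sum>i<N. d i) = 0" "\<forall>u\<in>V. 0 \<le> diag_form N d u u"
    "V' = {u\<in>V. diag_form N d u u = 0}" "V' \<noteq> V"
    by (auto simp: diag_reduces_def)
  have V: "subspace V" "V \<subseteq> A" "e \<in> V" using Suc.prems by (auto simp: V_def)
  have A: "subspace A" "A \<subseteq> supp N" using Suc.prems by auto
  have V': "subspace V'" "V' \<subset> V" "e \<in> V'"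
    using diag_reducesD[OF red V(1)] V(3) Suc.prems(8) by auto
  have rA: "restr lab T a \<in> A" if "a \<in> A" for a T using that by (rule Suc.prems(6))
  have fdA: "fin_dim A" using fin_dim_subset[OF fin_dim_supp A(2)] .
  \<comment> \<open>\<open>S\<close> collects the blocks that the form meets on \<open>A\<close>.
    The vectors of \<open>A\<close> that vanish on these blocks form \<open>Z\<close>, which is
    contained in the radical on \<open>A\<close>.\<close>
  define S where "S = {l \<in> lab ` {..<N}. \<exists>x\<in>A. \<exists>y\<in>A. diag_form N d (restr lab {l} x) y \<noteq> 0}"
  have fS: "finite S" by (simp add: S_def)
  define Z where "Z = {a\<in>A. \<forall>i. lab i \<in> S \<longrightarrow> a i = 0}"
  have Z: "subspace Z" "Z \<subseteq> A"
    using A by (auto simp: Z_def real_vector.subspace_def)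
  have Zrad: "diag_form N d z y = 0" if "z \<in> Z" "y \<in> A" for z y
  proof -
    have "diag_form N d (restr lab {l} z) y = 0" if l: "l \<in> lab ` {..<N}" for l
    proof (cases "l \<in> S")
      case True
      then have "restr lab {l} z = 0" using \<open>z \<in> Z\<close> by (auto simp: restr_def Z_def fun_eq_iff)
      then show ?thesis by (simp add: diag_form_def)
    next
      case False
      then show ?thesis using l \<open>z \<in> Z\<close> \<open>y \<in> A\<close> by (auto simp: S_def Z_def)
    qed
    then show ?thesis unfolding diag_form_restr_sum[of N d z y lab] by (intro sum.neutral) blast
  qed
  have "S \<noteq> {}"
  proof
    assume "S = {}"
    then have "Z = A" by (auto simp: Z_def)
    then have "V' = V" using Zrad V d(3) by auto
    then show False using d(4) by simp
  qed
  then obtain s0 where s0: "s0 \<in> S" by auto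
  \<comment> \<open>On the merged block the new product space is the projection of
    \<open>V'\<close>, and on the other blocks it is still that of \<open>A\<close>. The companion
    \<open>Vp\<close> adds the same \<open>Z\<close> to \<open>V\<close>, so that the two sums can
    be compared.\<close>
  define A' where "A' = {x + y |x y. x \<in> V' \<and> y \<in> Z}"
  define Vp where "Vp = {x + y |x y. x \<in> V \<and> y \<in> Z}"
  have zero: "0 \<in> V'" "0 \<in> Z" using V' Z by (auto simp: subspace_0)
  have sA': "subspace A'" "A' \<subseteq> A"
  proof -
    show "subspace A'" unfolding A'_def using V' Z by (intro subspace_sums)
    show "A' \<subseteq> A" unfolding A'_def using V' V Z A subspace_add[of A] by blast
  qed
  have sVp: "subspace Vp" "Vp \<subseteq> A"
  proof -
    show "subspace Vp" unfolding Vp_def using V Z by (intro subspace_sums)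
    show "Vp \<subseteq> A" unfolding Vp_def using V Z A subspace_add[of A] by blast
  qed
  have "V \<inter> Z \<subseteq> V'" using Zrad V d(3) by auto
  then have 1: "dim A' + dim V \<le> dim Vp + dim V'"
    unfolding A'_def Vp_def using V V' Z A by (intro dim_sum_diff_le[OF fdA]) auto
  \<comment> \<open>\<open>V'\<close> is the radical of the form on \<open>V\<close>, by
    semidefiniteness, and \<open>Z\<close> lies in the radical on all of \<open>A\<close>; so
    \<open>A'\<close> annihilates \<open>Vp\<close>.\<close>
  have "diag_form N d x w = 0" if xw: "x \<in> A'" "w \<in> Vp" for x w
  proof -
    obtain a b where ab: "x = a + b" "a \<in> V'" "b \<in> Z" using xw by (auto simp: A'_def)
    obtain v z where vz: "w = v + z" "v \<in> V" "z \<in> Z" using xw by (auto simp: Vp_def)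
    have "diag_form N d a v = 0"
      by (rule psd_form_null[OF V(1) linear_diag_form(2) linear_diag_form(1) diag_form_sym]) (use d ab vz in auto)
    moreover have "diag_form N d b w = 0" using Zrad[OF ab(3)] xw sVp by auto
    moreover have "diag_form N d a z = 0"
      using Zrad[OF vz(3), of a] ab V V' by (subst diag_form_sym) auto
    ultimately show ?thesis
      by (simp add: ab(1) linear_add[OF linear_diag_form(2)]) (simp add: vz(1) linear_add[OF linear_diag_form(1)])
  qed
  then have 2: "dim A' + dim Vp \<le> dim A + dim {a\<in>A. \<forall>y\<in>A. diag_form N d a y = 0}"
    by (intro dim_annihilator_le[OF fdA A(1) sVp sA' linear_diag_form(2) linear_diag_form(1)]) auto
  have "\<forall>l\<in>S. \<exists>x y. x \<in> A \<and> y \<in> A \<and> diag_form N d (restr lab {l} x) y \<noteq> 0"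
    by (auto simp: S_def)
  then obtain x y where xy: "\<And>l. l \<in> S \<Longrightarrow> x l \<in> A \<and> y l \<in> A \<and> diag_form N d (restr lab {l} (x l)) (y l) \<noteq> 0"
    by metis
  \<comment> \<open>Different blocks do not interact under a diagonal form, and each block of
    \<open>S\<close> supplies a pair with nonzero value, hence the rank on \<open>A\<close> is at
    least \<open>card S\<close>.\<close>
  have 3: "dim {a\<in>A. \<forall>y\<in>A. diag_form N d a y = 0} + card S \<le> dim A"
  proof (rule dim_radical_le[OF fdA A(1) linear_diag_form(2), where
        x = "\<lambda>l. restr lab {l} (x l)" and y = "\<lambda>l. restr lab {l} (y l)"])
    fix l assume l: "l \<in> S"
    have "diag_form N d (restr lab {l} (x l)) (restr lab {l} (y l)) = diag_form N d (restr lab {l} (x l)) (y l)"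
      unfolding diag_form_def restr_def by (intro sum.cong) auto
    then show "restr lab {l} (x l) \<in> A \<and> restr lab {l} (y l) \<in> A
        \<and> diag_form N d (restr lab {l} (x l)) (restr lab {l} (y l)) \<noteq> 0"
      using xy[OF l] rA by auto
  next
    fix l l' :: nat assume "l \<noteq> l'"
    then show "diag_form N d (restr lab {l} (x l)) (restr lab {l'} (y l')) = 0"
      unfolding diag_form_def by (intro sum.neutral) (auto simp: restr_def)
  qed (fact fS)
  \<comment> \<open>All labels in \<open>S\<close> become the single label \<open>s0\<close>, so the
    number of blocks falls by \<open>card S - 1\<close>.\<close>
  define lab' where "lab' i = (if lab i \<in> S then s0 else lab i)" for i
  have "S \<subseteq> lab ` {..<N}" by (auto simp: S_def)
  have "lab' ` {..<N} = insert s0 (lab ` {..<N} - S)"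
  proof
    show "insert s0 (lab ` {..<N} - S) \<subseteq> lab' ` {..<N}"
    proof
      fix l assume "l \<in> insert s0 (lab ` {..<N} - S)"
      then consider "l = s0" | "l \<in> lab ` {..<N}" "l \<notin> S" by auto
      then show "l \<in> lab' ` {..<N}"
      proof cases
        case 1
        then obtain i where "i < N" "lab i = l" using s0 \<open>S \<subseteq> lab ` {..<N}\<close> by auto
        then show ?thesis using 1 s0 by (intro image_eqI[of _ _ i]) (auto simp: lab'_def)
      next
        case 2
        then obtain i where "i < N" "lab i = l" by auto
        then show ?thesis using 2 by (intro image_eqI[of _ _ i]) (auto simp: lab'_def)
      qed
    qed
  qed (auto simp: lab'_def)
  then have "card (lab' ` {..<N}) = card (lab ` {..<N} - S) + 1" using s0 by simp
  also have "card (lab ` {..<N} - S) = card (lab ` {..<N}) - card S"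
    using \<open>S \<subseteq> lab ` {..<N}\<close> fS by (simp add: card_Diff_subset)
  finally have 4: "card (lab' ` {..<N}) + card S = card (lab ` {..<N}) + 1"
    using card_mono[OF _ \<open>S \<subseteq> lab ` {..<N}\<close>] by simp
  have cl: "restr lab' T a \<in> A'" if aA: "a \<in> A'" for a T
  proof -
    obtain v z where vz: "a = v + z" "v \<in> V'" "z \<in> Z" using aA by (auto simp: A'_def)
    define T' where "T' = {l. (if l \<in> S then s0 else l) \<in> T}"
    have T': "restr lab' T a = restr lab T' a" by (auto simp: restr_def lab'_def T'_def)
    have inA: "v \<in> A" "z \<in> A" using vz V V' Z by auto
    show ?thesis
    \<comment> \<open>A restriction keeps the merged block entirely or drops it entirely. If it is
      kept, the result differs from \<open>v\<close> by a vector that vanishes on the merged block;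
      if it is dropped, the result itself vanishes there. Both belong to \<open>Z\<close>.\<close>
    proof (cases "s0 \<in> T")
      case True
      have "restr lab T' z - restr lab (- T') v \<in> A"
        using inA rA by (intro subspace_diff[OF A(1)])
      then have "restr lab T' z - restr lab (- T') v \<in> Z"
        using vz(3) True by (auto simp: Z_def restr_def T'_def)
      moreover have "restr lab T' a = v + (restr lab T' z - restr lab (- T') v)"
        by (auto simp: restr_def vz(1))
      ultimately show ?thesis unfolding T' A'_def using vz(2) by blast
    next
      case False
      have "restr lab T' a \<in> Z"
        using rA[of a T'] \<open>a \<in> A'\<close> sA'(2) False by (auto simp: Z_def restr_def T'_def)
      moreover have "restr lab T' a = 0 + restr lab T' a" by simp
      ultimately show ?thesis unfolding T' A'_def using zero(1) by blast
    qed
  qed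
  have "k + card (lab' ` {..<N}) + dim (f (Suc 0)) \<le> 2 * dim A'"
  proof (rule Suc.IH[of "\<lambda>j. f (Suc j)"])
    show "\<forall>j<k. diag_reduces N (f (Suc j)) (f (Suc (Suc j)))" using Suc.prems(1) by auto
    show "f (Suc 0) \<subseteq> A'"
    proof
      fix v assume "v \<in> f (Suc 0)"
      then have "v \<in> V'" by (simp add: V'_def)
      then have "v + 0 \<in> A'" unfolding A'_def using zero(2) by blast
      then show "v \<in> A'" by simp
    qed
    show "A' \<subseteq> supp N" using sA' A by auto
  qed (use V' sA' cl Suc.prems(8) in \<open>auto simp: V'_def\<close>)
  then have "k + card (lab' ` {..<N}) + dim V' \<le> 2 * dim A'" by (simp add: V'_def)
  \<comment> \<open>Adding 1, 2 and 3 gives 2 dim A' + dim V + card S <= 2 dim A + dim V'. With 4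
    this is a drop of the potential by at least one.\<close>
  then have "Suc k + card (lab ` {..<N}) + dim V \<le> 2 * dim A" using 1 2 3 4 by linarith
  then show ?case by (simp add: V_def)
qed

lemma chain_subspace:
  assumes "\<forall>j<k. diag_reduces N (f j) (f (Suc j))" "subspace (f 0)" "e \<in> f 0" "\<forall>i<N. (e i)\<^sup>2 = 1"
    "j \<le> k"
  shows "subspace (f j) \<and> e \<in> f j \<and> f j \<subseteq> f 0"
  using assms(5)
proof (induction j)
  case (Suc j)
  then have "diag_reduces N (f j) (f (Suc j))" "subspace (f j)" "e \<in> f j" "f j \<subseteq> f 0"
    using assms(1) by auto
  then show ?case using diag_reducesD(1,2)[of N "f j" "f (Suc j)"]
      diag_reducesD(3)[of N "f j" "f (Suc j)" e] assms(4) by auto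
qed (use assms in auto)

text \<open>The potential argument started at the whole space with every coordinate its own block: k
  + N + dim (f 0) <= 2N.\<close>

lemma chain_length_le_codim:
  assumes "\<forall>j<k. diag_reduces N (f j) (f (Suc j))" "subspace (f 0)" "f 0 \<subseteq> supp N"
    "e \<in> f 0" "\<forall>i<N. (e i)\<^sup>2 = 1"
  shows "k + dim (f 0) \<le> N"
proof -
  have "k + card ((\<lambda>i. i) ` {..<N}) + dim (f 0) \<le> 2 * dim (supp N)"
    using assms subspace_supp by (intro chain_potential) (auto simp: supp_def restr_def)
  then show ?thesis by (simp add: dim_supp)
qed

text \<open>Every step loses a dimension and the last subspace still contains the nonzero vector
  \<open>e\<close>, whence the strict inequality.\<close>

lemma chain_length_less_dim:
  assumes "\<forall>j<k. diag_reduces N (f j) (f (Suc j))" "subspace (f 0)" "f 0 \<subseteq> supp N"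
    "e \<in> f 0" "\<forall>i<N. (e i)\<^sup>2 = 1" "0 < N"
  shows "k < dim (f 0)"
proof -
  have fd: "fin_dim (f 0)" using fin_dim_subset[OF fin_dim_supp assms(3)] .
  have "j \<le> k \<Longrightarrow> dim (f j) + j \<le> dim (f 0)" for j
  proof (induction j)
    case (Suc j)
    have j: "subspace (f j)" "f j \<subseteq> f 0" using chain_subspace[OF assms(1,2,4,5), of j] Suc by auto
    have "diag_reduces N (f j) (f (Suc j))" using assms(1) Suc by auto
    then obtain x where "x \<in> f j" "x \<notin> f (Suc j)" "subspace (f (Suc j))" "f (Suc j) \<subseteq> f j"
      using diag_reducesD(1,2)[OF _ j(1)] by blast
    then have "dim (f (Suc j)) < dim (f j)"
      using fin_dim_subset[OF fd j(2)] by (intro dim_less_fin[of _ _ x]) auto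
    then show ?case using Suc by simp
  qed simp
  then have *: "dim (f k) + k \<le> dim (f 0)" by simp
  have k: "subspace (f k)" "e \<in> f k" "f k \<subseteq> f 0" using chain_subspace[OF assms(1,2,4,5), of k] by auto
  have "(e 0)\<^sup>2 = 1" using assms by auto
  then have "e \<noteq> 0" by auto
  have "subspace {0::nat \<Rightarrow> real}" by (auto simp: real_vector.subspace_def)
  then have "dim {0::nat \<Rightarrow> real} < dim (f k)"
    using k \<open>e \<noteq> 0\<close> fin_dim_subset[OF fd k(3)]
    by (intro dim_less_fin[of _ _ e]) (auto simp: subspace_0)
  then show ?thesis using * by simp
qed

subsection \<open>A theorem of the alternative\<close>

text \<open>A convex cone, possibly containing lines, for which \<open>p\<close> is an order unit.
  The condition on \<open>- p\<close> is what permits a functional that is nonnegative on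
  \<open>Q\<close> and takes the value 1 at \<open>p\<close>.\<close>

definition pointed_wedge :: "(nat \<Rightarrow> real) set \<Rightarrow> (nat \<Rightarrow> real) \<Rightarrow> bool" where
  "pointed_wedge Q p \<longleftrightarrow> p \<in> Q \<and> - p \<notin> Q \<and> (\<forall>x\<in>Q. \<forall>y\<in>Q. x + y \<in> Q) \<and>
     (\<forall>x\<in>Q. \<forall>c\<ge>0. c *\<^sub>R x \<in> Q) \<and> (\<forall>x\<in>Q. \<exists>t\<ge>0. t *\<^sub>R p - x \<in> Q)"

lemma pointed_wedge_scaleR_nonneg:
  assumes "pointed_wedge Q p" "c *\<^sub>R p \<in> Q"
  shows "0 \<le> c"
proof (rule ccontr)
  assume "\<not> 0 \<le> c"
  then have c: "c < 0" by simp
  have "\<forall>x\<in>Q. \<forall>c\<ge>0. c *\<^sub>R x \<in> Q" "- p \<notin> Q" using assms by (simp_all add: pointed_wedge_def)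
  moreover have "0 \<le> 1 / - c" using c by simp
  ultimately have "(1 / - c) *\<^sub>R (c *\<^sub>R p) \<in> Q" using assms(2) by blast
  moreover have "(1 / - c) *\<^sub>R (c *\<^sub>R p) = - p" using c by (simp add: fun_eq_iff)
  ultimately show False using \<open>- p \<notin> Q\<close> by simp
qed

text \<open>One step of M. Riesz's extension theorem: instead of extending a positive functional to \<open>x\<close> with
  value \<open>s\<close>, the cone is enlarged by the line on which the extension vanishes.\<close>

lemma pointed_wedge_extend:
  assumes Q: "pointed_wedge Q p"
  obtains s where "pointed_wedge {q + t *\<^sub>R (x - s *\<^sub>R p) |q t. q \<in> Q} p"
proof -
  have add: "a + b \<in> Q" if "a \<in> Q" "b \<in> Q" for a b using Q that by (auto simp: pointed_wedge_def)
  have scale: "c *\<^sub>R a \<in> Q" if "a \<in> Q" "0 \<le> c" for a c using Q that by (auto simp: pointed_wedge_def)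
  have unit: "\<exists>t\<ge>0. t *\<^sub>R p - a \<in> Q" if "a \<in> Q" for a using Q that by (auto simp: pointed_wedge_def)
  \<comment> \<open>\<open>L\<close> and \<open>R\<close> hold the lower and upper bounds that
    positivity imposes on the value at \<open>x\<close> of a functional with value 1 at
    \<open>p\<close>.\<close>
  define L where "L = {a. x - a *\<^sub>R p \<in> Q}"
  define R where "R = {b. b *\<^sub>R p - x \<in> Q}"
  have LR: "a \<le> b" if "a \<in> L" "b \<in> R" for a b
  proof -
    have "(x - a *\<^sub>R p) + (b *\<^sub>R p - x) \<in> Q" using that by (intro add) (auto simp: L_def R_def)
    then have "(b - a) *\<^sub>R p \<in> Q" by (simp add: scaleR_diff_left)
    then show ?thesis using pointed_wedge_scaleR_nonneg[OF Q, of "b - a"] by simp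
  qed
  have LtoR: "R \<noteq> {}" if ne: "L \<noteq> {}"
  proof -
    obtain a where "x - a *\<^sub>R p \<in> Q" using ne by (auto simp: L_def)
    then obtain t where "t *\<^sub>R p - (x - a *\<^sub>R p) \<in> Q" using unit by blast
    then have "(t + a) *\<^sub>R p - x \<in> Q" by (simp add: scaleR_add_left algebra_simps)
    then show ?thesis by (auto simp: R_def)
  qed
  have RtoL: "L \<noteq> {}" if ne: "R \<noteq> {}"
  proof -
    obtain b where "b *\<^sub>R p - x \<in> Q" using ne by (auto simp: R_def)
    then obtain t where "t *\<^sub>R p - (b *\<^sub>R p - x) \<in> Q" using unit by blast
    then have "x - (b - t) *\<^sub>R p \<in> Q" by (simp add: scaleR_diff_left algebra_simps)
    then show ?thesis by (auto simp: L_def)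
  qed
  \<comment> \<open>As \<open>p\<close> is an order unit, \<open>L\<close> and \<open>R\<close> are
    empty together; then there is no bound on the value and 0 will do. Otherwise the supremum of
    \<open>L\<close> separates them.\<close>
  define s where "s = (if L = {} then 0 else Sup L)"
  have sL: "a \<le> s" if "a \<in> L" for a
  proof -
    have "R \<noteq> {}" using that by (intro LtoR) auto
    then obtain b where "b \<in> R" by auto
    then have "bdd_above L" unfolding bdd_above_def using LR by blast
    then show ?thesis using that by (auto simp: s_def intro: cSup_upper)
  qed
  have sR: "s \<le> b" if "b \<in> R" for b
    using RtoL LR that by (auto simp: s_def intro!: cSup_least)
  define Q' where "Q' = {q + t *\<^sub>R (x - s *\<^sub>R p) |q t. q \<in> Q}"
  have QQ': "q \<in> Q'" if "q \<in> Q" for q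
  proof -
    have "q = q + 0 *\<^sub>R (x - s *\<^sub>R p)" by simp
    then show ?thesis unfolding Q'_def using that by blast
  qed
  \<comment> \<open>In a representation of \<open>- p\<close> a positive \<open>t\<close> yields an
    upper bound \<open>s - 1 / t\<close> below \<open>s\<close>, and a negative \<open>t\<close> a
    lower bound above \<open>s\<close>.\<close>
  have "- p \<notin> Q'"
  proof
    assume "- p \<in> Q'"
    then obtain q t where q: "q \<in> Q" "- p = q + t *\<^sub>R (x - s *\<^sub>R p)" by (auto simp: Q'_def)
    consider "t = 0" | "0 < t" | "t < 0" by linarith
    then show False
    proof cases
      case 1
      then show ?thesis using q Q by (auto simp: pointed_wedge_def)
    next
      case 2
      have "(1 / t) *\<^sub>R q = (s - 1 / t) *\<^sub>R p - x"
      proof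
        fix i
        have "- p i = q i + t * (x i - s * p i)" using fun_cong[OF q(2), of i] by simp
        then have "q i = - p i - t * (x i - s * p i)" by simp
        then show "((1 / t) *\<^sub>R q) i = ((s - 1 / t) *\<^sub>R p - x) i"
          using 2 by (simp add: field_simps)
      qed
      then have "s - 1 / t \<in> R" using scale[OF q(1), of "1 / t"] 2 by (simp add: R_def)
      then show False using sR 2 by fastforce
    next
      case 3
      have "(1 / - t) *\<^sub>R q = x - (s + 1 / - t) *\<^sub>R p"
      proof
        fix i
        have "- p i = q i + t * (x i - s * p i)" using fun_cong[OF q(2), of i] by simp
        then have "q i = - p i - t * (x i - s * p i)" by simp
        then show "((1 / - t) *\<^sub>R q) i = (x - (s + 1 / - t) *\<^sub>R p) i"
          using 3 by (simp add: field_simps)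
      qed
      then have "s + 1 / - t \<in> L" using scale[OF q(1), of "1 / - t"] 3 by (simp add: L_def)
      then have "s + 1 / - t \<le> s" by (rule sL)
      then show False using 3 by (simp add: field_simps)
    qed
  qed
  moreover have "p \<in> Q'" using Q by (intro QQ') (auto simp: pointed_wedge_def)
  moreover have "a + b \<in> Q'" if ab: "a \<in> Q'" "b \<in> Q'" for a b
  proof -
    obtain q t where q: "q \<in> Q" "a = q + t *\<^sub>R (x - s *\<^sub>R p)" using ab by (auto simp: Q'_def)
    obtain r u where r: "r \<in> Q" "b = r + u *\<^sub>R (x - s *\<^sub>R p)" using ab by (auto simp: Q'_def)
    have "a + b = (q + r) + (t + u) *\<^sub>R (x - s *\<^sub>R p)" using q r by (simp add: scaleR_add_left)
    then show ?thesis unfolding Q'_def using add[OF q(1) r(1)] by blast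
  qed
  moreover have "c *\<^sub>R a \<in> Q'" if ac: "a \<in> Q'" "0 \<le> c" for a c
  proof -
    obtain q t where q: "q \<in> Q" "a = q + t *\<^sub>R (x - s *\<^sub>R p)" using ac by (auto simp: Q'_def)
    have "c *\<^sub>R a = c *\<^sub>R q + (c * t) *\<^sub>R (x - s *\<^sub>R p)" using q by (simp add: scaleR_add_right)
    then show ?thesis unfolding Q'_def using scale[OF q(1) ac(2)] by blast
  qed
  moreover have "\<exists>t\<ge>0. t *\<^sub>R p - a \<in> Q'" if a: "a \<in> Q'" for a
  proof -
    obtain q t where q: "q \<in> Q" "a = q + t *\<^sub>R (x - s *\<^sub>R p)" using a by (auto simp: Q'_def)
    obtain u where u: "u \<ge> 0" "u *\<^sub>R p - q \<in> Q" using unit q by blast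
    have "u *\<^sub>R p - a = (u *\<^sub>R p - q) + (- t) *\<^sub>R (x - s *\<^sub>R p)" using q by simp
    then have "u *\<^sub>R p - a \<in> Q'" unfolding Q'_def using u by blast
    then show ?thesis using u by blast
  qed
  ultimately have "pointed_wedge Q' p" by (auto simp: pointed_wedge_def)
  then show ?thesis using that by (simp add: Q'_def)
qed

text \<open>Adjoin in turn the lines through \<open>unit_fun i - s i *\<^sub>R p\<close>. Modulo
  these lines a vector \<open>q\<close> of \<open>supp N\<close> equals its weighted sum times
  \<open>p\<close>, so \<open>s\<close> serves as the functional: nonnegative multiples are the only
  multiples of \<open>p\<close> in the enlarged cone.\<close>

lemma pointed_wedge_functional:
  assumes Q: "pointed_wedge Q p" and p: "p \<in> supp N"
  obtains d where "(\<Sum>i<N. d i * p i) = 1" "\<And>q. q \<in> Q \<Longrightarrow> q \<in> supp N \<Longrightarrow> 0 \<le> (\<Sum>i<N. d i * q i)"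
proof -
  have "\<exists>Q' s. pointed_wedge Q' p \<and> Q \<subseteq> Q' \<and> (\<forall>i<k. \<forall>t. t *\<^sub>R (unit_fun i - s i *\<^sub>R p) \<in> Q')" for k
  proof (induction k)
    case 0
    then show ?case using Q by blast
  next
    case (Suc k)
    then obtain Q' s where Q': "pointed_wedge Q' p" "Q \<subseteq> Q'"
      "\<And>i t. i < k \<Longrightarrow> t *\<^sub>R (unit_fun i - s i *\<^sub>R p) \<in> Q'" by blast
    obtain r where r: "pointed_wedge {q + t *\<^sub>R (unit_fun k - r *\<^sub>R p) |q t. q \<in> Q'} p"
      using pointed_wedge_extend[OF Q'(1)] .
    define Q'' where "Q'' = {q + t *\<^sub>R (unit_fun k - r *\<^sub>R p) |q t. q \<in> Q'}"
    have sub: "q \<in> Q''" if "q \<in> Q'" for q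
    proof -
      have "q = q + 0 *\<^sub>R (unit_fun k - r *\<^sub>R p)" by simp
      then show ?thesis unfolding Q''_def using that by blast
    qed
    have "0 *\<^sub>R p \<in> Q'" using Q'(1) unfolding pointed_wedge_def by (meson order_refl)
    then have "0 \<in> Q'" by simp
    have line: "t *\<^sub>R (unit_fun k - r *\<^sub>R p) \<in> Q''" for t
    proof -
      have "t *\<^sub>R (unit_fun k - r *\<^sub>R p) = 0 + t *\<^sub>R (unit_fun k - r *\<^sub>R p)" by simp
      then show ?thesis unfolding Q''_def using \<open>0 \<in> Q'\<close> by blast
    qed
    have "t *\<^sub>R (unit_fun i - (s(k := r)) i *\<^sub>R p) \<in> Q''" if "i < Suc k" for i t
      using line Q'(3) sub that by (cases "i = k") auto
    moreover have "pointed_wedge Q'' p" using r by (simp add: Q''_def)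
    moreover have "Q \<subseteq> Q''" using sub Q'(2) by blast
    ultimately show ?case by blast
  qed
  from this[of N] obtain Q' s where Q': "pointed_wedge Q' p" "Q \<subseteq> Q'"
    "\<And>i t. i < N \<Longrightarrow> t *\<^sub>R (unit_fun i - s i *\<^sub>R p) \<in> Q'" by blast
  have add: "a + b \<in> Q'" if "a \<in> Q'" "b \<in> Q'" for a b using Q'(1) that by (auto simp: pointed_wedge_def)
  have "0 *\<^sub>R p \<in> Q'" using Q'(1) unfolding pointed_wedge_def by (meson order_refl)
  then have zero: "0 \<in> Q'" by simp
  have sum: "(\<Sum>i\<in>I. g i) \<in> Q'" if "finite I" "\<And>i. i \<in> I \<Longrightarrow> g i \<in> Q'" for I :: "nat set" and g
    using that by (induction I) (auto intro: add zero)
  have key: "(\<Sum>i<N. s i * q i) *\<^sub>R p - q \<in> Q'" "q - (\<Sum>i<N. s i * q i) *\<^sub>R p \<in> Q'" if q: "q \<in> supp N" for q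
  proof -
    have eq: "(\<Sum>i<N. (c * q i) *\<^sub>R (unit_fun i - s i *\<^sub>R p)) = c *\<^sub>R (q - (\<Sum>i<N. s i * q i) *\<^sub>R p)" for c
    proof -
      have "(\<Sum>i<N. (c * q i) *\<^sub>R (unit_fun i - s i *\<^sub>R p))
          = (\<Sum>i<N. c *\<^sub>R (q i *\<^sub>R unit_fun i) - (c * (s i * q i)) *\<^sub>R p)"
        by (intro sum.cong) (auto simp: scaleR_diff_right mult_ac)
      also have "\<dots> = c *\<^sub>R (\<Sum>i<N. q i *\<^sub>R unit_fun i) - c *\<^sub>R ((\<Sum>i<N. s i * q i) *\<^sub>R p)"
        by (simp add: sum_subtractf scaleR_sum_right scaleR_sum_left sum_distrib_left)
      finally show ?thesis using supp_expand[OF q] by (simp add: scaleR_diff_right)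
    qed
    have "(\<Sum>i<N. (c * q i) *\<^sub>R (unit_fun i - s i *\<^sub>R p)) \<in> Q'" for c
      using Q'(3) by (intro sum) auto
    from this[of "-1"] this[of 1] show "(\<Sum>i<N. s i * q i) *\<^sub>R p - q \<in> Q'" "q - (\<Sum>i<N. s i * q i) *\<^sub>R p \<in> Q'"
      unfolding eq by auto
  qed
  have "0 \<le> (\<Sum>i<N. s i * q i)" if q: "q \<in> Q" "q \<in> supp N" for q
  proof -
    have "((\<Sum>i<N. s i * q i) *\<^sub>R p - q) + q \<in> Q'" using key(1)[OF q(2)] q(1) Q'(2) by (intro add) auto
    then show ?thesis using pointed_wedge_scaleR_nonneg[OF Q'(1)] by simp
  qed
  moreover have "(\<Sum>i<N. s i * p i) = 1"
  proof -
    have "((\<Sum>i<N. s i * p i) - 1) *\<^sub>R p \<in> Q'" "(1 - (\<Sum>i<N. s i * p i)) *\<^sub>R p \<in> Q'"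
      using key[OF p] by (simp_all add: scaleR_diff_left)
    from this[THEN pointed_wedge_scaleR_nonneg[OF Q'(1)]] show ?thesis by simp
  qed
  ultimately show ?thesis using that by blast
qed

section \<open>Semidefinite matrices as sums of squares of vectors in a subspace\<close>

definition gsum :: "(nat \<Rightarrow> real) list \<Rightarrow> nat \<Rightarrow> nat \<Rightarrow> real" where
  "gsum gs i j = (\<Sum>g\<leftarrow>gs. g i * g j)"

lemma gsum_simps [simp]:
  "gsum [] i j = 0" "gsum (g # gs) i j = g i * g j + gsum gs i j"
  "gsum (gs @ hs) i j = gsum gs i j + gsum hs i j"
  by (auto simp: gsum_def)

lemma gsum_scale: "gsum (map (\<lambda>g. c *\<^sub>R g) gs) i j = c\<^sup>2 * gsum gs i j"
  by (induction gs) (auto simp: power2_eq_square algebra_simps)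

lemma gsum_sqrt: "0 \<le> c \<Longrightarrow> gsum (map (\<lambda>g. sqrt c *\<^sub>R g) gs) i j = c * gsum gs i j"
  by (simp add: gsum_scale)

lemma gsum_diag_nonneg: "0 \<le> gsum gs i i"
  by (induction gs) auto

lemma set_map_scale: "subspace U \<Longrightarrow> set gs \<subseteq> U \<Longrightarrow> set (map (\<lambda>g. c *\<^sub>R g) gs) \<subseteq> U"
  by (auto intro: subspace_scale)

text \<open>In the semidefinite order, a multiple of the Gram matrix of a spanning list dominates
  the square of each vector of \<open>U\<close>. The dominated vectors form a subspace by the
  parallelogram law: the squares of a + b and a - b add up to twice those of \<open>a\<close> and
  \<open>b\<close>. So the Gram matrix acts as an order unit of the cone over
  \<open>U\<close>.\<close>

lemma span_gsum_dominated:
  assumes U: "subspace U" and bs: "set bs \<subseteq> U" "U \<subseteq> span (set bs)" and g: "g \<in> U"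
  shows "\<exists>M hs. 0 \<le> M \<and> set hs \<subseteq> U \<and> (\<forall>i j. M * gsum bs i j = g i * g j + gsum hs i j)"
proof -
  define K where "K = {g\<in>U. \<exists>M hs. 0 \<le> M \<and> set hs \<subseteq> U \<and> (\<forall>i j. M * gsum bs i j = g i * g j + gsum hs i j)}"
  have "subspace K"
    unfolding real_vector.subspace_def
  proof (intro conjI ballI allI)
    show "0 \<in> K"
      using U by (auto simp: K_def subspace_0 intro!: exI[of _ 0] exI[of _ "[]"])
  next
    fix a b assume "a \<in> K" "b \<in> K"
    then obtain M hs M' hs' where *: "a \<in> U" "b \<in> U" "0 \<le> M" "set hs \<subseteq> U" "0 \<le> M'" "set hs' \<subseteq> U"
      "\<And>i j. M * gsum bs i j = a i * a j + gsum hs i j"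
      "\<And>i j. M' * gsum bs i j = b i * b j + gsum hs' i j"
      unfolding K_def by blast
    define ks where "ks = (a - b) # map (\<lambda>g. sqrt 2 *\<^sub>R g) (hs @ hs')"
    have "(2 * M + 2 * M') * gsum bs i j = (a + b) i * (a + b) j + gsum ks i j" for i j
    proof -
      have "(2 * M + 2 * M') * gsum bs i j = 2 * (M * gsum bs i j) + 2 * (M' * gsum bs i j)"
        by (simp add: algebra_simps)
      also have "\<dots> = 2 * (a i * a j + gsum hs i j) + 2 * (b i * b j + gsum hs' i j)"
        by (simp only: *)
      also have "\<dots> = (a + b) i * (a + b) j + gsum ks i j"
        unfolding ks_def gsum_simps(2) gsum_sqrt[OF zero_le_numeral] by (simp add: algebra_simps)
      finally show ?thesis .
    qed
    moreover have "set ks \<subseteq> U"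
      using * U set_map_scale[OF U, of "hs @ hs'"] by (auto simp: ks_def subspace_diff)
    moreover have "0 \<le> 2 * M + 2 * M'" "a + b \<in> U" using * U by (auto intro: subspace_add)
    ultimately show "a + b \<in> K" unfolding K_def by blast
  next
    fix c a assume "a \<in> K"
    then obtain M hs where *: "a \<in> U" "0 \<le> M" "set hs \<subseteq> U"
      "\<And>i j. M * gsum bs i j = a i * a j + gsum hs i j"
      unfolding K_def by blast
    have "(c\<^sup>2 * M) * gsum bs i j = (c *\<^sub>R a) i * (c *\<^sub>R a) j + gsum (map (\<lambda>g. c *\<^sub>R g) hs) i j" for i j
    proof -
      have "(c\<^sup>2 * M) * gsum bs i j = c\<^sup>2 * (M * gsum bs i j)" by simp
      also have "\<dots> = (c *\<^sub>R a) i * (c *\<^sub>R a) j + gsum (map (\<lambda>g. c *\<^sub>R g) hs) i j"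
        unfolding *(4) gsum_scale by (simp add: power2_eq_square algebra_simps)
      finally show ?thesis .
    qed
    moreover have "0 \<le> c\<^sup>2 * M" "c *\<^sub>R a \<in> U" "set (map (\<lambda>g. c *\<^sub>R g) hs) \<subseteq> U"
      using * U set_map_scale[OF U *(3)] by (auto intro: subspace_scale)
    ultimately show "c *\<^sub>R a \<in> K" unfolding K_def by blast
  qed
  moreover have "set bs \<subseteq> K"
  proof
    fix b assume b: "b \<in> set bs"
    then obtain xs ys where "bs = xs @ b # ys" by (meson split_list)
    then have "\<forall>i j. 1 * gsum bs i j = b i * b j + gsum (xs @ ys) i j" "set (xs @ ys) \<subseteq> U"
      using bs by auto
    moreover have "b \<in> U" using b bs by auto
    ultimately show "b \<in> K" unfolding K_def using zero_le_one[where ?'a = real] by blast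
  qed
  ultimately have "span (set bs) \<subseteq> K" by (intro span_minimal)
  then show ?thesis using g bs by (auto simp: K_def)
qed

lemma list_gsum_dominated:
  assumes U: "subspace U" and bs: "set bs \<subseteq> U" "U \<subseteq> span (set bs)" and gs: "set gs \<subseteq> U"
  shows "\<exists>M hs. 0 \<le> M \<and> set hs \<subseteq> U \<and> (\<forall>i j. M * gsum bs i j = gsum gs i j + gsum hs i j)"
  using gs
proof (induction gs)
  case Nil
  then show ?case by (auto intro!: exI[of _ 0] exI[of _ "[]"])
next
  case (Cons g gs)
  then obtain M hs where 1: "0 \<le> M" "set hs \<subseteq> U" "\<And>i j. M * gsum bs i j = gsum gs i j + gsum hs i j" by auto
  obtain M' hs' where 2: "0 \<le> M'" "set hs' \<subseteq> U" "\<And>i j. M' * gsum bs i j = g i * g j + gsum hs' i j"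
    using span_gsum_dominated[OF U bs, of g] Cons.prems by auto
  have "(M + M') * gsum bs i j = gsum (g # gs) i j + gsum (hs @ hs') i j" for i j
    using 1(3)[of i j] 2(3)[of i j] by (simp add: algebra_simps)
  moreover have "0 \<le> M + M'" "set (hs @ hs') \<subseteq> U" using 1 2 by auto
  ultimately show ?case by blast
qed

text \<open>In the coordinates \<open>u\<close> a feasible matrix has unit diagonal. The spanning
  condition places the matrix in the relative interior of the face belonging to \<open>U\<close>, so
  that no further reduction is required.\<close>

definition slater :: "nat \<Rightarrow> (nat \<Rightarrow> real) set \<Rightarrow> (nat \<Rightarrow> real) list \<Rightarrow> bool" where
  "slater N U ws \<longleftrightarrow> set ws \<subseteq> U \<and> (\<forall>i<N. gsum ws i i = 1) \<and> U \<subseteq> span (set ws)"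

text \<open>\<open>Q\<close> consists of the diagonals of Gram matrices over \<open>U\<close>,
  modulo the constant vector, and \<open>p\<close> is the diagonal for a spanning list. If
  \<open>- p\<close> is in \<open>Q\<close>, some Gram matrix with spanning list has constant
  diagonal and can be rescaled. If not, a functional on \<open>Q\<close> normalised at
  \<open>p\<close> is a certificate: it is semidefinite on \<open>U\<close>, kills constants, and
  does not vanish on the spanning list.\<close>

lemma slater_or_diag_reduces:
  assumes U: "subspace U" "U \<subseteq> supp N" and e: "e \<in> U" "\<forall>i<N. (e i)\<^sup>2 = 1" and N: "0 < N"
  shows "(\<exists>ws. slater N U ws) \<or> (\<exists>U'. diag_reduces N U U')"
proof -
  obtain B where B: "B \<subseteq> U" "U \<subseteq> span B" "finite B"
    using fin_dim_basis[OF fin_dim_subset[OF fin_dim_supp U(2)]] .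
  obtain bs where bs: "set bs = B" using finite_list[OF B(3)] by blast
  have bsU: "set bs \<subseteq> U" "U \<subseteq> span (set bs)" using B bs by auto
  define one where "one = (\<lambda>i. if i < N then 1 else (0::real))"
  define p where "p = (\<lambda>i. gsum bs i i)"
  define Q where "Q = {(\<lambda>i. gsum gs i i) - t *\<^sub>R one |gs t. set gs \<subseteq> U}"
  have pos: "set gs \<subseteq> U \<Longrightarrow> N \<le> i \<Longrightarrow> gsum gs i i = 0" for gs i
    using U(2) by (induction gs) (auto simp: supp_def)
  show ?thesis
  proof (cases "- p \<in> Q")
    case True
    then obtain gs t where gs: "set gs \<subseteq> U" "- p = (\<lambda>i. gsum gs i i) - t *\<^sub>R one" by (auto simp: Q_def)
    have eq: "gsum bs i i + gsum gs i i = t" if "i < N" for i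
      using fun_cong[OF gs(2), of i] that by (simp add: p_def one_def)
    \<comment> \<open>A zero constant would make entry 0 of every vector of the spanning list
      vanish, against \<open>e 0\<close> being plus or minus one.\<close>
    have "t \<noteq> 0"
    proof
      assume "t = 0"
      then have "gsum bs i i = 0" if "i < N" for i
        using eq[OF that] gsum_diag_nonneg[of bs i] gsum_diag_nonneg[of gs i] by linarith
      then have b0: "gsum bs 0 0 = 0" using N by blast
      obtain M hs where "M * gsum bs 0 0 = e 0 * e 0 + gsum hs 0 0"
        using span_gsum_dominated[OF U(1) bsU e(1)] by blast
      then have "e 0 * e 0 = 0"
        using b0 gsum_diag_nonneg[of hs 0] zero_le_square[of "e 0"] by (simp add: add_nonneg_eq_0_iff)
      then show False using e(2) N by (auto simp: power2_eq_square)
    qed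
    moreover have "0 \<le> t" using eq[OF N] gsum_diag_nonneg[of bs 0] gsum_diag_nonneg[of gs 0] by linarith
    ultimately have t: "0 < t" by simp
    define ws where "ws = map (\<lambda>g. sqrt (1 / t) *\<^sub>R g) (bs @ gs)"
    have "set ws \<subseteq> U" unfolding ws_def using bsU gs by (intro set_map_scale[OF U(1)]) auto
    moreover have "gsum ws i i = 1" if "i < N" for i
    proof -
      have "gsum ws i i = (1 / t) * gsum (bs @ gs) i i" unfolding ws_def using t by (intro gsum_sqrt) simp
      then show ?thesis using eq[OF that] t by simp
    qed
    moreover have "set bs \<subseteq> span (set ws)"
    proof
      fix b assume b: "b \<in> set bs"
      have "sqrt t *\<^sub>R (sqrt (1 / t) *\<^sub>R b) \<in> span (set ws)"
        using b by (intro span_scale span_base) (auto simp: ws_def)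
      moreover have "sqrt t *\<^sub>R (sqrt (1 / t) *\<^sub>R b) = b" using t by (simp add: real_sqrt_divide fun_eq_iff)
      ultimately show "b \<in> span (set ws)" by simp
    qed
    then have "U \<subseteq> span (set ws)" using bsU(2) span_minimal[of "set bs" "span (set ws)"] by auto
    ultimately show ?thesis by (auto simp: slater_def)
  next
    case False
    have "pointed_wedge Q p"
      unfolding pointed_wedge_def
    proof (intro conjI ballI allI impI)
      have "p = (\<lambda>i. gsum bs i i) - 0 *\<^sub>R one" by (simp add: p_def)
      then show "p \<in> Q" unfolding Q_def using bsU by blast
      show "- p \<notin> Q" by fact
    next
      fix x y assume "x \<in> Q" "y \<in> Q"
      then obtain gs t hs u where *: "set gs \<subseteq> U" "x = (\<lambda>i. gsum gs i i) - t *\<^sub>R one"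
        "set hs \<subseteq> U" "y = (\<lambda>i. gsum hs i i) - u *\<^sub>R one" by (auto simp: Q_def)
      have "x + y = (\<lambda>i. gsum (gs @ hs) i i) - (t + u) *\<^sub>R one"
        by (simp add: * fun_eq_iff algebra_simps)
      moreover have "set (gs @ hs) \<subseteq> U" using * by auto
      ultimately show "x + y \<in> Q" unfolding Q_def by blast
    next
      fix x and c :: real assume "x \<in> Q" "0 \<le> c"
      then obtain gs t where *: "set gs \<subseteq> U" "x = (\<lambda>i. gsum gs i i) - t *\<^sub>R one" by (auto simp: Q_def)
      have "c *\<^sub>R x = (\<lambda>i. gsum (map (\<lambda>g. sqrt c *\<^sub>R g) gs) i i) - (c * t) *\<^sub>R one"
        using \<open>0 \<le> c\<close> by (simp add: * fun_eq_iff gsum_sqrt algebra_simps)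
      then show "c *\<^sub>R x \<in> Q" unfolding Q_def using set_map_scale[OF U(1) *(1)] by blast
    next
      fix x assume "x \<in> Q"
      then obtain gs t where *: "set gs \<subseteq> U" "x = (\<lambda>i. gsum gs i i) - t *\<^sub>R one" by (auto simp: Q_def)
      obtain M hs where M: "0 \<le> M" "set hs \<subseteq> U" "\<And>i j. M * gsum bs i j = gsum gs i j + gsum hs i j"
        using list_gsum_dominated[OF U(1) bsU *(1)] by blast
      have "M *\<^sub>R p - x = (\<lambda>i. gsum hs i i) - (- t) *\<^sub>R one"
        by (simp add: * fun_eq_iff p_def M(3))
      then have "M *\<^sub>R p - x \<in> Q" unfolding Q_def using M(2) by blast
      then show "\<exists>t\<ge>0. t *\<^sub>R p - x \<in> Q" using M(1) by blast
    qed
    moreover have "p \<in> supp N" using pos[OF bsU(1)] by (auto simp: p_def supp_def)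
    ultimately obtain d where d: "(\<Sum>i<N. d i * p i) = 1"
      "\<And>q. q \<in> Q \<Longrightarrow> q \<in> supp N \<Longrightarrow> 0 \<le> (\<Sum>i<N. d i * q i)"
      using pointed_wedge_functional by blast
    have sq: "0 \<le> (\<Sum>i<N. d i * (gsum gs i i - t * one i))" if gs: "set gs \<subseteq> U" for gs t
    proof -
      have "(\<lambda>i. gsum gs i i) - t *\<^sub>R one \<in> Q" unfolding Q_def using gs by blast
      moreover have "(\<lambda>i. gsum gs i i) - t *\<^sub>R one \<in> supp N"
        using pos[OF gs] by (auto simp: supp_def one_def)
      ultimately show ?thesis using d(2) by fastforce
    qed
    \<comment> \<open>The cone contains every multiple of the constant vector, with both signs,
      which forces trace zero.\<close>
    have "(\<Sum>i<N. d i * (gsum [] i i - t * one i)) = - t * (\<Sum>i<N. d i)" for t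
      unfolding sum_distrib_left by (intro sum.cong) (auto simp: one_def)
    then have "0 \<le> - t * (\<Sum>i<N. d i)" for t using sq[of "[]" t] by simp
    from this[of 1] this[of "-1"] have d0: "(\<Sum>i<N. d i) = 0" by simp
    have psd: "0 \<le> diag_form N d u u" if "u \<in> U" for u
      using sq[of "[u]" 0] that by (simp add: diag_form_def mult.assoc)
    have dgs: "(\<Sum>i<N. d i * gsum gs i i) = (\<Sum>g\<leftarrow>gs. diag_form N d g g)" for gs
      by (induction gs) (auto simp: diag_form_def algebra_simps sum.distrib)
    have "\<exists>b\<in>set bs. diag_form N d b b \<noteq> 0"
    proof (rule ccontr)
      assume "\<not> (\<exists>b\<in>set bs. diag_form N d b b \<noteq> 0)"
      then have "(\<Sum>g\<leftarrow>bs. diag_form N d g g) = 0" by (induction bs) auto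
      then show False using d(1) dgs[of bs] by (simp add: p_def)
    qed
    then have "{u\<in>U. diag_form N d u u = 0} \<noteq> U" using bsU by auto
    then show ?thesis unfolding diag_reduces_def using d0 psd by blast
  qed
qed

lemma diag_chain_exists:
  assumes U: "subspace U" "U \<subseteq> supp N" and e: "e \<in> U" "\<forall>i<N. (e i)\<^sup>2 = 1" and N: "0 < N"
  shows "\<exists>k f ws. f 0 = U \<and> (\<forall>j<k. diag_reduces N (f j) (f (Suc j))) \<and> slater N (f k) ws"
  using U e(1)
proof (induction "dim U" arbitrary: U rule: less_induct)
  case less
  show ?case
  proof (cases "\<exists>ws. slater N U ws")
    case True
    then obtain ws where "slater N U ws" by blast
    then show ?thesis by (intro exI[of _ "0::nat"] exI[of _ "\<lambda>_. U"] exI[of _ ws]) simp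
  next
    case False
    then obtain U' where red: "diag_reduces N U U'"
      using slater_or_diag_reduces[OF less.prems(1,2,3) e(2) N] by blast
    note U' = diag_reducesD[OF red less.prems(1)]
    obtain x where "x \<in> U" "x \<notin> U'" using U'(2) by blast
    then have "dim U' < dim U"
      using U' fin_dim_subset[OF fin_dim_supp less.prems(2)] by (intro dim_less_fin[of _ _ x]) auto
    then obtain k f ws where f: "f 0 = U'" "\<forall>j<k. diag_reduces N (f j) (f (Suc j))" "slater N (f k) ws"
      using less.hyps[of U'] U' less.prems e(2) by blast
    have "\<forall>j<Suc k. diag_reduces N (case_nat U f j) (case_nat U f (Suc j))"
      using f red by (auto simp: less_Suc_eq_0_disj)
    moreover have "slater N (case_nat U f (Suc k)) ws" using f by simp
    ultimately show ?thesis by (intro exI[of _ "Suc k"] exI[of _ "case_nat U f"] exI[of _ ws]) simp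
  qed
qed

subsection \<open>Faces of the semidefinite cone\<close>

definition bilin :: "nat \<Rightarrow> real mat \<Rightarrow> (nat \<Rightarrow> real) \<Rightarrow> (nat \<Rightarrow> real) \<Rightarrow> real" where
  "bilin N W x y = (\<Sum>i<N. \<Sum>j<N. W $$ (i, j) * x i * y j)"

definition gram :: "nat \<Rightarrow> (nat \<Rightarrow> real) list \<Rightarrow> real mat" where
  "gram N gs = mat N N (\<lambda>(i, j). gsum gs i j)"

text \<open>For a subspace \<open>V\<close> of \<open>supp N\<close> these are the semidefinite
  matrices whose column space lies in \<open>V\<close>, the face attached to
  \<open>V\<close>.\<close>

definition gram_cone :: "nat \<Rightarrow> (nat \<Rightarrow> real) set \<Rightarrow> real mat set" where
  "gram_cone N V = {gram N gs |gs. set gs \<subseteq> V}"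

definition dot :: "nat \<Rightarrow> (nat \<Rightarrow> real) \<Rightarrow> (nat \<Rightarrow> real) \<Rightarrow> real" where
  "dot N c v = (\<Sum>i<N. c i * v i)"

lemma sum_list_map_eq_0: "(\<And>g. g \<in> set gs \<Longrightarrow> f g = (0::real)) \<Longrightarrow> (\<Sum>g\<leftarrow>gs. f g) = 0"
  by (induction gs) auto

lemma linear_dot: "linear (dot N c)"
  by (auto intro!: linearI simp: dot_def algebra_simps sum.distrib sum_distrib_left)

lemma linear_bilin: "linear (bilin N W x)" "linear (\<lambda>x. bilin N W x y)"
  by (auto intro!: linearI simp: bilin_def algebra_simps sum.distrib sum_distrib_left)

lemma gsum_sym: "gsum gs i j = gsum gs j i"
  by (simp add: gsum_def mult.commute)

lemma gram_carrier [simp]: "gram N gs \<in> carrier_mat N N" "dim_row (gram N gs) = N" "dim_col (gram N gs) = N"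
  by (auto simp: gram_def)

lemma gram_index [simp]: "i < N \<Longrightarrow> j < N \<Longrightarrow> gram N gs $$ (i, j) = gsum gs i j"
  by (simp add: gram_def)

lemma gram_sym_mats: "gram N gs \<in> sym_mats N"
  by (auto simp: sym_mats_def gsum_sym intro!: eq_matI)

lemma sym_matsD:
  assumes "X \<in> sym_mats N"
  shows "X \<in> carrier_mat N N" "i < N \<Longrightarrow> j < N \<Longrightarrow> X $$ (i, j) = X $$ (j, i)"
proof -
  show *: "X \<in> carrier_mat N N" using assms by (simp add: sym_mats_def)
  assume "i < N" "j < N"
  then show "X $$ (i, j) = X $$ (j, i)"
    using assms * by (metis (mono_tags, lifting) carrier_matD index_transpose_mat(1) mem_Collect_eq sym_mats_def)
qed

lemma sym_matsI:
  assumes "X \<in> carrier_mat N N" "\<And>i j. i < N \<Longrightarrow> j < N \<Longrightarrow> X $$ (i, j) = X $$ (j, i)"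
  shows "X \<in> sym_mats N"
  using assms by (auto simp: sym_mats_def intro!: eq_matI)

lemma bilin_sym: "W \<in> sym_mats N \<Longrightarrow> bilin N W x y = bilin N W y x"
  unfolding bilin_def
  by (subst sum.swap, intro sum.cong refl) (use sym_matsD(2)[of W N] in \<open>auto simp: mult_ac\<close>)

lemma mat_inner_eq:
  assumes "X \<in> carrier_mat N N" "Y \<in> carrier_mat N N"
  shows "mat_inner X Y = (\<Sum>i<N. \<Sum>j<N. X $$ (i, j) * Y $$ (j, i))"
  using assms by (auto simp: mat_inner_def mat_trace_def scalar_prod_def atLeast0LessThan)

lemma mat_inner_gram:
  assumes W: "W \<in> carrier_mat N N"
  shows "mat_inner W (gram N gs) = (\<Sum>g\<leftarrow>gs. bilin N W g g)"
    "mat_inner (gram N gs) W = (\<Sum>g\<leftarrow>gs. bilin N W g g)"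
proof -
  have *: "(\<Sum>i<N. \<Sum>j<N. W $$ (i, j) * gsum gs j i) = (\<Sum>g\<leftarrow>gs. bilin N W g g)"
    by (induction gs) (auto simp: bilin_def algebra_simps sum.distrib)
  show "mat_inner W (gram N gs) = (\<Sum>g\<leftarrow>gs. bilin N W g g)"
    using W * by (simp add: mat_inner_eq)
  have "mat_inner (gram N gs) W = (\<Sum>i<N. \<Sum>j<N. gsum gs i j * W $$ (j, i))"
    by (subst mat_inner_eq[OF gram_carrier(1) W]) simp
  also have "\<dots> = (\<Sum>i<N. \<Sum>j<N. W $$ (i, j) * gsum gs j i)"
    by (subst sum.swap) (simp add: mult.commute)
  finally show "mat_inner (gram N gs) W = (\<Sum>g\<leftarrow>gs. bilin N W g g)" using * by simp
qed

lemma quadratic_form_vec: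
  assumes "X \<in> carrier_mat N N"
  shows "vec N x \<bullet> (X *\<^sub>v vec N x) = bilin N X x x"
  using assms by (auto simp: bilin_def scalar_prod_def atLeast0LessThan sum_distrib_left mult_ac
      intro!: sum.cong)

lemma psd_cone_iff: "X \<in> psd_cone N \<longleftrightarrow> X \<in> sym_mats N \<and> (\<forall>x. 0 \<le> bilin N X x x)"
proof -
  have "(\<forall>v\<in>carrier_vec N. 0 \<le> v \<bullet> (X *\<^sub>v v)) \<longleftrightarrow> (\<forall>x. 0 \<le> bilin N X x x)" if X: "X \<in> sym_mats N"
  proof (intro iffI allI ballI)
    fix x assume "\<forall>v\<in>carrier_vec N. 0 \<le> v \<bullet> (X *\<^sub>v v)"
    then have "0 \<le> vec N x \<bullet> (X *\<^sub>v vec N x)" by simp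
    then show "0 \<le> bilin N X x x" using quadratic_form_vec[OF sym_matsD(1)[OF X]] by simp
  next
    fix v :: "real vec" assume *: "\<forall>x. 0 \<le> bilin N X x x" "v \<in> carrier_vec N"
    then have "vec N (\<lambda>i. v $ i) = v" by auto
    then show "0 \<le> v \<bullet> (X *\<^sub>v v)"
      using * quadratic_form_vec[OF sym_matsD(1)[OF X], of "\<lambda>i. v $ i"] by simp
  qed
  then show ?thesis by (auto simp: psd_cone_def)
qed

lemma bilin_gram: "bilin N (gram N gs) x x = (\<Sum>g\<leftarrow>gs. (dot N g x)\<^sup>2)"
proof -
  have "bilin N (gram N gs) x x = (\<Sum>i<N. \<Sum>j<N. gsum gs i j * x i * x j)"
    unfolding bilin_def by (intro sum.cong refl) auto
  also have "\<dots> = (\<Sum>g\<leftarrow>gs. (dot N g x)\<^sup>2)"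
  proof (induction gs)
    case (Cons g gs)
    have "(dot N g x)\<^sup>2 = (\<Sum>i<N. \<Sum>j<N. g i * g j * x i * x j)"
      unfolding dot_def power2_eq_square sum_product by (intro sum.cong refl) (simp add: mult_ac)
    then show ?case using Cons by (simp add: algebra_simps sum.distrib)
  qed simp
  finally show ?thesis .
qed

lemma gram_psd: "gram N gs \<in> psd_cone N"
  unfolding psd_cone_iff bilin_gram using gram_sym_mats by (auto intro!: sum_list_nonneg)

lemma bilin_unit: "i < N \<Longrightarrow> j < N \<Longrightarrow> bilin N X (unit_fun i) (unit_fun j) = X $$ (i, j)"
proof -
  assume ij: "i < N" "j < N"
  have "bilin N X (unit_fun i) (unit_fun j) = (\<Sum>k<N. if k = i then X $$ (i, j) else 0)"
    unfolding bilin_def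
  proof (intro sum.cong refl)
    fix k
    have "(\<Sum>l<N. X $$ (k, l) * unit_fun i k * unit_fun j l)
        = (\<Sum>l<N. if l = j then (if k = i then X $$ (i, j) else 0) else 0)"
      by (intro sum.cong) (auto simp: unit_fun_def)
    then show "(\<Sum>l<N. X $$ (k, l) * unit_fun i k * unit_fun j l) = (if k = i then X $$ (i, j) else 0)"
      using ij by simp
  qed
  then show ?thesis using ij by simp
qed

text \<open>Cholesky decomposition, one column at a time.\<close>

lemma psd_gram_aux:
  assumes "X \<in> psd_cone N" "\<And>i j. i < N \<Longrightarrow> j < N \<Longrightarrow> i < N - k \<Longrightarrow> X $$ (i, j) = 0" "k \<le> N"
  shows "\<exists>gs. set gs \<subseteq> supp N \<and> X = gram N gs"
  using assms
proof (induction k arbitrary: X)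
  case 0
  then have "X = gram N []" by (auto simp: psd_cone_def sym_mats_def intro!: eq_matI)
  then show ?case by (intro exI[of _ "[]"]) simp
next
  case (Suc k)
  have X: "X \<in> sym_mats N" "\<And>x. 0 \<le> bilin N X x x" using Suc.prems(1) by (auto simp: psd_cone_iff)
  note Xs = sym_matsD[OF X(1)]
  define r where "r = N - Suc k"
  have r: "r < N" "Suc r = N - k" using Suc.prems by (auto simp: r_def)
  define a where "a = X $$ (r, r)"
  have "0 \<le> bilin N X (unit_fun r) (unit_fun r)" by (rule X(2))
  then have "0 \<le> a" using r by (simp add: bilin_unit a_def)
  \<comment> \<open>A zero pivot makes a unit vector isotropic, so by semidefiniteness its whole row
    vanishes and there is nothing to eliminate.\<close>
  have null: "X $$ (r, j) = 0" if "a = 0" "j < N" for j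
  proof -
    have "bilin N X (unit_fun r) (unit_fun j) = 0"
      by (rule psd_form_null[OF subspace_UNIV linear_bilin(2) linear_bilin(1) bilin_sym[OF X(1)]])
        (use X(2) that r in \<open>auto simp: bilin_unit a_def\<close>)
    then show ?thesis using that r by (simp add: bilin_unit)
  qed
  show ?case
  proof (cases "a = 0")
    case True
    show ?thesis
    proof (rule Suc.IH[OF Suc.prems(1)])
      fix i j assume ij: "i < N" "j < N" "i < N - k"
      then consider "i = r" | "i < N - Suc k" using r by linarith
      then show "X $$ (i, j) = 0" using null[OF True] Suc.prems(2) ij by cases auto
    qed (use Suc.prems in auto)
  next
    case False
    then have a: "0 < a" using \<open>0 \<le> a\<close> by simp
    define g where "g i = (if i < N then X $$ (r, i) / sqrt a else 0)" for i
    define X' where "X' = mat N N (\<lambda>(i, j). X $$ (i, j) - g i * g j)"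
    have gg: "g i * g j = X $$ (r, i) * X $$ (r, j) / a" if "i < N" "j < N" for i j
      using that a by (simp add: g_def)
    have dotg: "dot N g x = bilin N X (unit_fun r) x / sqrt a" for x
    proof -
      have "bilin N X (unit_fun r) x = (\<Sum>i<N. if i = r then (\<Sum>j<N. X $$ (r, j) * x j) else 0)"
        unfolding bilin_def by (intro sum.cong refl) (auto simp: unit_fun_def)
      also have "\<dots> = (\<Sum>j<N. X $$ (r, j) * x j)" using r by simp
      finally show ?thesis by (simp add: dot_def g_def sum_divide_distrib)
    qed
    have qX': "bilin N X' x x = bilin N X x x - (dot N g x)\<^sup>2" for x
    proof -
      have "bilin N X' x x = (\<Sum>i<N. \<Sum>j<N. X $$ (i, j) * x i * x j - (g i * x i) * (g j * x j))"
        unfolding bilin_def X'_def by (intro sum.cong refl) (auto simp: algebra_simps)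
      then show ?thesis
        by (simp add: sum_subtractf bilin_def dot_def power2_eq_square sum_product)
    qed
    have "X' \<in> psd_cone N"
      unfolding psd_cone_iff
    proof (intro conjI allI)
      show "X' \<in> sym_mats N" using Xs by (intro sym_matsI) (auto simp: X'_def)
      fix x
      \<comment> \<open>The Schur complement is the minimum of the form along the line through
        \<open>x\<close> in direction \<open>unit_fun r\<close>, attained at the shift by
        \<open>b / a\<close>.\<close>
      define b where "b = bilin N X (unit_fun r) x"
      have "0 \<le> bilin N X (x - (b / a) *\<^sub>R unit_fun r) (x - (b / a) *\<^sub>R unit_fun r)" by (rule X(2))
      also have "\<dots> = bilin N X x x - 2 * (b / a) * b + (b / a)\<^sup>2 * a"
        using r bilin_sym[OF X(1), of x "unit_fun r"]
        by (simp add: linear_diff[OF linear_bilin(1)] linear_diff[OF linear_bilin(2)]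
            linear_scale[OF linear_bilin(1)] linear_scale[OF linear_bilin(2)] bilin_unit a_def[symmetric]
            b_def[symmetric] power2_eq_square algebra_simps)
      also have "\<dots> = bilin N X x x - (b / sqrt a)\<^sup>2"
        using a by (simp add: power_divide power2_eq_square field_simps)
      finally show "0 \<le> bilin N X' x x" unfolding qX' dotg b_def .
    qed
    moreover have "X' $$ (i, j) = 0" if ij: "i < N" "j < N" "i < N - k" for i j
    proof -
      consider "i = r" | "i < N - Suc k" using ij r by linarith
      then show ?thesis
      proof cases
        case 1
        then show ?thesis using ij gg[of i j] a r by (simp add: X'_def a_def[symmetric])
      next
        case 2
        then have "X $$ (r, i) = 0" using Xs(2)[of r i] Suc.prems(2)[of i r] r ij by simp
        then show ?thesis using ij gg[of i j] Suc.prems(2)[of i j] 2 by (simp add: X'_def)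
      qed
    qed
    ultimately obtain gs where gs: "set gs \<subseteq> supp N" "X' = gram N gs"
      using Suc.IH[of X'] Suc.prems(3) by auto
    have "X = gram N (g # gs)"
    proof (rule eq_matI)
      fix i j assume "i < dim_row (gram N (g # gs))" "j < dim_col (gram N (g # gs))"
      then have ij: "i < N" "j < N" by auto
      have "X' $$ (i, j) = X $$ (i, j) - g i * g j" using ij by (simp add: X'_def)
      then show "X $$ (i, j) = gram N (g # gs) $$ (i, j)" using ij gs(2) by simp
    qed (use Xs in auto)
    moreover have "set (g # gs) \<subseteq> supp N" using gs by (auto simp: supp_def g_def)
    ultimately show ?thesis by blast
  qed
qed

lemma psd_cone_eq_gram_cone: "psd_cone N = gram_cone N (supp N)"
proof
  show "psd_cone N \<subseteq> gram_cone N (supp N)"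
    using psd_gram_aux[of _ N N] by (auto simp: gram_cone_def)
  show "gram_cone N (supp N) \<subseteq> psd_cone N"
    using gram_psd by (auto simp: gram_cone_def)
qed

text \<open>Describing a subspace by equations lets membership in the face be tested by zeros of
  quadratic forms: a Gram matrix comes from vectors in \<open>V\<close> iff its form vanishes at
  every \<open>c\<close> in \<open>C\<close>.\<close>

definition annihilated :: "nat \<Rightarrow> (nat \<Rightarrow> real) set \<Rightarrow> bool" where
  "annihilated N V \<longleftrightarrow> (\<exists>C. V = {v\<in>supp N. \<forall>c\<in>C. dot N c v = 0})"

lemma annihilated_subspace: "annihilated N V \<Longrightarrow> subspace V"
  using subspace_supp[of N]
  by (auto simp: annihilated_def real_vector.subspace_def linear_add[OF linear_dot]
      linear_scale[OF linear_dot] linear_0[OF linear_dot])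

lemma annihilated_supp: "annihilated N V \<Longrightarrow> V \<subseteq> supp N"
  by (auto simp: annihilated_def)

lemma annihilated_UNIV: "annihilated N (supp N)"
  unfolding annihilated_def by (rule exI[of _ "{}"]) auto

text \<open>On a semidefinite form the isotropic vectors are the radical, so the new equations are
  pairings with the images under \<open>W\<close> of the vectors of \<open>V\<close>.\<close>

lemma annihilated_psd_null:
  assumes V: "annihilated N V" and W: "W \<in> sym_mats N" and psd: "\<And>v. v \<in> V \<Longrightarrow> 0 \<le> bilin N W v v"
  shows "annihilated N {v\<in>V. bilin N W v v = 0}"
proof -
  obtain C where C: "V = {v\<in>supp N. \<forall>c\<in>C. dot N c v = 0}" using V by (auto simp: annihilated_def)
  define c where "c v = (\<lambda>j. \<Sum>i<N. W $$ (i, j) * v i)" for v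
  have "bilin N W v u = dot N (c v) u" for u v
    unfolding bilin_def dot_def c_def by (subst sum.swap) (simp add: sum_distrib_right)
  then have "{v\<in>V. bilin N W v v = 0} = {v\<in>V. \<forall>u\<in>V. dot N (c u) v = 0}"
    using subspace_psd_null(1)[OF annihilated_subspace[OF V] linear_bilin(2) linear_bilin(1) bilin_sym[OF W] psd]
    by simp
  also have "\<dots> = {v\<in>supp N. \<forall>c\<in>C \<union> c ` V. dot N c v = 0}" using C by auto
  finally show ?thesis unfolding annihilated_def by blast
qed

lemma gram_combination:
  assumes "0 \<le> a" "0 \<le> b"
  shows "a \<cdot>\<^sub>m gram N gs + b \<cdot>\<^sub>m gram N hs
    = gram N (map (\<lambda>g. sqrt a *\<^sub>R g) gs @ map (\<lambda>g. sqrt b *\<^sub>R g) hs)"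
  using assms by (intro eq_matI) (auto simp: gsum_sqrt)

lemma bilin_combination:
  assumes "X \<in> carrier_mat N N" "Y \<in> carrier_mat N N"
  shows "bilin N (a \<cdot>\<^sub>m X + b \<cdot>\<^sub>m Y) x y = a * bilin N X x y + b * bilin N Y x y"
  using assms by (simp add: bilin_def algebra_simps sum.distrib sum_distrib_left)

text \<open>If a proper convex combination of two semidefinite matrices has zero form at each
  \<open>c\<close> in \<open>C\<close>, so have both matrices; a vanishing sum of squares then puts
  each Gram vector into \<open>V\<close>.\<close>

lemma gram_cone_face:
  assumes V: "annihilated N V"
  shows "mat_face_of (gram_cone N V) (psd_cone N)"
  unfolding mat_face_of_def
proof (intro conjI ballI allI impI)
  show "gram_cone N V \<subseteq> psd_cone N" using gram_psd by (auto simp: gram_cone_def)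
  show "mat_convex (gram_cone N V)"
    unfolding mat_convex_def
  proof (intro ballI allI impI)
    fix X Y and t :: real assume "X \<in> gram_cone N V" "Y \<in> gram_cone N V" "0 \<le> t \<and> t \<le> 1"
    then obtain gs hs where *: "set gs \<subseteq> V" "X = gram N gs" "set hs \<subseteq> V" "Y = gram N hs" "0 \<le> t" "0 \<le> 1 - t"
      by (auto simp: gram_cone_def)
    have "set (map (\<lambda>g. sqrt (1 - t) *\<^sub>R g) gs @ map (\<lambda>g. sqrt t *\<^sub>R g) hs) \<subseteq> V"
      using set_map_scale[OF annihilated_subspace[OF V]] * by (auto simp del: set_map)
    then show "(1 - t) \<cdot>\<^sub>m X + t \<cdot>\<^sub>m Y \<in> gram_cone N V"
      unfolding gram_cone_def *(2,4) gram_combination[OF *(6,5)] by blast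
  qed
next
  fix X Y and t :: real
  assume XY: "X \<in> psd_cone N" "Y \<in> psd_cone N" and t: "0 < t \<and> t < 1 \<and> (1 - t) \<cdot>\<^sub>m X + t \<cdot>\<^sub>m Y \<in> gram_cone N V"
  obtain C where C: "V = {v\<in>supp N. \<forall>c\<in>C. dot N c v = 0}" using V by (auto simp: annihilated_def)
  obtain gs hs ks where *: "set gs \<subseteq> supp N" "X = gram N gs" "set hs \<subseteq> supp N" "Y = gram N hs"
    "set ks \<subseteq> V" "(1 - t) \<cdot>\<^sub>m X + t \<cdot>\<^sub>m Y = gram N ks"
    using XY t by (auto simp: gram_cone_def psd_cone_eq_gram_cone)
  have sym: "dot N g c = dot N c g" for g c by (simp add: dot_def mult.commute)
  have zero: "bilin N X c c = 0 \<and> bilin N Y c c = 0" if "c \<in> C" for c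
  proof -
    have "(1 - t) * bilin N X c c + t * bilin N Y c c = bilin N (gram N ks) c c"
      unfolding *(6)[symmetric] by (subst bilin_combination) (simp_all add: *(2,4))
    also have "\<dots> = 0"
      unfolding bilin_gram using *(5) that C sym by (intro sum_list_map_eq_0) auto
    finally have "(1 - t) * bilin N X c c + t * bilin N Y c c = 0" .
    moreover have "0 \<le> bilin N X c c" "0 \<le> bilin N Y c c" using XY by (auto simp: psd_cone_iff)
    ultimately show ?thesis using t
      by (smt (verit) mult_nonneg_nonneg mult_pos_pos)
  qed
  have "set gs \<subseteq> V" if gs: "set gs \<subseteq> supp N" "\<forall>c\<in>C. bilin N (gram N gs) c c = 0" for gs
  proof
    fix g assume g: "g \<in> set gs"
    have "dot N c g = 0" if "c \<in> C" for c
    proof -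
      have "(\<Sum>g\<leftarrow>gs. (dot N g c)\<^sup>2) = 0" using gs that by (simp add: bilin_gram)
      then have "(dot N g c)\<^sup>2 = 0" using g
        by (subst (asm) sum_list_nonneg_eq_0_iff) auto
      then show ?thesis by (simp add: sym)
    qed
    then show "g \<in> V" using g gs C by auto
  qed
  then show "X \<in> gram_cone N V" "Y \<in> gram_cone N V"
    using zero * unfolding gram_cone_def by blast+
qed

lemma gram_cone_dual:
  assumes W: "W \<in> sym_mats N" and psd: "\<And>v. v \<in> V \<Longrightarrow> 0 \<le> bilin N W v v"
  shows "W \<in> dual_cone N (gram_cone N V)"
proof -
  have "0 \<le> mat_inner W (gram N gs)" if "set gs \<subseteq> V" for gs
    unfolding mat_inner_gram(1)[OF sym_matsD(1)[OF W]]
    using that psd by (intro sum_list_nonneg) auto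
  then show ?thesis using W by (auto simp: dual_cone_def gram_cone_def)
qed

lemma gram_single: "v \<in> V \<Longrightarrow> gram N [v] \<in> gram_cone N V"
  by (auto simp: gram_cone_def)

lemma gram_cone_not_perp:
  assumes W: "W \<in> sym_mats N" and v: "v \<in> V" "bilin N W v v \<noteq> 0"
  shows "W \<notin> perp N (gram_cone N V)"
  using gram_single[OF v(1), of N] v(2) sym_matsD(1)[OF W] unfolding perp_def
  by (auto simp: mat_inner_gram intro!: bexI[of _ "gram N [v]"])

lemma gram_cone_Int_perp:
  assumes W: "W \<in> sym_mats N" and psd: "\<And>v. v \<in> V \<Longrightarrow> 0 \<le> bilin N W v v"
  shows "gram_cone N V \<inter> perp N {W} = gram_cone N {v\<in>V. bilin N W v v = 0}"
proof
  show "gram_cone N V \<inter> perp N {W} \<subseteq> gram_cone N {v\<in>V. bilin N W v v = 0}"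
  proof
    fix X assume X: "X \<in> gram_cone N V \<inter> perp N {W}"
    then obtain gs where gs: "set gs \<subseteq> V" "X = gram N gs" by (auto simp: gram_cone_def)
    have "(\<Sum>g\<leftarrow>gs. bilin N W g g) = 0"
      using X sym_matsD(1)[OF W] by (auto simp: perp_def gs mat_inner_gram)
    then have "\<forall>x\<in>set (map (\<lambda>g. bilin N W g g) gs). x = 0"
      using gs psd by (subst (asm) sum_list_nonneg_eq_0_iff) auto
    then show "X \<in> gram_cone N {v\<in>V. bilin N W v v = 0}" using gs by (auto simp: gram_cone_def)
  qed
  show "gram_cone N {v\<in>V. bilin N W v v = 0} \<subseteq> gram_cone N V \<inter> perp N {W}"
  proof
    fix X assume "X \<in> gram_cone N {v\<in>V. bilin N W v v = 0}"
    then obtain gs where gs: "set gs \<subseteq> {v\<in>V. bilin N W v v = 0}" "X = gram N gs" by (auto simp: gram_cone_def)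
    have "(\<Sum>g\<leftarrow>gs. bilin N W g g) = 0" using gs by (intro sum_list_map_eq_0) auto
    then show "X \<in> gram_cone N V \<inter> perp N {W}"
      using gs sym_matsD(1)[OF W] gram_sym_mats by (auto simp: gram_cone_def perp_def mat_inner_gram)
  qed
qed

text \<open>A Gram matrix with spanning list is a relative interior point: each matrix of the cone
  occurs in a proper convex combination equal to it, hence belongs to every face that contains
  it.\<close>

lemma min_face_eq_gram_cone:
  assumes V: "annihilated N V" and S: "S \<subseteq> gram_cone N V"
    and ws: "set ws \<subseteq> V" "V \<subseteq> span (set ws)" "gram N ws \<in> S"
  shows "min_face N S = gram_cone N V"
proof
  show "min_face N S \<subseteq> gram_cone N V"
    using gram_cone_face[OF V] S by (auto simp: min_face_def)
  show "gram_cone N V \<subseteq> min_face N S"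
    unfolding min_face_def
  proof (intro Inter_greatest)
    fix F assume "F \<in> {F. mat_face_of F (psd_cone N) \<and> S \<subseteq> F}"
    then have F: "mat_face_of F (psd_cone N)" "gram N ws \<in> F" using ws by auto
    show "gram_cone N V \<subseteq> F"
    proof
      fix X assume "X \<in> gram_cone N V"
      then obtain gs where gs: "set gs \<subseteq> V" "X = gram N gs" by (auto simp: gram_cone_def)
      obtain M hs where M: "0 \<le> M" "\<And>i j. M * gsum ws i j = gsum gs i j + gsum hs i j"
        using list_gsum_dominated[OF annihilated_subspace[OF V] ws(1,2) gs(1)] by blast
      \<comment> \<open>With \<open>M\<close> times the Gram matrix of \<open>ws\<close> equal to X
        + H, the Gram matrix of \<open>ws\<close> is \<open>t\<close> times X + H plus twice itself.
        The added 2 keeps \<open>t\<close> below 1 even for \<open>M = 0\<close>.\<close>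
      define t where "t = 1 / (M + 2)"
      have t: "0 < t" "t < 1" "t * (M + 2) = 1" using M(1) by (auto simp: t_def)
      define ks where "ks = map (\<lambda>g. sqrt (t / (1 - t)) *\<^sub>R g) hs @ map (\<lambda>g. sqrt (2 * t / (1 - t)) *\<^sub>R g) ws"
      have cancel: "(1 - t) * (x / (1 - t) * y) = x * y" for x y using t by simp
      have "(1 - t) \<cdot>\<^sub>m gram N ks + t \<cdot>\<^sub>m X = gram N ws"
      proof (rule eq_matI)
        fix i j assume "i < dim_row (gram N ws)" "j < dim_col (gram N ws)"
        then have ij: "i < N" "j < N" by auto
        have "gsum ks i j = t / (1 - t) * gsum hs i j + 2 * t / (1 - t) * gsum ws i j"
          unfolding ks_def gsum_simps using t by (simp add: gsum_sqrt)
        then have "(1 - t) * gsum ks i j + t * gsum gs i j = t * (gsum gs i j + gsum hs i j) + 2 * t * gsum ws i j"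
          using cancel[of t "gsum hs i j"] cancel[of "2 * t" "gsum ws i j"] by (simp add: distrib_left)
        also have "\<dots> = t * (M + 2) * gsum ws i j" unfolding M(2)[symmetric] by (simp add: algebra_simps)
        finally show "((1 - t) \<cdot>\<^sub>m gram N ks + t \<cdot>\<^sub>m X) $$ (i, j) = gram N ws $$ (i, j)"
          using ij t by (simp add: gs)
      qed (use gs in auto)
      then show "X \<in> F" using F t gram_psd[of N ks] gram_psd[of N gs] gs
        unfolding mat_face_of_def by metis
    qed
  qed
qed

subsection \<open>The rank of a matrix\<close>

definition fun_of_vec :: "real vec \<Rightarrow> nat \<Rightarrow> real" where
  "fun_of_vec v = (\<lambda>i. if i < dim_vec v then v $ i else 0)"

lemma inj_on_fun_of_vec: "inj_on fun_of_vec (carrier_vec q)"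
proof (rule inj_onI)
  fix x y :: "real vec" assume xy: "x \<in> carrier_vec q" "y \<in> carrier_vec q" "fun_of_vec x = fun_of_vec y"
  show "x = y"
  proof (rule eq_vecI)
    fix i assume "i < dim_vec y"
    moreover have "fun_of_vec x i = fun_of_vec y i" using xy(3) by simp
    ultimately show "x $ i = y $ i" using xy(1,2) by (simp add: fun_of_vec_def)
  qed (use xy in auto)
qed

text \<open>Vanishing linear combinations correspond under the injective map
  \<open>fun_of_vec\<close>; this connects the module-theoretic notion behind
  \<open>vec_space.rank\<close> with the type-class one behind \<open>dim\<close>.\<close>

lemma lin_indpt_iff_independent:
  assumes fT: "finite T" and T: "T \<subseteq> carrier_vec q"
  shows "module.lin_dep class_ring (module_vec TYPE(real) q) T \<longleftrightarrow> dependent (fun_of_vec ` T)"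
proof -
  interpret vec_space "TYPE(real)" q .
  have inj: "inj_on fun_of_vec T" using inj_on_fun_of_vec T by (rule inj_on_subset)
  have sum0: "lincomb a T = 0\<^sub>v q \<longleftrightarrow> (\<Sum>v\<in>T. a v *\<^sub>R fun_of_vec v) = 0" for a
  proof -
    have "lincomb a T = 0\<^sub>v q \<longleftrightarrow> (\<forall>i<q. lincomb a T $ i = 0)"
      using lincomb_dim[OF fT T, of a] by (auto simp: vec_eq_iff)
    also have "\<dots> \<longleftrightarrow> (\<forall>i<q. (\<Sum>v\<in>T. a v * v $ i) = 0)"
      using lincomb_index[OF _ T, of _ a] by auto
    also have "\<dots> \<longleftrightarrow> (\<forall>i. (\<Sum>v\<in>T. a v * fun_of_vec v i) = 0)"
    proof -
      have "(\<Sum>v\<in>T. a v * fun_of_vec v i) = (if i < q then (\<Sum>v\<in>T. a v * v $ i) else 0)" for i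
      proof (cases "i < q")
        case True
        then show ?thesis using T by (auto simp: fun_of_vec_def intro!: sum.cong)
      next
        case False
        then show ?thesis using T by (auto simp: fun_of_vec_def intro!: sum.neutral)
      qed
      then show ?thesis by auto
    qed
    also have "\<dots> \<longleftrightarrow> (\<Sum>v\<in>T. a v *\<^sub>R fun_of_vec v) = 0"
      by (simp add: fun_eq_iff sum_fun_apply)
    finally show ?thesis .
  qed
  have "lin_dep T \<longleftrightarrow> (\<exists>a. (\<exists>v\<in>T. a v \<noteq> 0) \<and> lincomb a T = 0\<^sub>v q)"
  proof
    assume "lin_dep T"
    then show "\<exists>a. (\<exists>v\<in>T. a v \<noteq> 0) \<and> lincomb a T = 0\<^sub>v q"
      using finite_lin_dep[OF fT _ T] by auto
  next
    assume "\<exists>a. (\<exists>v\<in>T. a v \<noteq> 0) \<and> lincomb a T = 0\<^sub>v q"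
    then show "lin_dep T" using lin_dep_crit[OF fT subset_refl, of _ ] by (auto simp: class_field_def)
  qed
  also have "\<dots> \<longleftrightarrow> (\<exists>a. (\<exists>v\<in>T. a v \<noteq> 0) \<and> (\<Sum>v\<in>T. a v *\<^sub>R fun_of_vec v) = 0)"
    by (simp only: sum0)
  also have "\<dots> \<longleftrightarrow> (\<exists>u. (\<exists>w\<in>fun_of_vec ` T. u w \<noteq> 0) \<and> (\<Sum>w\<in>fun_of_vec ` T. u w *\<^sub>R w) = 0)"
  proof
    assume "\<exists>a. (\<exists>v\<in>T. a v \<noteq> 0) \<and> (\<Sum>v\<in>T. a v *\<^sub>R fun_of_vec v) = 0"
    then obtain a where a: "\<exists>v\<in>T. a v \<noteq> 0" "(\<Sum>v\<in>T. a v *\<^sub>R fun_of_vec v) = 0" by auto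
    define u where "u = a \<circ> the_inv_into T fun_of_vec"
    have u: "u (fun_of_vec v) = a v" if "v \<in> T" for v
      using the_inv_into_f_f[OF inj that] by (simp add: u_def)
    have "(\<Sum>w\<in>fun_of_vec ` T. u w *\<^sub>R w) = (\<Sum>v\<in>T. a v *\<^sub>R fun_of_vec v)"
      unfolding sum.reindex[OF inj] by (intro sum.cong) (auto simp: u)
    then show "\<exists>u. (\<exists>w\<in>fun_of_vec ` T. u w \<noteq> 0) \<and> (\<Sum>w\<in>fun_of_vec ` T. u w *\<^sub>R w) = 0"
      using a u by (intro exI[of _ u]) auto
  next
    assume "\<exists>u. (\<exists>w\<in>fun_of_vec ` T. u w \<noteq> 0) \<and> (\<Sum>w\<in>fun_of_vec ` T. u w *\<^sub>R w) = 0"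
    then obtain u where "\<exists>w\<in>fun_of_vec ` T. u w \<noteq> 0" "(\<Sum>w\<in>fun_of_vec ` T. u w *\<^sub>R w) = 0" by auto
    then show "\<exists>a. (\<exists>v\<in>T. a v \<noteq> 0) \<and> (\<Sum>v\<in>T. a v *\<^sub>R fun_of_vec v) = 0"
      unfolding sum.reindex[OF inj] by (intro exI[of _ "u \<circ> fun_of_vec"]) auto
  qed
  also have "\<dots> \<longleftrightarrow> dependent (fun_of_vec ` T)"
    using real_vector.dependent_finite[of "fun_of_vec ` T"] fT by simp
  finally show ?thesis .
qed

text \<open>The rank is the size of any maximal independent set of columns, and a basis chosen among
  the column functions is such a set.\<close>

lemma rank_eq_dim_cols:
  assumes A: "A \<in> carrier_mat q n"
  shows "vec_space.rank q A = dim (fun_of_vec ` set (cols A))"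
proof -
  have cols: "set (cols A) \<subseteq> carrier_vec q" using A cols_dim by blast
  obtain B where B: "B \<subseteq> fun_of_vec ` set (cols A)" "independent B" "fun_of_vec ` set (cols A) \<subseteq> span B"
    "card B = dim (fun_of_vec ` set (cols A))"
    using basis_exists[of "fun_of_vec ` set (cols A)"] .
  obtain S where S: "S \<subseteq> set (cols A)" "B = fun_of_vec ` S"
    using B(1) by (auto simp: subset_image_iff)
  have fin: "finite T" if "T \<subseteq> set (cols A)" for T using that finite_subset by blast
  have "maximal S (\<lambda>T. T \<subseteq> set (cols A) \<and> \<not> module.lin_dep class_ring (module_vec TYPE(real) q) T)"
    unfolding maximal_def
  proof (intro conjI allI impI)
    show "S \<subseteq> set (cols A)" by (fact S(1))
    show "\<not> module.lin_dep class_ring (module_vec TYPE(real) q) S"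
      using B(2) S lin_indpt_iff_independent[OF fin[OF S(1)], of q] cols by auto
  next
    fix T assume T: "S \<subseteq> T \<and> T \<subseteq> set (cols A) \<and> \<not> module.lin_dep class_ring (module_vec TYPE(real) q) T"
    then have ind: "independent (fun_of_vec ` T)"
      using lin_indpt_iff_independent[OF fin, of T q] cols by auto
    show "T = S"
    proof (rule ccontr)
      assume "T \<noteq> S"
      then obtain t where t: "t \<in> T" "t \<notin> S" using T by auto
      have "fun_of_vec t \<notin> fun_of_vec ` S"
        using t T cols S inj_on_image_mem_iff[OF inj_on_fun_of_vec, of t q S] by auto
      then have "fun_of_vec ` S \<subseteq> fun_of_vec ` T - {fun_of_vec t}"
        using T by (metis Diff_empty image_mono subset_Diff_insert)
      moreover have "fun_of_vec t \<in> fun_of_vec ` set (cols A)" using t T by blast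
      then have "fun_of_vec t \<in> span (fun_of_vec ` S)" using B(3) S(2) by blast
      ultimately have "fun_of_vec t \<in> span (fun_of_vec ` T - {fun_of_vec t})" using span_mono by blast
      then show False using ind t by (auto simp: real_vector.dependent_def)
    qed
  qed
  then have "vec_space.rank q A = card S" using vec_space.rank_card_indpt[OF A] by blast
  also have "\<dots> = card B"
    using S cols inj_on_fun_of_vec[of q] by (metis card_image inj_on_subset)
  finally show ?thesis using B(4) by simp
qed

subsection \<open>The constraint subspace\<close>

definition aug_row :: "real mat \<Rightarrow> real vec \<Rightarrow> nat \<Rightarrow> nat \<Rightarrow> real" where
  "aug_row A b i = (\<lambda>k. if k = 0 then - b $ i else if k \<le> dim_col A then A $$ (i, k - 1) else 0)"

definition aug_ker :: "real mat \<Rightarrow> real vec \<Rightarrow> (nat \<Rightarrow> real) set" where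
  "aug_ker A b = {v\<in>supp (Suc (dim_col A)). \<forall>i<dim_row A. dot (Suc (dim_col A)) (aug_row A b i) v = 0}"

lemma annihilated_aug_ker: "annihilated (Suc (dim_col A)) (aug_ker A b)"
  unfolding annihilated_def aug_ker_def
  by (rule exI[of _ "aug_row A b ` {..<dim_row A}"]) auto

lemma dot_aug_row:
  "dot (Suc (dim_col A)) (aug_row A b i) v = (\<Sum>k<dim_col A. A $$ (i, k) * v (Suc k)) - b $ i * v 0"
  unfolding dot_def sum.lessThan_Suc_shift by (simp add: aug_row_def)

definition mat_col :: "nat \<Rightarrow> real mat \<Rightarrow> nat \<Rightarrow> nat \<Rightarrow> real" where
  "mat_col N Y j = (\<lambda>i. if i < N then Y $$ (i, j) else 0)"

lemma rlt_affine_iff: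
  assumes A: "A \<in> carrier_mat q n" and b: "b \<in> carrier_vec q"
  shows "Y \<in> rlt_affine A b \<longleftrightarrow> Y \<in> sym_mats (Suc n) \<and> Y $$ (0, 0) = 1 \<and>
    (\<forall>i\<in>{1..n}. Y $$ (i, i) = Y $$ (0, i)) \<and> (\<forall>j<Suc n. mat_col (Suc n) Y j \<in> aug_ker A b)"
proof -
  have dims: "dim_row A = q" "dim_col A = n" using A by auto
  have "mat_of_cols q ((- b) # cols A) * Y = 0\<^sub>m q (Suc n) \<longleftrightarrow>
      (\<forall>j<Suc n. mat_col (Suc n) Y j \<in> aug_ker A b)" if Y: "Y \<in> sym_mats (Suc n)"
  proof -
    have "mat_col (Suc n) Y j \<in> aug_ker A b \<longleftrightarrow>
        (\<forall>i<q. (\<Sum>k<n. A $$ (i, k) * Y $$ (Suc k, j)) = b $ i * Y $$ (0, j))" if "j < Suc n" for j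
    proof -
      have "dot (Suc n) (aug_row A b i) (mat_col (Suc n) Y j)
          = (\<Sum>k<n. A $$ (i, k) * Y $$ (Suc k, j)) - b $ i * Y $$ (0, j)" for i
        using dot_aug_row[of A b i "mat_col (Suc n) Y j"] by (simp add: dims mat_col_def)
      then show ?thesis by (simp add: aug_ker_def dims supp_def) (simp add: mat_col_def)
    qed
    then show ?thesis unfolding aug_mult_eq_0_iff[OF A b sym_matsD(1)[OF Y]] by blast
  qed
  then show ?thesis by (auto simp: rlt_affine_def dims)
qed

text \<open>Feasibility makes \<open>b\<close> a combination of the columns of \<open>A\<close>, so
  the extra column does not raise the rank; the rest is rank-nullity on a space of dimension
  \<open>n + 1\<close>.\<close>

lemma dim_aug_ker:
  assumes A: "A \<in> carrier_mat q n" and b: "b \<in> carrier_vec q" and x: "x \<in> binary_points A b"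
  shows "dim (aug_ker A b) + vec_space.rank q A = Suc n"
proof -
  have dims: "dim_row A = q" "dim_col A = n" using A by auto
  define f where "f v = (\<lambda>i. if i < q then dot (Suc n) (aug_row A b i) v else 0)" for v
  have lf: "linear f"
    by (intro linearI) (auto simp: f_def fun_eq_iff linear_add[OF linear_dot] linear_scale[OF linear_dot])
  have ker: "{v\<in>supp (Suc n). f v = 0} = aug_ker A b"
    by (auto simp: f_def aug_ker_def dims fun_eq_iff split: if_splits)
  have fsuc: "f (unit_fun (Suc k)) = fun_of_vec (col A k)" if "k < n" for k
  proof
    fix i
    have "dot (Suc n) (aug_row A b i) (unit_fun (Suc k)) = (\<Sum>l<n. if l = k then A $$ (i, k) else 0)"
      using dot_aug_row[of A b i "unit_fun (Suc k)"] unfolding dims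
      by (simp add: unit_fun_def if_distrib cong: if_cong)
    then show "f (unit_fun (Suc k)) i = fun_of_vec (col A k) i"
      using that A by (simp add: f_def fun_of_vec_def)
  qed
  have "f (unit_fun 0) = (\<Sum>k<n. (- x $ k) *\<^sub>R fun_of_vec (col A k))"
  proof
    fix i
    have xb: "A *\<^sub>v x = b" "x \<in> carrier_vec n" using x by (auto simp: binary_points_def dims)
    show "f (unit_fun 0) i = (\<Sum>k<n. (- x $ k) *\<^sub>R fun_of_vec (col A k)) i"
    proof (cases "i < q")
      case True
      have "b $ i = (\<Sum>k<n. A $$ (i, k) * x $ k)"
        using True A xb(2) unfolding xb(1)[symmetric] by (simp add: scalar_prod_def atLeast0LessThan)
      then show ?thesis using True dot_aug_row[of A b i "unit_fun 0"] A
        by (simp add: dims f_def unit_fun_def sum_fun_apply fun_of_vec_def sum_negf mult.commute)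
    next
      case False
      then show ?thesis using A by (simp add: f_def sum_fun_apply fun_of_vec_def)
    qed
  qed
  also have "\<dots> \<in> span (fun_of_vec ` set (cols A))"
  proof (intro span_sum span_scale span_base)
    fix k assume "k \<in> {..<n}"
    then have "col A k \<in> set (cols A)" using A by (auto simp: cols_def)
    then show "fun_of_vec (col A k) \<in> fun_of_vec ` set (cols A)" by simp
  qed
  finally have f0: "f (unit_fun 0) \<in> span (fun_of_vec ` set (cols A))" .
  have "span (f ` supp (Suc n)) = span (fun_of_vec ` set (cols A))"
  proof (rule subset_antisym; rule span_minimal[OF _ subspace_span])
    have "f ` supp (Suc n) \<subseteq> f ` span (unit_fun ` {..<Suc n})" using supp_span by blast
    also have "\<dots> = span (f ` unit_fun ` {..<Suc n})" using linear_span_image[OF lf] by simp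
    also have "\<dots> \<subseteq> span (fun_of_vec ` set (cols A))"
    proof (rule span_minimal[OF _ subspace_span], clarify)
      fix k assume "k < Suc n"
      then show "f (unit_fun k) \<in> span (fun_of_vec ` set (cols A))"
        using f0 fsuc A by (cases k) (auto intro!: span_base simp: cols_def)
    qed
    finally show "f ` supp (Suc n) \<subseteq> span (fun_of_vec ` set (cols A))" .
    show "fun_of_vec ` set (cols A) \<subseteq> span (f ` supp (Suc n))"
    proof clarify
      fix c assume "c \<in> set (cols A)"
      then obtain k where k: "k < n" "c = col A k" using A by (auto simp: cols_def)
      have "unit_fun (Suc k) \<in> supp (Suc n)" using k by (auto simp: supp_def unit_fun_def)
      then show "fun_of_vec c \<in> span (f ` supp (Suc n))"
        using fsuc[OF k(1)] k by (metis image_eqI span_base)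
    qed
  qed
  then have "dim (f ` supp (Suc n)) = vec_space.rank q A"
    unfolding rank_eq_dim_cols[OF A] by (rule span_eq_dim)
  then show ?thesis
    using rank_nullity[OF fin_dim_supp subspace_supp lf, of "Suc n"] by (simp add: ker dim_supp)
qed

text \<open>The coordinates \<open>u\<^sub>0 = v\<^sub>0\<close>, \<open>u\<^sub>i = 2 v\<^sub>i - v\<^sub>0\<close>, in which \<open>v\<^sub>i\<^sup>2 - v\<^sub>0 v\<^sub>i\<close> becomes
  \<open>(u\<^sub>i\<^sup>2 - u\<^sub>0\<^sup>2) / 4\<close>.\<close>

definition to_pm :: "nat \<Rightarrow> (nat \<Rightarrow> real) \<Rightarrow> nat \<Rightarrow> real" where
  "to_pm N v = (\<lambda>i. if i = 0 then v 0 else if i < N then 2 * v i - v 0 else 0)"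

definition of_pm :: "nat \<Rightarrow> (nat \<Rightarrow> real) \<Rightarrow> nat \<Rightarrow> real" where
  "of_pm N u = (\<lambda>i. if i = 0 then u 0 else if i < N then (u i + u 0) / 2 else 0)"

lemma linear_to_pm: "linear (to_pm N)"
  by (intro linearI) (auto simp: to_pm_def fun_eq_iff algebra_simps)

lemma linear_of_pm: "linear (of_pm N)"
  by (intro linearI) (auto simp: of_pm_def fun_eq_iff field_simps)

lemma of_pm_to_pm: "0 < N \<Longrightarrow> v \<in> supp N \<Longrightarrow> of_pm N (to_pm N v) = v"
  by (auto simp: of_pm_def to_pm_def supp_def fun_eq_iff)

lemma to_pm_supp: "0 < N \<Longrightarrow> to_pm N v \<in> supp N"
  by (auto simp: to_pm_def supp_def)

lemma dim_to_pm:
  assumes V: "subspace V" "V \<subseteq> supp N" and N: "0 < N"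
  shows "dim (to_pm N ` V) = dim V"
proof -
  have "{v\<in>V. to_pm N v = 0} = {0}"
  proof
    show "{v\<in>V. to_pm N v = 0} \<subseteq> {0}"
    proof clarify
      fix v assume "v \<in> V" "to_pm N v = 0"
      then have "v = of_pm N 0" using of_pm_to_pm[OF N, of v] V by auto
      then show "v = 0" by (simp add: linear_0[OF linear_of_pm])
    qed
    show "{0} \<subseteq> {v\<in>V. to_pm N v = 0}" using V by (auto simp: subspace_0 linear_0[OF linear_to_pm])
  qed
  moreover have "dim {0::nat \<Rightarrow> real} = 0" using dim_le_card[of "{0::nat \<Rightarrow> real}" "{}"] by simp
  ultimately show ?thesis
    using rank_nullity[OF fin_dim_subset[OF fin_dim_supp V(2)] V(1) linear_to_pm, of N] by simp
qed

subsection \<open>Facial reduction sequences from subspaces\<close>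

lemma mat_inner_sym:
  assumes "X \<in> carrier_mat N N" "Y \<in> carrier_mat N N"
  shows "mat_inner X Y = mat_inner Y X"
  unfolding mat_inner_eq[OF assms] mat_inner_eq[OF assms(2,1)]
  by (subst sum.swap) (simp add: mult.commute)

text \<open>A strict drop of the subspace exhibits a vector on which the certificate is nonzero, so
  \<open>W j\<close> is not orthogonal to its face; a matrix of \<open>L\<close> with spanning list
  identifies the last face as the minimal one. Certificates are counted from 1 in the target and
  from 0 here, hence \<open>W (j - 1)\<close>.\<close>

lemma facial_reduction_seq_of_subspaces:
  assumes L: "L \<subseteq> sym_mats N" and V0: "V 0 = supp N"
    and W: "\<And>j. j < k \<Longrightarrow> W j \<in> perp N L \<and> (\<forall>v\<in>V j. 0 \<le> bilin N (W j) v v) \<and>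
      V (Suc j) = {v\<in>V j. bilin N (W j) v v = 0} \<and> V (Suc j) \<noteq> V j"
    and ws: "set ws \<subseteq> V k" "V k \<subseteq> span (set ws)" "gram N ws \<in> L"
  shows "facial_reduction_seq N L k (\<lambda>j. gram_cone N (V j)) (\<lambda>j. W (j - 1))"
proof -
  have Wsym: "W j \<in> sym_mats N" if "j < k" for j using W[OF that] by (auto simp: perp_def)
  have ann: "j \<le> k \<Longrightarrow> annihilated N (V j)" for j
  proof (induction j)
    case 0
    then show ?case by (simp add: V0 annihilated_UNIV)
  next
    case (Suc j)
    then have j: "annihilated N (V j)" "j < k" by auto
    then show ?case using annihilated_psd_null[OF j(1) Wsym[OF j(2)]] W[OF j(2)] by simp
  qed
  have step: "gram_cone N (V (Suc j)) = gram_cone N (V j) \<inter> perp N {W j}" if "j < k" for j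
    using gram_cone_Int_perp[OF Wsym[OF that], of "V j"] W[OF that] by simp
  have sub: "j \<le> k \<Longrightarrow> L \<inter> psd_cone N \<subseteq> gram_cone N (V j)" for j
  proof (induction j)
    case 0
    then show ?case by (simp add: V0 psd_cone_eq_gram_cone)
  next
    case (Suc j)
    have "L \<subseteq> perp N {W j}"
    proof
      fix X assume X: "X \<in> L"
      have "W j \<in> perp N L" using W Suc by auto
      then have "mat_inner (W j) X = 0" "X \<in> sym_mats N" "W j \<in> sym_mats N"
        using X L by (auto simp: perp_def)
      then show "X \<in> perp N {W j}" using mat_inner_sym[of X N "W j"] by (auto simp: perp_def sym_matsD(1))
    qed
    then show ?case using step[of j] Suc by auto
  qed
  show ?thesis
    unfolding facial_reduction_seq_def
  proof (intro conjI allI impI ballI)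
    show "gram_cone N (V 0) = psd_cone N" by (simp add: V0 psd_cone_eq_gram_cone)
    show "mat_face_of (gram_cone N (V j)) (psd_cone N)" if "j \<le> k" for j
      using gram_cone_face[OF ann[OF that]] .
    show "gram_cone N (V k) = min_face N (L \<inter> psd_cone N)"
      using min_face_eq_gram_cone[OF ann[OF order_refl] sub[OF order_refl] ws(1,2)] ws(3) gram_psd by simp
  next
    fix j assume "j \<in> {1..k}"
    then obtain i where i: "j = Suc i" "i < k" by (cases j) auto
    have Wi: "W i \<in> perp N L" "\<And>v. v \<in> V i \<Longrightarrow> 0 \<le> bilin N (W i) v v" using W[OF i(2)] by auto
    obtain v where v: "v \<in> V i" "bilin N (W i) v v \<noteq> 0" using W[OF i(2)] by auto
    show "W (j - 1) \<in> perp N L \<inter> (dual_cone N (gram_cone N (V (j - 1))) - perp N (gram_cone N (V (j - 1))))"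
      using Wi gram_cone_dual[OF Wsym[OF i(2)] Wi(2)] gram_cone_not_perp[OF Wsym[OF i(2)] v] i by simp
    show "gram_cone N (V j) = gram_cone N (V (j - 1)) \<inter> perp N {W (j - 1)}"
      using step[OF i(2)] i by simp
  qed
qed

subsection \<open>The upper bound\<close>

definition form_mat :: "nat \<Rightarrow> ((nat \<Rightarrow> real) \<Rightarrow> (nat \<Rightarrow> real) \<Rightarrow> real) \<Rightarrow> real mat" where
  "form_mat N B = mat N N (\<lambda>(i, j). B (unit_fun i) (unit_fun j))"

lemma bilin_form_mat:
  assumes lin1: "\<And>y. linear (\<lambda>x. B x y)" and lin2: "\<And>x. linear (B x)"
    and xy: "x \<in> supp N" "y \<in> supp N"
  shows "bilin N (form_mat N B) x y = B x y"
proof -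
  have "B x y = B (\<Sum>i<N. x i *\<^sub>R unit_fun i) (\<Sum>j<N. y j *\<^sub>R unit_fun j)"
    using supp_expand[OF xy(1)] supp_expand[OF xy(2)] by simp
  also have "\<dots> = (\<Sum>i<N. x i * B (unit_fun i) (\<Sum>j<N. y j *\<^sub>R unit_fun j))"
    by (simp add: linear_sum[OF lin1] linear_scale[OF lin1])
  also have "\<dots> = (\<Sum>i<N. \<Sum>j<N. x i * (y j * B (unit_fun i) (unit_fun j)))"
    by (simp add: linear_sum[OF lin2] linear_scale[OF lin2] sum_distrib_left)
  also have "\<dots> = bilin N (form_mat N B) x y"
    unfolding bilin_def by (intro sum.cong refl) (simp add: form_mat_def mult_ac)
  finally show ?thesis by simp
qed

lemma mat_col_expand: "mat_col N Y j = (\<Sum>i<N. Y $$ (i, j) *\<^sub>R unit_fun i)"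
proof -
  have "mat_col N Y j \<in> supp N" by (auto simp: mat_col_def supp_def)
  from supp_expand[OF this] show ?thesis by (simp add: mat_col_def)
qed

locale rlt_feasible =
  fixes q n :: nat and A :: "real mat" and b x :: "real vec"
  assumes A: "A \<in> carrier_mat q n" and b: "b \<in> carrier_vec q" and x: "x \<in> binary_points A b"
begin

abbreviation "N \<equiv> Suc n"
abbreviation "V \<equiv> aug_ker A b"
abbreviation "L \<equiv> rlt_affine A b"

lemma dims: "dim_row A = q" "dim_col A = n" using A by auto

lemma V: "subspace V" "V \<subseteq> supp N"
  using annihilated_subspace[OF annihilated_aug_ker, of A b] annihilated_supp[OF annihilated_aug_ker, of A b]
  by (simp_all add: dims)

text \<open>A form that is semidefinite on \<open>V\<close> becomes semidefinite everywhere when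
  pulled back along a linear projection onto \<open>V\<close>. The first certificate needs this,
  since it acts on the full cone.\<close>

definition proj :: "(nat \<Rightarrow> real) \<Rightarrow> nat \<Rightarrow> real" where
  "proj = (SOME g. range g \<subseteq> V \<and> linear g \<and> (\<forall>v\<in>V. g v = v))"

lemma proj: "proj v \<in> V" "linear proj" "v \<in> V \<Longrightarrow> proj v = v"
proof -
  have "\<exists>g. range g \<subseteq> V \<and> linear g \<and> (\<forall>v\<in>V. g (id v) = v)"
    using V(1) by (intro linear_exists_left_inverse_on linear_id) auto
  then have "\<exists>g. range g \<subseteq> V \<and> linear g \<and> (\<forall>v\<in>V. g v = v)" by simp
  from someI_ex[OF this] have "range proj \<subseteq> V \<and> linear proj \<and> (\<forall>v\<in>V. proj v = v)"
    unfolding proj_def .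
  then show "proj v \<in> V" "linear proj" "v \<in> V \<Longrightarrow> proj v = v" by auto
qed

text \<open>The diagonal form \<open>d\<close>, extended from \<open>V\<close> by the projection, plus the square of the
  constraints: the second summand makes a first step with this form also reduce to \<open>V\<close>.\<close>

definition cert_form :: "(nat \<Rightarrow> real) \<Rightarrow> (nat \<Rightarrow> real) \<Rightarrow> (nat \<Rightarrow> real) \<Rightarrow> real" where
  "cert_form d v w = diag_form N d (to_pm N (proj v)) (to_pm N (proj w))
    + (\<Sum>i<q. dot N (aug_row A b i) v * dot N (aug_row A b i) w)"

lemma cert_form_sym: "cert_form d v w = cert_form d w v"
  by (simp add: cert_form_def diag_form_sym[of N d "to_pm N (proj v)"] mult.commute)

lemma linear_cert_form: "linear (cert_form d v)" "linear (\<lambda>v. cert_form d v w)"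
proof -
  show 1: "linear (cert_form d v)" for v
    by (intro linearI) (simp_all add: cert_form_def linear_add[OF proj(2)] linear_scale[OF proj(2)]
        linear_add[OF linear_to_pm] linear_scale[OF linear_to_pm] linear_add[OF linear_diag_form(1)]
        linear_scale[OF linear_diag_form(1)] linear_add[OF linear_dot] linear_scale[OF linear_dot]
        sum.distrib distrib_left sum_distrib_left mult_ac)
  show "linear (\<lambda>v. cert_form d v w)"
    using 1[of w] by (subst cert_form_sym)
qed

lemma dot_aug_row_V: "v \<in> V \<Longrightarrow> i < q \<Longrightarrow> dot N (aug_row A b i) v = 0"
  by (simp add: aug_ker_def dims)

lemma cert_form_V:
  assumes "v \<in> V"
  shows "cert_form d v w = diag_form N d (to_pm N v) (to_pm N (proj w))"
  using assms by (simp add: cert_form_def dot_aug_row_V proj)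

definition cert :: "(nat \<Rightarrow> real) \<Rightarrow> real mat" where
  "cert d = form_mat N (cert_form d)"

lemma bilin_cert: "v \<in> supp N \<Longrightarrow> bilin N (cert d) v v = cert_form d v v"
  unfolding cert_def by (rule bilin_form_mat[OF linear_cert_form(2) linear_cert_form(1)])

text \<open>The columns of a matrix in \<open>L\<close> lie in \<open>V\<close>, where the
  projection is the identity and the constraint squares vanish. The pairing reduces to the diagonal
  form applied to \<open>Y\<close> in the coordinates \<open>u\<close>, whose diagonal is constant
  1, and so to the trace of \<open>d\<close>.\<close>

lemma cert_perp:
  assumes d: "(\<Sum>i<N. d i) = 0"
  shows "cert d \<in> perp N L"
proof -
  have car: "cert d \<in> carrier_mat N N" by (simp add: cert_def form_mat_def)
  have "cert d \<in> sym_mats N"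
    using car by (intro sym_matsI) (auto simp: cert_def form_mat_def intro: cert_form_sym)
  moreover have "mat_inner (cert d) Y = 0" if "Y \<in> L" for Y
  proof -
    have Y: "Y \<in> sym_mats N" "Y $$ (0, 0) = 1" "\<And>i. i \<in> {1..n} \<Longrightarrow> Y $$ (i, i) = Y $$ (0, i)"
      "\<And>j. j < N \<Longrightarrow> mat_col N Y j \<in> V"
      using that by (auto simp: rlt_affine_iff[OF A b])
    note Ys = sym_matsD[OF Y(1)]
    let ?c = "mat_col N Y"
    have "mat_inner (cert d) Y = (\<Sum>i<N. \<Sum>j<N. Y $$ (j, i) * cert_form d (unit_fun j) (unit_fun i))"
      unfolding mat_inner_eq[OF car Ys(1)]
      by (intro sum.cong refl) (simp add: cert_def form_mat_def cert_form_sym mult.commute)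
    also have "\<dots> = (\<Sum>i<N. cert_form d (?c i) (unit_fun i))"
      by (simp add: mat_col_expand linear_sum[OF linear_cert_form(2)] linear_scale[OF linear_cert_form(2)]
          del: sum.lessThan_Suc)
    also have "\<dots> = (\<Sum>i<N. diag_form N d (to_pm N (?c i)) (to_pm N (proj (unit_fun i))))"
      using Y(4) by (intro sum.cong refl) (simp add: cert_form_V)
    also have "\<dots> = (\<Sum>i<N. \<Sum>j<N. Y $$ (j, i) * diag_form N d (to_pm N (unit_fun j)) (to_pm N (proj (unit_fun i))))"
      by (simp add: mat_col_expand linear_sum[OF linear_to_pm] linear_scale[OF linear_to_pm]
          linear_sum[OF linear_diag_form(2)] linear_scale[OF linear_diag_form(2)] del: sum.lessThan_Suc)
    \<comment> \<open>By symmetry of \<open>Y\<close> its columns can now be collected in the second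
      argument, to remove the projection there as well.\<close>
    also have "\<dots> = (\<Sum>j<N. \<Sum>i<N. Y $$ (i, j) * diag_form N d (to_pm N (unit_fun j)) (to_pm N (proj (unit_fun i))))"
      by (subst sum.swap) (use Ys(2) in \<open>auto intro!: sum.cong\<close>)
    also have "\<dots> = (\<Sum>j<N. diag_form N d (to_pm N (unit_fun j)) (to_pm N (proj (?c j))))"
      by (simp add: mat_col_expand linear_sum[OF linear_to_pm] linear_scale[OF linear_to_pm]
          linear_sum[OF proj(2)] linear_scale[OF proj(2)]
          linear_sum[OF linear_diag_form(1)] linear_scale[OF linear_diag_form(1)] del: sum.lessThan_Suc)
    also have "\<dots> = (\<Sum>j<N. diag_form N d (to_pm N (unit_fun j)) (to_pm N (?c j)))"
      using Y(4) by (intro sum.cong refl) (simp add: proj)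
    also have "\<dots> = (\<Sum>k<N. d k * (\<Sum>j<N. to_pm N (unit_fun j) k * to_pm N (?c j) k))"
      unfolding diag_form_def by (subst sum.swap) (simp add: sum_distrib_left mult.assoc del: sum.lessThan_Suc)
    \<comment> \<open>Diagonal entry \<open>k\<close> of \<open>Y\<close> in the new coordinates is
      4 Y_kk - 4 Y_0k + Y_00 for positive \<open>k\<close> and Y_00 for k = 0, in both cases
      1.\<close>
    also have "\<dots> = (\<Sum>k<N. d k)"
    proof (intro sum.cong refl)
      fix k assume "k \<in> {..<N}"
      then have k: "k < N" by simp
      have pick: "(\<Sum>j<N. unit_fun j i * h j) = h i" if "i < N" for i and h :: "nat \<Rightarrow> real"
      proof -
        have "(\<Sum>j<N. unit_fun j i * h j) = (\<Sum>j<N. if j = i then h i else 0)"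
          by (intro sum.cong) (auto simp: unit_fun_def)
        then show ?thesis using that by (simp del: sum.lessThan_Suc)
      qed
      have "(\<Sum>j<N. to_pm N (unit_fun j) k * to_pm N (?c j) k) = 1"
      proof (cases "k = 0")
        case True
        then show ?thesis using pick[of 0 "\<lambda>j. ?c j 0"] Y(2) by (simp add: to_pm_def mat_col_def del: sum.lessThan_Suc)
      next
        case False
        have "(\<Sum>j<N. to_pm N (unit_fun j) k * to_pm N (?c j) k)
            = 2 * (\<Sum>j<N. unit_fun j k * (2 * Y $$ (k, j) - Y $$ (0, j)))
              - (\<Sum>j<N. unit_fun j 0 * (2 * Y $$ (k, j) - Y $$ (0, j)))"
          unfolding sum_distrib_left sum_subtractf[symmetric] using False k
          by (intro sum.cong refl) (simp add: to_pm_def mat_col_def algebra_simps)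
        also have "\<dots> = 2 * (2 * Y $$ (k, k) - Y $$ (0, k)) - (2 * Y $$ (k, 0) - Y $$ (0, 0))"
          using pick[OF k] pick[of 0] by (simp del: sum.lessThan_Suc)
        also have "\<dots> = 1" using Y(2) Y(3)[of k] Ys(2)[of k 0] False k by simp
        finally show ?thesis .
      qed
      then show "d k * (\<Sum>j<N. to_pm N (unit_fun j) k * to_pm N (?c j) k) = d k" by simp
    qed
    finally show ?thesis using d by simp
  qed
  ultimately show ?thesis by (auto simp: perp_def)
qed

definition base_point :: "nat \<Rightarrow> real" where
  "base_point = (\<lambda>i. if i = 0 then 1 else if i \<le> n then x $ (i - 1) else 0)"

lemma base_point: "base_point \<in> V" "i < N \<Longrightarrow> (to_pm N base_point i)\<^sup>2 = 1"
proof -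
  have x': "x \<in> carrier_vec n" "\<And>i. i < n \<Longrightarrow> x $ i \<in> {0, 1}" "A *\<^sub>v x = b"
    using x by (auto simp: binary_points_def dims)
  have "dot N (aug_row A b i) base_point = 0" if i: "i < q" for i
  proof -
    have "b $ i = (\<Sum>k<n. A $$ (i, k) * x $ k)"
      using i A x'(1) unfolding x'(3)[symmetric] by (simp add: scalar_prod_def atLeast0LessThan)
    then show ?thesis using dot_aug_row[of A b i base_point] by (simp add: dims base_point_def)
  qed
  then show "base_point \<in> V" by (auto simp: aug_ker_def dims supp_def base_point_def)
  show "(to_pm N base_point i)\<^sup>2 = 1" if "i < N"
  proof (cases i)
    case 0
    then show ?thesis by (simp add: to_pm_def base_point_def)
  next
    case (Suc k)
    then show ?thesis using that x'(2)[of k] by (auto simp: to_pm_def base_point_def)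
  qed
qed

lemma singularity_degree_le:
  assumes m: "vec_space.rank q A = m" "0 < m" "m < n"
  shows "singularity_degree N L \<le> enat (min m (n - m))"
proof -
  define U where "U = to_pm N ` V"
  have U: "subspace U" "U \<subseteq> supp N"
    using linear_subspace_image[OF linear_to_pm V(1)] to_pm_supp by (auto simp: U_def)
  have dimV: "dim V + m = N" using dim_aug_ker[OF A b x] m by simp
  have dimU: "dim U = dim V" unfolding U_def using V by (intro dim_to_pm) auto
  define e where "e = to_pm N base_point"
  have e: "e \<in> U" "\<forall>i<N. (e i)\<^sup>2 = 1" using base_point by (auto simp: e_def U_def)
  obtain k f ws where f: "f 0 = U" "\<forall>j<k. diag_reduces N (f j) (f (Suc j))" and ws: "slater N (f k) ws"
    using diag_chain_exists[OF U e] by blast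
  have fU: "subspace (f 0)" "f 0 \<subseteq> supp N" "e \<in> f 0" using f(1) U e by auto
  have "k + dim U \<le> N" using chain_length_le_codim[OF f(2) fU e(2)] f(1) by simp
  moreover have "k < dim U" using chain_length_less_dim[OF f(2) fU e(2)] f(1) by simp
  ultimately have k: "k \<le> min m (n - m)" using dimV dimU m by auto
  have fsub: "subspace (f j)" "f j \<subseteq> U" if "j \<le> k" for j
    using chain_subspace[OF f(2) fU(1,3) e(2) that] f(1) by auto
  \<comment> \<open>The chain was built in the coordinates \<open>u\<close>; certificates and faces
    live in the original coordinates.\<close>
  define VV where "VV j = {v\<in>V. to_pm N v \<in> f j}" for j
  have VV0: "VV 0 = V" by (auto simp: VV_def f(1) U_def)
  have pm: "to_pm N (of_pm N u) = u" "of_pm N u \<in> V" if "u \<in> U" for u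
    using that V of_pm_to_pm[of N] by (auto simp: U_def)
  define step where "step j c \<longleftrightarrow> (\<Sum>i<N. c i) = 0 \<and> (\<forall>u\<in>f j. 0 \<le> diag_form N c u u) \<and>
      f (Suc j) = {u\<in>f j. diag_form N c u u = 0} \<and> f (Suc j) \<noteq> f j" for j c
  have "\<forall>j. \<exists>c. j < k \<longrightarrow> step j c" using f(2) unfolding diag_reduces_def step_def by blast
  from choice[OF this] obtain d where "\<forall>j. j < k \<longrightarrow> step j (d j)" by blast
  then have d: "(\<Sum>i<N. d j i) = 0 \<and> (\<forall>u\<in>f j. 0 \<le> diag_form N (d j) u u) \<and>
      f (Suc j) = {u\<in>f j. diag_form N (d j) u u = 0} \<and> f (Suc j) \<noteq> f j" if "j < k" for j
    using that unfolding step_def by blast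
  have cV: "bilin N (cert c) v v = diag_form N c (to_pm N v) (to_pm N v)" if "v \<in> V" for c v
    using that V(2) by (auto simp: bilin_cert cert_form_V proj)
  have cS: "bilin N (cert c) v v = diag_form N c (to_pm N (proj v)) (to_pm N (proj v))
      + (\<Sum>i<q. (dot N (aug_row A b i) v)\<^sup>2)" if "v \<in> supp N" for c v
    using that by (simp add: bilin_cert cert_form_def power2_eq_square)
  have S0: "{v\<in>supp N. (\<Sum>i<q. (dot N (aug_row A b i) v)\<^sup>2) = 0} = V"
    by (auto simp: aug_ker_def dims sum_nonneg_eq_0_iff)
  have VVne: "VV (Suc j) \<noteq> VV j" if j: "j < k" for j
  proof -
    obtain u where u: "u \<in> f j" "u \<notin> f (Suc j)" using d[OF j] by blast
    then have "u \<in> U" using fsub(2)[of j] j by auto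
    then have "of_pm N u \<in> VV j" "of_pm N u \<notin> VV (Suc j)" using pm u by (auto simp: VV_def)
    then show ?thesis by blast
  qed
  define ws' where "ws' = map (of_pm N) ws"
  have wsU: "set ws \<subseteq> U" using ws fsub(2)[of k] by (auto simp: slater_def)
  have ws'1: "set ws' \<subseteq> VV k"
  proof
    fix v assume "v \<in> set ws'"
    then obtain w where w: "w \<in> set ws" "v = of_pm N w" by (auto simp: ws'_def)
    have "w \<in> U" "w \<in> f k" using w(1) wsU ws by (auto simp: slater_def)
    then show "v \<in> VV k" using pm w(2) by (simp add: VV_def)
  qed
  have ws'2: "VV k \<subseteq> span (set ws')"
  proof
    fix v assume v: "v \<in> VV k"
    then have "v = of_pm N (to_pm N v)" using V of_pm_to_pm[of N v] by (auto simp: VV_def)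
    also have "\<dots> \<in> of_pm N ` span (set ws)" using v ws by (auto simp: VV_def slater_def)
    also have "\<dots> = span (set ws')" using linear_span_image[OF linear_of_pm, of N "set ws"] by (simp add: ws'_def)
    finally show "v \<in> span (set ws')" .
  qed
  have g0: "gsum ws' 0 0 = gsum ws 0 0"
    unfolding ws'_def by (induction ws) (auto simp: of_pm_def)
  \<comment> \<open>The equal diagonal entries of the Slater matrix turn into the constraint that
    the diagonal agrees with row 0.\<close>
  have gi: "gsum ws' i i - gsum ws' 0 i = (gsum ws i i - gsum ws 0 0) / 4" if "i \<in> {1..n}" for i
    unfolding ws'_def using that by (induction ws) (auto simp: of_pm_def field_simps)
  have ws'3: "gram N ws' \<in> L"
    unfolding rlt_affine_iff[OF A b]
  proof (intro conjI ballI allI impI)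
    show "gram N ws' \<in> sym_mats N" by (rule gram_sym_mats)
    show "gram N ws' $$ (0, 0) = 1" using g0 ws by (simp add: slater_def)
    show "gram N ws' $$ (i, i) = gram N ws' $$ (0, i)" if "i \<in> {1..n}" for i
      using gi[OF that] ws that by (simp add: slater_def)
    fix j assume j: "j < N"
    have sub: "set gs \<subseteq> V \<Longrightarrow> (\<lambda>i. if i < N then gsum gs i j else 0) \<in> V" for gs
    proof (induction gs)
      case Nil
      have "(\<lambda>i. if i < N then gsum [] i j else 0) = 0" by (auto simp: fun_eq_iff)
      then show ?case using V(1) by (simp add: subspace_0)
    next
      case (Cons g gs)
      have "(\<lambda>i. if i < N then gsum (g # gs) i j else 0) = g j *\<^sub>R g + (\<lambda>i. if i < N then gsum gs i j else 0)"
        using Cons.prems V(2) by (auto simp: fun_eq_iff supp_def)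
      then show ?case using Cons V(1) by (auto intro: subspace_add subspace_scale)
    qed
    have "mat_col N (gram N ws') j = (\<lambda>i. if i < N then gsum ws' i j else 0)"
      using j by (auto simp: mat_col_def)
    then show "mat_col N (gram N ws') j \<in> V" using sub[of ws'] ws'1 by (auto simp: VV_def)
  qed
  have Lsym: "L \<subseteq> sym_mats N" by (auto simp: rlt_affine_iff[OF A b])
  have "\<exists>k' F W. k' \<le> min m (n - m) \<and> facial_reduction_seq N L k' F W"
  \<comment> \<open>An empty chain means that \<open>V\<close> already has a Slater matrix, yet the
    passage from the full cone to \<open>V\<close> still takes one step, with \<open>d = 0\<close>.
    The bound absorbs it because both \<open>m\<close> and \<open>n - m\<close> are
    positive.\<close>
  proof (cases "k = 0")
    case True
    define VS where "VS j = (if j = 0 then supp N else V)" for j :: nat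
    have "V \<noteq> supp N" using dimV m dim_supp[of N] by auto
    have "facial_reduction_seq N L 1 (\<lambda>j. gram_cone N (VS j)) (\<lambda>j. (\<lambda>_. cert (\<lambda>_. 0)) (j - 1))"
    proof (rule facial_reduction_seq_of_subspaces[OF Lsym])
      fix j :: nat assume "j < 1"
      have z: "diag_form N (\<lambda>_. 0) v w = 0" for v w by (simp add: diag_form_def)
      show "cert (\<lambda>_. 0) \<in> perp N L \<and> (\<forall>v\<in>VS j. 0 \<le> bilin N (cert (\<lambda>_. 0)) v v) \<and>
          VS (Suc j) = {v\<in>VS j. bilin N (cert (\<lambda>_. 0)) v v = 0} \<and> VS (Suc j) \<noteq> VS j"
        using \<open>j < 1\<close> cert_perp[of "\<lambda>_. 0"] S0 \<open>V \<noteq> supp N\<close>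
        by (auto simp: VS_def cS z sum_nonneg cong: conj_cong)
    qed (use ws'1 ws'2 ws'3 True VV0 in \<open>auto simp: VS_def\<close>)
    moreover have "1 \<le> min m (n - m)" using m by simp
    ultimately show ?thesis by blast
  next
    case False
    \<comment> \<open>Stage 0 is the whole space in place of \<open>V\<close>, so the first
      certificate has to cut out \<open>V\<close> and perform the first diagonal reduction at
      once.\<close>
    define VS where "VS j = (if j = 0 then supp N else VV j)" for j
    have "facial_reduction_seq N L k (\<lambda>j. gram_cone N (VS j)) (\<lambda>j. (\<lambda>j. cert (d j)) (j - 1))"
    proof (rule facial_reduction_seq_of_subspaces[OF Lsym])
      fix j assume j: "j < k"
      have psd: "\<forall>v\<in>VS j. 0 \<le> bilin N (cert (d j)) v v"
      proof
        fix v assume v: "v \<in> VS j"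
        show "0 \<le> bilin N (cert (d j)) v v"
        proof (cases "j = 0")
          case True
          have "to_pm N (proj v) \<in> f j" using proj(1) True by (auto simp: f(1) U_def)
          then have "0 \<le> diag_form N (d j) (to_pm N (proj v)) (to_pm N (proj v))" using d[OF j] by blast
          moreover have "v \<in> supp N" using v True by (simp add: VS_def)
          ultimately show ?thesis by (simp add: cS sum_nonneg)
        next
          case False
          then have "v \<in> V" "to_pm N v \<in> f j" using v by (auto simp: VS_def VV_def)
          then show ?thesis using d[OF j] by (simp add: cV)
        qed
      qed
      have zero: "VS (Suc j) = {v\<in>VS j. bilin N (cert (d j)) v v = 0}"
      proof (cases "j = 0")
        case True
        \<comment> \<open>Both summands of the certificate are nonnegative. A zero therefore forces
          the constraint equations, and on \<open>V\<close> what remains is the diagonal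
          form.\<close>
        have "bilin N (cert (d j)) v v = 0 \<longleftrightarrow> v \<in> VV (Suc j)" if v: "v \<in> supp N" for v
        proof
          assume q0: "bilin N (cert (d j)) v v = 0"
          have "to_pm N (proj v) \<in> f j" using proj(1) True by (auto simp: f(1) U_def)
          then have "0 \<le> diag_form N (d j) (to_pm N (proj v)) (to_pm N (proj v))" using d[OF j] by blast
          moreover have "0 \<le> (\<Sum>i<q. (dot N (aug_row A b i) v)\<^sup>2)" by (simp add: sum_nonneg)
          ultimately have "(\<Sum>i<q. (dot N (aug_row A b i) v)\<^sup>2) = 0" using q0 cS[OF v, of "d j"] by linarith
          then have vV: "v \<in> V" using S0 v by blast
          then show "v \<in> VV (Suc j)"
            using q0 cV[OF vV, of "d j"] d[OF j] True by (auto simp: VV_def f(1) U_def)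
        next
          assume "v \<in> VV (Suc j)"
          then show "bilin N (cert (d j)) v v = 0" using d[OF j] by (auto simp: VV_def cV)
        qed
        moreover have "VV (Suc j) \<subseteq> supp N" using V by (auto simp: VV_def)
        ultimately show ?thesis using True by (auto simp: VS_def)
      next
        case False
        then show ?thesis using d[OF j] by (auto simp: VS_def VV_def cV)
      qed
      have "VS (Suc j) \<noteq> VS j"
      proof (cases "j = 0")
        case True
        have "VV (Suc j) \<subset> V" using VVne[OF j] True VV0 by (auto simp: VV_def)
        then show ?thesis using V True by (auto simp: VS_def)
      next
        case False
        then show ?thesis using VVne[OF j] by (simp add: VS_def)
      qed
      then show "cert (d j) \<in> perp N L \<and> (\<forall>v\<in>VS j. 0 \<le> bilin N (cert (d j)) v v) \<and>
          VS (Suc j) = {v\<in>VS j. bilin N (cert (d j)) v v = 0} \<and> VS (Suc j) \<noteq> VS j"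
        using psd zero cert_perp d[OF j] by blast
    qed (use ws'1 ws'2 ws'3 False in \<open>auto simp: VS_def\<close>)
    then show ?thesis using k by blast
  qed
  then obtain k' F W where k': "k' \<le> min m (n - m)" "facial_reduction_seq N L k' F W" by blast
  have "singularity_degree N L \<le> enat k'"
    unfolding singularity_degree_def using k'(2) by (intro INF_lower) blast
  also have "\<dots> \<le> enat (min m (n - m))" using k'(1) by simp
  finally show ?thesis .
qed

end

subsection \<open>The extremal example\<close>

lemma coeff_square_top:
  fixes p :: "real poly"
  assumes "degree p \<le> d"
  shows "coeff (p * p) (2 * d) = (coeff p d)\<^sup>2"
proof (cases "degree p = d")
  case True
  then show ?thesis using coeff_mult_degree_sum[of p p] by (simp add: power2_eq_square mult_2)
next
  case False
  then have "degree p < d" using assms by simp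
  then have "degree (p * p) < 2 * d" using degree_mult_le[of p p] by simp
  then show ?thesis using \<open>degree p < d\<close> by (simp add: coeff_eq_0)
qed

text \<open>On the left the top degree doubles and cannot cancel.\<close>

lemma sum_squares_eq_linear:
  fixes P :: "'a \<Rightarrow> real poly"
  assumes eq: "(\<Sum>g\<leftarrow>gs. P g * P g) = (\<Sum>g\<leftarrow>gs. Polynomial.smult (c g) (P g))"
    and P0: "\<And>g. g \<in> set gs \<Longrightarrow> poly (P g) 0 = 0" and g: "g \<in> set gs"
  shows "P g = 0"
proof -
  define d where "d = Max ((\<lambda>g. degree (P g)) ` set gs)"
  have le: "degree (P h) \<le> d" if "h \<in> set gs" for h using that by (auto simp: d_def)
  have "d = 0"
  proof (rule ccontr)
    assume "d \<noteq> 0"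
    have "coeff (\<Sum>g\<leftarrow>gs. P g * P g) (2 * d) = (\<Sum>g\<leftarrow>gs. (coeff (P g) d)\<^sup>2)"
      using le by (induction gs) (auto simp: coeff_square_top)
    moreover have "coeff (\<Sum>g\<leftarrow>gs. Polynomial.smult (c g) (P g)) (2 * d) = 0"
    proof -
      have "coeff (P h) (2 * d) = 0" if "h \<in> set gs" for h
        using le[OF that] \<open>d \<noteq> 0\<close> by (intro coeff_eq_0) simp
      then show ?thesis by (induction gs) auto
    qed
    ultimately have "(\<Sum>g\<leftarrow>gs. (coeff (P g) d)\<^sup>2) = 0" using eq by simp
    then have "\<forall>x\<in>set (map (\<lambda>g. (coeff (P g) d)\<^sup>2) gs). x = 0"
      by (subst (asm) sum_list_nonneg_eq_0_iff) auto
    then have z: "coeff (P h) d = 0" if "h \<in> set gs" for h using that by auto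
    have "d \<in> (\<lambda>g. degree (P g)) ` set gs" unfolding d_def using g by (intro Max_in) auto
    then obtain h where "h \<in> set gs" "degree (P h) = d" by auto
    then have "P h = 0" using z[of h] by (metis leading_coeff_0_iff)
    then show False using \<open>degree (P h) = d\<close> \<open>d \<noteq> 0\<close> by simp
  qed
  then have "degree (P g) = 0" using le[OF g] by simp
  then obtain a where "P g = [:a:]" by (rule degree_eq_zeroE)
  then show ?thesis using P0[OF g] by simp
qed

section \<open>Interpolation at integer nodes\<close>

lemma lagrange_basis_exists:
  "\<exists>l. \<forall>j\<in>{1..k}. degree (l j :: real poly) \<le> k \<and> poly (l j) 0 = 0 \<and>
     (\<forall>i\<in>{1..k}. poly (l j) (real i) = (if i = j then 1 else 0))"
proof -
  \<comment> \<open>The product runs over the nodes 0, ..., k except \<open>j\<close>; including the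
    node 0 gives the zero at the origin while the degree stays \<open>k\<close>.\<close>
  define r where "r j = (\<Prod>i\<in>{0..k} - {j}. [:- real i, 1:])" for j
  define l where "l j = Polynomial.smult (1 / poly (r j) (real j)) (r j)" for j
  have pr: "poly (r j) t = (\<Prod>i\<in>{0..k} - {j}. t - real i)" for j t
    by (simp add: r_def poly_prod)
  have "degree (l j) \<le> k" if "j \<in> {1..k}" for j
  proof -
    have "degree (r j) \<le> (\<Sum>i\<in>{0..k} - {j}. degree [:- real i, 1:])"
      unfolding r_def by (rule degree_prod_sum_le[unfolded comp_def]) simp
    also have "\<dots> = k" using that by simp
    finally show ?thesis unfolding l_def using degree_smult_le order_trans by blast
  qed
  moreover have "poly (l j) 0 = 0" if "j \<in> {1..k}" for j
  proof -
    have "poly (r j) 0 = 0" unfolding pr using that by (intro prod_zero) auto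
    then show ?thesis by (simp add: l_def)
  qed
  moreover have "poly (l j) (real i) = (if i = j then 1 else 0)" if "j \<in> {1..k}" "i \<in> {1..k}" for i j
  proof (cases "i = j")
    case True
    have "poly (r j) (real j) \<noteq> 0" unfolding pr by auto
    then show ?thesis using True by (simp add: l_def)
  next
    case False
    then have "poly (r j) (real i) = 0" unfolding pr using that by (intro prod_zero) auto
    then show ?thesis using False by (simp add: l_def)
  qed
  ultimately show ?thesis by blast
qed

lemma poly_eq_on_nats:
  fixes p q :: "real poly"
  assumes "\<And>i. i \<le> k \<Longrightarrow> poly p (real i) = poly q (real i)" "degree p \<le> k" "degree q \<le> k"
  shows "p = q"
proof (rule poly_eqI_degree[of "real ` {..k}"])
  have "card (real ` {..k}) = Suc k" by (simp add: card_image)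
  then show "degree p < card (real ` {..k})" "degree q < card (real ` {..k})" using assms by auto
qed (use assms in auto)

text \<open>The feasible \<open>x\<close> are the value vectors \<open>(p 1, \<dots>, p (2 * k))\<close> of the polynomials \<open>p\<close> of degree at
  most \<open>k\<close> with \<open>p 0 = 0\<close>, followed by \<open>m - k\<close> zeros and \<open>n - m - k\<close> free entries.\<close>

locale poly_example =
  fixes m n k :: nat and l :: "nat \<Rightarrow> real poly"
  assumes m: "0 < m" "m < n" and k: "k = min m (n - m)"
    and l: "\<forall>j\<in>{1..k}. degree (l j) \<le> k \<and> poly (l j) 0 = 0 \<and>
     (\<forall>i\<in>{1..k}. poly (l j) (real i) = (if i = j then 1 else 0))"
begin

text \<open>Column \<open>c\<close> belongs to the unknown x_(c+1). The rows below \<open>k\<close>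
  say that the entries at k + 1, ..., 2k extrapolate those at 1, ..., k, and the other rows set an
  entry to zero. The columns from \<open>k\<close> to \<open>k + m - 1\<close> form an identity
  block, whence rank \<open>m\<close>.\<close>

definition A :: "real mat" where
  "A = mat m n (\<lambda>(r, c). if c = k + r then 1
     else if r < k \<and> c < k then - poly (l (Suc c)) (real (k + r + 1)) else 0)"

abbreviation "b \<equiv> 0\<^sub>v m :: real vec"
abbreviation "N \<equiv> Suc n"
abbreviation "V \<equiv> aug_ker A b"
abbreviation "L \<equiv> rlt_affine A b"

lemma k': "0 < k" "k \<le> m" "k + m \<le> n" using m k by auto

lemma A: "A \<in> carrier_mat m n" "dim_row A = m" "dim_col A = n" by (auto simp: A_def)

lemma b: "b \<in> carrier_vec m" by simp

lemma zero_binary: "0\<^sub>v n \<in> binary_points A b"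
  using A by (auto simp: binary_points_def)

lemma rank: "vec_space.rank m A = m"
proof -
  have u: "unit_fun r \<in> fun_of_vec ` set (cols A)" if "r < m" for r
  proof
    show "unit_fun r = fun_of_vec (col A (k + r))"
      using that k' by (auto simp: fun_of_vec_def A_def unit_fun_def fun_eq_iff)
    show "col A (k + r) \<in> set (cols A)" using that k' A by (auto simp: cols_def)
  qed
  have "span (fun_of_vec ` set (cols A)) = span (supp m)"
  proof (rule subset_antisym; rule span_minimal[OF _ subspace_span])
    have "fun_of_vec c \<in> supp m" if "c \<in> set (cols A)" for c
      using that A by (auto simp: cols_def fun_of_vec_def supp_def)
    then show "fun_of_vec ` set (cols A) \<subseteq> span (supp m)" by (auto intro: span_base)
    have "supp m \<subseteq> span (unit_fun ` {..<m})" by (rule supp_span)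
    also have "\<dots> \<subseteq> span (fun_of_vec ` set (cols A))" using u by (intro span_mono) auto
    finally show "supp m \<subseteq> span (fun_of_vec ` set (cols A))" .
  qed
  then have "dim (fun_of_vec ` set (cols A)) = dim (supp m)" by (rule span_eq_dim)
  then show ?thesis using rank_eq_dim_cols[OF A(1)] by (simp add: dim_supp)
qed

lemma V_iff: "v \<in> V \<longleftrightarrow> v \<in> supp N \<and>
    (\<forall>r<k. v (k + r + 1) = (\<Sum>c<k. poly (l (Suc c)) (real (k + r + 1)) * v (Suc c))) \<and>
    (\<forall>r. k \<le> r \<and> r < m \<longrightarrow> v (k + r + 1) = 0)"
proof -
  have row: "dot N (aug_row A b r) v
      = v (k + r + 1) - (if r < k then (\<Sum>c<k. poly (l (Suc c)) (real (k + r + 1)) * v (Suc c)) else 0)"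
    if r: "r < m" for r
  proof -
    have "dot N (aug_row A b r) v = (\<Sum>c<n. A $$ (r, c) * v (Suc c))"
      using dot_aug_row[of A b r v] r by (simp add: A)
    also have "\<dots> = (\<Sum>c<n. (if c = k + r then v (Suc c) else 0)
        - (if c \<in> {..<k} then (if r < k then poly (l (Suc c)) (real (k + r + 1)) * v (Suc c) else 0) else 0))"
      using r by (intro sum.cong refl) (auto simp: A_def)
    also have "\<dots> = v (k + r + 1)
        - (\<Sum>c\<in>{..<n} \<inter> {..<k}. if r < k then poly (l (Suc c)) (real (k + r + 1)) * v (Suc c) else 0)"
      using r k' by (simp add: sum_subtractf sum.inter_restrict)
    also have "{..<n} \<inter> {..<k} = {..<k}" using k' by auto
    finally show ?thesis by (auto intro: sum.cong)
  qed
  have "v \<in> V \<longleftrightarrow> v \<in> supp N \<and> (\<forall>r<m. dot N (aug_row A b r) v = 0)"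
    by (simp add: aug_ker_def A)
  also have "\<dots> \<longleftrightarrow> v \<in> supp N \<and> (\<forall>r<m. v (k + r + 1)
      = (if r < k then (\<Sum>c<k. poly (l (Suc c)) (real (k + r + 1)) * v (Suc c)) else 0))"
    using row by simp
  also have "\<dots> \<longleftrightarrow> v \<in> supp N \<and>
    (\<forall>r<k. v (k + r + 1) = (\<Sum>c<k. poly (l (Suc c)) (real (k + r + 1)) * v (Suc c))) \<and>
    (\<forall>r. k \<le> r \<and> r < m \<longrightarrow> v (k + r + 1) = 0)"
    (is "?S \<and> (\<forall>r<m. ?E r) \<longleftrightarrow> ?S \<and> ?K \<and> ?M")
  proof -
    have "(\<forall>r<m. ?E r) \<longleftrightarrow> (\<forall>r<k. ?E r) \<and> (\<forall>r. k \<le> r \<and> r < m \<longrightarrow> ?E r)"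
      using k'(2) by (meson not_less order_less_le_trans)
    also have "(\<forall>r<k. ?E r) \<longleftrightarrow> ?K" by simp
    also have "(\<forall>r. k \<le> r \<and> r < m \<longrightarrow> ?E r) \<longleftrightarrow> ?M" by auto
    finally show ?thesis by simp
  qed
  finally show ?thesis .
qed

section \<open>Value vectors of polynomials in the constraint subspace\<close>

definition interp :: "(nat \<Rightarrow> real) \<Rightarrow> real poly" where
  "interp v = (\<Sum>c<k. Polynomial.smult (v (Suc c)) (l (Suc c)))"

lemma degree_interp: "degree (interp v) \<le> k"
  unfolding interp_def
proof (rule degree_sum_le)
  fix c assume "c \<in> {..<k}"
  then have "degree (l (Suc c)) \<le> k" using l by auto
  then show "degree (Polynomial.smult (v (Suc c)) (l (Suc c))) \<le> k" using degree_smult_le order_trans by blast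
qed simp

lemma poly_interp: "poly (interp v) t = (\<Sum>c<k. poly (l (Suc c)) t * v (Suc c))"
  by (simp add: interp_def poly_sum mult.commute)

lemma poly_interp_0: "poly (interp v) 0 = 0"
  unfolding poly_interp using l by (intro sum.neutral) auto

lemma poly_interp_node: "i \<in> {1..k} \<Longrightarrow> poly (interp v) (real i) = v i"
proof -
  assume i: "i \<in> {1..k}"
  have "poly (interp v) (real i) = (\<Sum>c<k. if c = i - 1 then v i else 0)"
    unfolding poly_interp
  proof (intro sum.cong refl)
    fix c assume "c \<in> {..<k}"
    then have "poly (l (Suc c)) (real i) = (if i = Suc c then 1 else 0)" using l i by auto
    then show "poly (l (Suc c)) (real i) * v (Suc c) = (if c = i - 1 then v i else 0)" using i by auto
  qed
  also have "\<dots> = v i" using i by auto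
  finally show ?thesis .
qed

lemma poly_interp_V:
  assumes "v \<in> V" "i \<in> {1..2 * k}"
  shows "poly (interp v) (real i) = v i"
proof (cases "i \<le> k")
  case True
  then show ?thesis using poly_interp_node[of i v] assms by simp
next
  case False
  then obtain r where r: "i = k + r + 1" "r < k" using assms(2) by (auto intro: that[of "i - k - 1"])
  then show ?thesis using assms(1) poly_interp[of v "real i"] by (simp add: V_iff)
qed

definition tv :: "nat \<Rightarrow> nat \<Rightarrow> real" where
  "tv s = (\<lambda>i. if i \<in> {1..2 * k} then real i ^ s else 0)"

lemma tv_V:
  assumes s: "s \<in> {1..k}"
  shows "tv s \<in> V"
proof -
  have "interp (tv s) = monom 1 s"
  proof (rule poly_eq_on_nats[of k])
    fix i assume i: "i \<le> k"
    show "poly (interp (tv s)) (real i) = poly (monom 1 s) (real i)"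
    proof (cases "i = 0")
      case True
      then show ?thesis using s poly_interp_0[of "tv s"] by (simp add: poly_monom)
    next
      case False
      then show ?thesis using poly_interp_node[of i "tv s"] i by (simp add: poly_monom tv_def)
    qed
  qed (use degree_interp s in \<open>auto simp: degree_monom_eq\<close>)
  then have "(\<Sum>c<k. poly (l (Suc c)) t * tv s (Suc c)) = t ^ s" for t
    by (simp add: poly_interp[symmetric] poly_monom)
  then show ?thesis using k' by (auto simp: V_iff tv_def supp_def)
qed

definition e0 :: "nat \<Rightarrow> real" where "e0 = unit_fun 0"

lemma e0_V: "e0 \<in> V" using k' by (auto simp: V_iff e0_def unit_fun_def supp_def)

lemma V: "subspace V" "V \<subseteq> supp N"
  using annihilated_subspace[OF annihilated_aug_ker, of A b] annihilated_supp[OF annihilated_aug_ker, of A b]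
  by (simp_all add: A)

text \<open>At each of the 2k nodes the diagonal constraint equates the sum of p_g^2 with the sum of
  g_0 p_g, and at 0 both sides vanish; with degree at most 2k this is a polynomial identity, so
  every p_g is zero. Entry 1 is recorded because \<open>tv 1\<close> is nonzero there.\<close>

lemma feasible_gram:
  assumes Y: "Y \<in> L" "Y \<in> psd_cone N"
  obtains gs where "Y = gram N gs" "set gs \<subseteq> V" "\<And>g. g \<in> set gs \<Longrightarrow> g 1 = 0"
proof -
  obtain gs where gs: "Y = gram N gs" "set gs \<subseteq> supp N"
    using Y(2) by (auto simp: psd_cone_eq_gram_cone gram_cone_def)
  have Y': "Y $$ (0, 0) = 1" "\<And>i. i \<in> {1..n} \<Longrightarrow> Y $$ (i, i) = Y $$ (0, i)"
    "\<And>j. j < N \<Longrightarrow> mat_col N Y j \<in> V"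
    using Y(1) by (auto simp: rlt_affine_iff[OF A(1) b])
  have gV: "g \<in> V" if g: "g \<in> set gs" for g
  proof -
    have "dot N (aug_row A b r) g = 0" if r: "r < m" for r
    proof -
      let ?c = "aug_row A b r"
      \<comment> \<open>The form of \<open>Y\<close> vanishes at each constraint row, and in Gram
        form it is a sum of squares, so every Gram vector satisfies the constraint.\<close>
      have "bilin N Y ?c ?c = (\<Sum>j<N. ?c j * dot N ?c (mat_col N Y j))"
        unfolding bilin_def dot_def sum_distrib_left
        by (subst sum.swap) (intro sum.cong refl, simp add: mat_col_def)
      also have "\<dots> = 0"
      proof (intro sum.neutral ballI)
        fix j assume "j \<in> {..<N}"
        then have "mat_col N Y j \<in> V" by (intro Y'(3)) simp
        then show "?c j * dot N ?c (mat_col N Y j) = 0" using r by (simp add: aug_ker_def A)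
      qed
      finally have "(\<Sum>g\<leftarrow>gs. (dot N g ?c)\<^sup>2) = 0" by (simp add: gs(1) bilin_gram)
      then have "\<forall>x\<in>set (map (\<lambda>g. (dot N g ?c)\<^sup>2) gs). x = 0"
        by (subst (asm) sum_list_nonneg_eq_0_iff) auto
      then have "dot N g ?c = 0" using g by auto
      then show ?thesis by (simp add: dot_def mult.commute)
    qed
    then show ?thesis using g gs by (auto simp: aug_ker_def A)
  qed
  have "(\<Sum>g\<leftarrow>gs. interp g * interp g) = (\<Sum>g\<leftarrow>gs. Polynomial.smult (g 0) (interp g))"
  proof (rule poly_eq_on_nats[of "2 * k"])
    have sq: "poly (\<Sum>g\<leftarrow>gs. interp g * interp g) t = (\<Sum>g\<leftarrow>gs. (poly (interp g) t)\<^sup>2)" for t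
      by (induction gs) (auto simp: power2_eq_square)
    have ln: "poly (\<Sum>g\<leftarrow>gs. Polynomial.smult (g 0) (interp g)) t = (\<Sum>g\<leftarrow>gs. g 0 * poly (interp g) t)" for t
      by (induction gs) auto
    fix i assume i: "i \<le> 2 * k"
    show "poly (\<Sum>g\<leftarrow>gs. interp g * interp g) (real i) = poly (\<Sum>g\<leftarrow>gs. Polynomial.smult (g 0) (interp g)) (real i)"
    proof (cases "i = 0")
      case True
      then show ?thesis unfolding sq ln by (simp add: poly_interp_0)
    next
      case False
      then have i': "i \<in> {1..2 * k}" "i \<in> {1..n}" "i < N" using i k' by auto
      have v: "poly (interp g) (real i) = g i" if "g \<in> set gs" for g
        using poly_interp_V[OF gV[OF that] i'(1)] .
      have "(\<Sum>g\<leftarrow>gs. (poly (interp g) (real i))\<^sup>2) = gsum gs i i"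
        using v by (induction gs) (auto simp: power2_eq_square)
      also have "\<dots> = gsum gs 0 i" using Y'(2)[OF i'(2)] i'(3) by (simp add: gs(1))
      also have "\<dots> = (\<Sum>g\<leftarrow>gs. g 0 * poly (interp g) (real i))"
        using v by (induction gs) auto
      finally show ?thesis unfolding sq ln .
    qed
  next
    have d: "degree (interp g * interp g) \<le> 2 * k" for g
      using degree_mult_le[of "interp g" "interp g"] degree_interp[of g] by simp
    show "degree (\<Sum>g\<leftarrow>gs. interp g * interp g) \<le> 2 * k"
      by (induction gs) (auto intro: degree_add_le d)
    have d': "degree (Polynomial.smult c (interp g)) \<le> 2 * k" for c g
      using degree_smult_le[of c "interp g"] degree_interp[of g] by simp
    show "degree (\<Sum>g\<leftarrow>gs. Polynomial.smult (g 0) (interp g)) \<le> 2 * k"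
      by (induction gs) (auto intro: degree_add_le d' simp del: degree_smult_eq)
  qed
  from sum_squares_eq_linear[where P = interp, OF this poly_interp_0]
  have "interp g = 0" if "g \<in> set gs" for g using that by blast
  then have "g 1 = 0" if "g \<in> set gs" for g
    using poly_interp_V[OF gV[OF that], of 1] that k' by simp
  then show thesis using that[OF gs(1)] gV by blast
qed

text \<open>Symmetrised sums of outer products, to test \<open>W \<in> perp N L\<close> on matrices that need not be
  semidefinite.\<close>

definition pair_mat :: "((nat \<Rightarrow> real) \<times> (nat \<Rightarrow> real)) list \<Rightarrow> real mat" where
  "pair_mat ps = mat N N (\<lambda>(i, j). \<Sum>(u, v)\<leftarrow>ps. u i * v j + v i * u j)"

lemma perp_pair_mat:
  assumes W: "W \<in> perp N L" and ps: "\<And>u v. (u, v) \<in> set ps \<Longrightarrow> u \<in> V \<and> v \<in> V"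
    and 0: "(\<Sum>(u, v)\<leftarrow>ps. 2 * (u 0 * v 0)) = 1"
    and diag: "\<And>i. i \<in> {1..n} \<Longrightarrow> (\<Sum>(u, v)\<leftarrow>ps. 2 * (u i * v i)) = (\<Sum>(u, v)\<leftarrow>ps. u 0 * v i + v 0 * u i)"
  shows "(\<Sum>(u, v)\<leftarrow>ps. bilin N W u v) = 0"
proof -
  have Ws: "W \<in> sym_mats N" using W by (auto simp: perp_def)
  have idx: "pair_mat ps $$ (i, j) = (\<Sum>(u, v)\<leftarrow>ps. u i * v j + v i * u j)" if "i < N" "j < N" for i j
    using that by (simp add: pair_mat_def)
  have car: "pair_mat ps \<in> carrier_mat N N" by (simp add: pair_mat_def)
  have "pair_mat ps \<in> L"
    unfolding rlt_affine_iff[OF A(1) b]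
  proof (intro conjI ballI allI impI)
    have "(\<Sum>(u, v)\<leftarrow>ps. u i * v j + v i * u j) = (\<Sum>(u, v)\<leftarrow>ps. u j * v i + v j * u i)" for i j
      by (induction ps) (auto simp: mult.commute)
    then show "pair_mat ps \<in> sym_mats N" using car by (intro sym_matsI) (auto simp: idx)
    have twice: "(\<Sum>(u, v)\<leftarrow>ps. u i * v i + v i * u i) = (\<Sum>(u, v)\<leftarrow>ps. 2 * (u i * v i))" for i
      by (induction ps) auto
    then show "pair_mat ps $$ (0, 0) = 1" using 0 by (simp add: idx)
    show "pair_mat ps $$ (i, i) = pair_mat ps $$ (0, i)" if "i \<in> {1..n}" for i
      using diag[OF that] that by (simp add: idx twice)
    fix j assume j: "j < N"
    have "(\<lambda>i. if i < N then (\<Sum>(u, v)\<leftarrow>ps. u i * v j + v i * u j) else 0) \<in> V"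
      using ps
    proof (induction ps)
      case Nil
      have "(\<lambda>i. if i < N then (\<Sum>(u, v)\<leftarrow>[]. u i * v j + v i * u j) else 0) = (0 :: nat \<Rightarrow> real)"
        by (auto simp: fun_eq_iff)
      then show ?case using V(1) by (simp add: subspace_0)
    next
      case (Cons p ps)
      obtain u v where p: "p = (u, v)" by (cases p)
      have uv: "u \<in> V" "v \<in> V" using Cons.prems p by auto
      then have uvN: "u \<in> supp N" "v \<in> supp N" using V(2) by blast+
      have "(\<lambda>i. if i < N then (\<Sum>(u, v)\<leftarrow>p # ps. u i * v j + v i * u j) else 0)
          = (v j *\<^sub>R u + u j *\<^sub>R v) + (\<lambda>i. if i < N then (\<Sum>(u, v)\<leftarrow>ps. u i * v j + v i * u j) else 0)"
        using uvN by (auto simp: fun_eq_iff supp_def p not_less)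
      moreover have "(\<lambda>i. if i < N then (\<Sum>(u, v)\<leftarrow>ps. u i * v j + v i * u j) else 0) \<in> V"
        using Cons by auto
      ultimately show ?case using V(1) uv by (simp add: subspace_add subspace_scale)
    qed
    moreover have "mat_col N (pair_mat ps) j
        = (\<lambda>i. if i < N then (\<Sum>(u, v)\<leftarrow>ps. u i * v j + v i * u j) else 0)"
      using j by (auto simp: mat_col_def idx)
    ultimately show "mat_col N (pair_mat ps) j \<in> V" by simp
  qed
  then have "0 = mat_inner W (pair_mat ps)" using W by (auto simp: perp_def)
  also have "\<dots> = (\<Sum>i<N. \<Sum>j<N. W $$ (i, j) * (\<Sum>(u, v)\<leftarrow>ps. u j * v i + v j * u i))"
    unfolding mat_inner_eq[OF sym_matsD(1)[OF Ws] car] by (intro sum.cong refl) (simp add: idx)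
  also have "\<dots> = (\<Sum>(u, v)\<leftarrow>ps. bilin N W v u + bilin N W u v)"
    by (induction ps) (auto simp: bilin_def distrib_left sum.distrib mult_ac simp del: sum.lessThan_Suc)
  also have "\<dots> = 2 * (\<Sum>(u, v)\<leftarrow>ps. bilin N W u v)"
    by (induction ps) (auto simp: bilin_sym[OF Ws])
  finally show ?thesis by simp
qed

text \<open>Every test matrix includes half of \<open>e0\<close> paired with \<open>e0\<close>,
  which supplies the entry Y_00 = 1. The entrywise product of \<open>tv s\<close> and
  \<open>tv t\<close> is \<open>tv (s + t)\<close>, so pairs with the same s + t have the same
  diagonal, and a pair of \<open>2 *\<^sub>R e0\<close> with \<open>tv (s + t)\<close> balances it
  through row 0.\<close>

lemma perp_facts:
  assumes W: "W \<in> perp N L"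
  shows "bilin N W e0 e0 = 0"
    and "\<lbrakk>s \<in> {1..k}; t \<in> {1..k}; s' \<in> {1..k}; t' \<in> {1..k}; s + t = s' + t'\<rbrakk>
      \<Longrightarrow> bilin N W (tv s) (tv t) = bilin N W (tv s') (tv t')"
    and "\<lbrakk>s \<in> {1..k}; t \<in> {1..k}; s + t \<le> k\<rbrakk>
      \<Longrightarrow> bilin N W (tv s) (tv t) + 2 * bilin N W e0 (tv (s + t)) = 0"
proof -
  have h: "(1 / 2) *\<^sub>R e0 \<in> V" "2 *\<^sub>R e0 \<in> V" using e0_V V(1) by (auto intro: subspace_scale)
  have e: "e0 0 = 1" "i \<noteq> 0 \<Longrightarrow> e0 i = 0" for i by (auto simp: e0_def unit_fun_def)
  have t0: "tv s 0 = 0" for s by (simp add: tv_def)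
  have tt: "tv s i * tv t i = tv (s + t) i" for s t i by (simp add: tv_def power_add)
  have "(\<Sum>(u, v)\<leftarrow>[((1 / 2) *\<^sub>R e0, e0)]. bilin N W u v) = 0"
    by (rule perp_pair_mat[OF W]) (use h e0_V e in auto)
  then show 1: "bilin N W e0 e0 = 0" by (simp add: linear_scale[OF linear_bilin(2)])
  show "bilin N W (tv s) (tv t) = bilin N W (tv s') (tv t')"
    if s: "s \<in> {1..k}" "t \<in> {1..k}" "s' \<in> {1..k}" "t' \<in> {1..k}" "s + t = s' + t'"
  proof -
    have "(-1) *\<^sub>R tv s' \<in> V" using tv_V[OF s(3)] V(1) by (intro subspace_scale)
    then have "(\<Sum>(u, v)\<leftarrow>[((1 / 2) *\<^sub>R e0, e0), (tv s, tv t), ((-1) *\<^sub>R tv s', tv t')]. bilin N W u v) = 0"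
      by (intro perp_pair_mat[OF W]) (use h e0_V e t0 tv_V s in \<open>auto simp: tt\<close>)
    then show ?thesis by (simp add: linear_scale[OF linear_bilin(2)] linear_neg[OF linear_bilin(2)] 1)
  qed
  show "bilin N W (tv s) (tv t) + 2 * bilin N W e0 (tv (s + t)) = 0"
    if s: "s \<in> {1..k}" "t \<in> {1..k}" "s + t \<le> k"
  proof -
    have "tv (s + t) \<in> V" using s by (intro tv_V) auto
    then have "(\<Sum>(u, v)\<leftarrow>[((1 / 2) *\<^sub>R e0, e0), (tv s, tv t), (2 *\<^sub>R e0, tv (s + t))]. bilin N W u v) = 0"
      by (intro perp_pair_mat[OF W]) (use h e0_V e t0 tv_V s in \<open>auto simp: tt\<close>)
    then show ?thesis by (simp add: linear_scale[OF linear_bilin(2)] 1)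
  qed
qed

section \<open>A filtration by degree that every facial reduction sequence respects\<close>

definition gens :: "nat \<Rightarrow> (nat \<Rightarrow> real) set" where
  "gens d = insert e0 (tv ` {1..d})"

text \<open>The vector \<open>e0\<close> is isotropic, hence null against everything, and this kills
  the entries with s + t <= d. The Hankel property and semidefiniteness spread the zeros up to s + t
  = 2d - 1, so only the corner entry at degree \<open>d\<close> can survive.\<close>

lemma cert_vanishes:
  assumes W: "W \<in> perp N L" and d: "d \<le> k" and psd: "\<And>u. u \<in> span (gens d) \<Longrightarrow> 0 \<le> bilin N W u u"
    and u: "u \<in> span (gens (d - 1))"
  shows "bilin N W u u = 0"
proof -
  have Ws: "W \<in> sym_mats N" using W by (auto simp: perp_def)
  have null: "bilin N W x y = 0" if "x \<in> span (gens d)" "bilin N W x x = 0" "y \<in> span (gens d)" for x y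
    by (rule psd_form_null[OF subspace_span linear_bilin(2) linear_bilin(1) bilin_sym[OF Ws] psd that])
  have g: "e0 \<in> span (gens d)" "s \<in> {1..d} \<Longrightarrow> tv s \<in> span (gens d)" for s
    by (auto simp: gens_def intro: span_base)
  have e: "bilin N W e0 y = 0" if "y \<in> span (gens d)" for y
    using null[OF g(1) perp_facts(1)[OF W] that] .
  have hankel: "s \<in> {1..d} \<Longrightarrow> t \<in> {1..d} \<Longrightarrow> s + t < 2 * d \<Longrightarrow> bilin N W (tv s) (tv t) = 0" for s t
  proof (induction "s + t" arbitrary: s t rule: less_induct)
    case less
    show ?case
    proof (cases "s + t \<le> d")
      case True
      then show ?thesis
        using perp_facts(3)[OF W, of s t] e[OF g(2), of "s + t"] less.prems d by auto
    next
      case False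
      \<comment> \<open>The entry is moved along its antidiagonal to \<open>(r, d)\<close>. As
        \<open>r < d\<close>, the diagonal entry \<open>(r, r)\<close> lies on an earlier
        antidiagonal, already zero, and a zero diagonal entry makes its row vanish.\<close>
      define r where "r = s + t - d"
      have r: "r \<in> {1..d}" "r < d" "s + t = r + d" using False less.prems by (auto simp: r_def)
      have "bilin N W (tv r) (tv r) = 0" using less.hyps[of r r] r by auto
      then have "bilin N W (tv r) (tv d) = 0" using null[OF g(2)[OF r(1)] _ g(2), of d] r by simp
      moreover have "bilin N W (tv s) (tv t) = bilin N W (tv r) (tv d)"
        using less.prems d r by (intro perp_facts(2)[OF W]) auto
      ultimately show ?thesis by simp
    qed
  qed
  have gg: "bilin N W x y = 0" if xy: "x \<in> gens (d - 1)" "y \<in> gens (d - 1)" for x y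
  proof -
    have sub: "gens (d - 1) \<subseteq> span (gens d)" using g by (auto simp: gens_def)
    consider "x = e0" | "y = e0" | s t where "s \<in> {1..d - 1}" "t \<in> {1..d - 1}" "x = tv s" "y = tv t"
      using xy by (auto simp: gens_def)
    then show ?thesis
    proof cases
      case 1
      then show ?thesis using e xy sub by auto
    next
      case 2
      then show ?thesis using e[of x] xy sub bilin_sym[OF Ws, of x e0] by auto
    next
      case 3
      then show ?thesis using hankel[of s t] by auto
    qed
  qed
  have "bilin N W x u = 0" if "x \<in> gens (d - 1)" for x
    by (rule linear_eq_0_on_span[OF linear_bilin(1) gg[OF that] u])
  then show ?thesis by (rule linear_eq_0_on_span[OF linear_bilin(2) _ u])
qed

text \<open>Nothing is assumed of the faces or certificates beyond the definition. The rank-one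
  matrices kept so far make the next certificate semidefinite on the span, and it then vanishes on
  all degrees but the top one.\<close>

lemma seq_keeps_span:
  assumes fr: "facial_reduction_seq N L d F W" and j: "j \<le> d" "j \<le> k" and u: "u \<in> span (gens (k - j))"
  shows "gram N [u] \<in> F j"
  using j u
proof (induction j arbitrary: u)
  case 0
  then show ?case using fr gram_psd by (simp add: facial_reduction_seq_def)
next
  case (Suc j)
  have W: "W (Suc j) \<in> perp N L" "W (Suc j) \<in> dual_cone N (F j)" "F (Suc j) = F j \<inter> perp N {W (Suc j)}"
    using fr Suc.prems(1) unfolding facial_reduction_seq_def by (auto dest!: bspec[where x = "Suc j"])
  have Ws: "W (Suc j) \<in> carrier_mat N N" using W(1) sym_matsD(1) by (auto simp: perp_def)
  have psd: "0 \<le> bilin N (W (Suc j)) v v" if "v \<in> span (gens (k - j))" for v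
  proof -
    have "gram N [v] \<in> F j" using Suc that by simp
    then have "0 \<le> mat_inner (W (Suc j)) (gram N [v])" using W(2) by (auto simp: dual_cone_def)
    then show ?thesis using Ws by (simp add: mat_inner_gram)
  qed
  have u: "u \<in> span (gens (k - j - 1))" using Suc.prems(3) by simp
  then have "bilin N (W (Suc j)) u u = 0" using cert_vanishes[OF W(1) _ psd u] by simp
  then have "gram N [u] \<in> perp N {W (Suc j)}" using Ws gram_sym_mats by (simp add: perp_def mat_inner_gram)
  moreover have "gens (k - Suc j) \<subseteq> gens (k - j)" by (auto simp: gens_def)
  then have "u \<in> span (gens (k - j))" using Suc.prems(3) span_mono by blast
  then have "gram N [u] \<in> F j" using Suc by simp
  ultimately show ?case using W(3) by simp
qed

text \<open>After fewer than \<open>k\<close> steps the square of \<open>tv 1\<close> is still in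
  the face. The minimal face lies in the face of vectors with entry 1 equal to zero, whereas
  \<open>tv 1\<close> has the value 1 there.\<close>

lemma seq_length_ge:
  assumes fr: "facial_reduction_seq N L d F W"
  shows "k \<le> d"
proof (rule ccontr)
  assume "\<not> k \<le> d"
  then have d: "d < k" by simp
  define V1 where "V1 = {v\<in>supp N. v 1 = 0}"
  have dot1: "dot N (unit_fun 1) v = v 1" for v
  proof -
    have "dot N (unit_fun 1) v = (\<Sum>i<N. if i = 1 then v 1 else 0)"
      unfolding dot_def by (intro sum.cong) (auto simp: unit_fun_def)
    then show ?thesis using m by simp
  qed
  have "V1 = {v\<in>supp N. \<forall>c\<in>{unit_fun 1}. dot N c v = 0}" using dot1 by (auto simp: V1_def)
  then have "annihilated N V1" unfolding annihilated_def by blast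
  moreover have "L \<inter> psd_cone N \<subseteq> gram_cone N V1"
  proof
    fix Y assume "Y \<in> L \<inter> psd_cone N"
    then obtain gs where "Y = gram N gs" "set gs \<subseteq> V" "\<And>g. g \<in> set gs \<Longrightarrow> g 1 = 0"
      using feasible_gram by blast
    moreover from this have "set gs \<subseteq> V1" using V(2) unfolding V1_def by blast
    ultimately show "Y \<in> gram_cone N V1" by (auto simp: gram_cone_def)
  qed
  ultimately have "min_face N (L \<inter> psd_cone N) \<subseteq> gram_cone N V1"
    using gram_cone_face unfolding min_face_def by blast
  moreover have "tv 1 \<in> span (gens (k - d))" using d by (intro span_base) (auto simp: gens_def)
  then have "gram N [tv 1] \<in> F d" using seq_keeps_span[OF fr, of d] d by simp
  moreover have "F d = min_face N (L \<inter> psd_cone N)" using fr by (simp add: facial_reduction_seq_def)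
  ultimately obtain gs where gs: "gram N [tv 1] = gram N gs" "set gs \<subseteq> V1"
    by (auto simp: gram_cone_def)
  have "gram N [tv 1] $$ (1, 1) = 1" using m k' by (simp add: tv_def)
  moreover have "gram N gs $$ (1, 1) = 0"
    using gs(2) m by (simp add: gsum_def) (intro sum_list_map_eq_0, auto simp: V1_def)
  ultimately show False using gs(1) by simp
qed

lemma singularity_degree_ge: "enat k \<le> singularity_degree N L"
  unfolding singularity_degree_def using seq_length_ge by (intro INF_greatest) auto

end

theorem mainTheorem1:
  fixes n m :: nat
  assumes "0 < m" and "m < n"
  shows "(\<forall>q A b. 0 < q \<and> A \<in> carrier_mat q n \<and> vec_space.rank q A = m \<and> b \<in> carrier_vec q \<and>
            binary_points A b \<noteq> {} \<longrightarrow>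
            singularity_degree (n + 1) (rlt_affine A b) \<le> enat (min m (n - m)))
       \<and> (\<exists>q A b. 0 < q \<and> A \<in> carrier_mat q n \<and> vec_space.rank q A = m \<and> b \<in> carrier_vec q \<and>
            binary_points A b \<noteq> {} \<and>
            singularity_degree (n + 1) (rlt_affine A b) = enat (min m (n - m)))"
proof (rule conjI)
  have upper: "singularity_degree (n + 1) (rlt_affine A b) \<le> enat (min m (n - m))"
    if Ab: "A \<in> carrier_mat q n" "vec_space.rank q A = m" "b \<in> carrier_vec q" "binary_points A b \<noteq> {}"
    for q A b
  proof -
    obtain x where "x \<in> binary_points A b" using Ab(4) by blast
    then interpret rlt_feasible q n A b x using Ab by unfold_locales
    show ?thesis using singularity_degree_le Ab(2) assms by simp
  qed
  then show "\<forall>q A b. 0 < q \<and> A \<in> carrier_mat q n \<and> vec_space.rank q A = m \<and> b \<in> carrier_vec q \<and>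
            binary_points A b \<noteq> {} \<longrightarrow>
            singularity_degree (n + 1) (rlt_affine A b) \<le> enat (min m (n - m))"
    by blast
  define k where "k = min m (n - m)"
  obtain l :: "nat \<Rightarrow> real poly" where "\<forall>j\<in>{1..k}. degree (l j) \<le> k \<and> poly (l j) 0 = 0 \<and>
     (\<forall>i\<in>{1..k}. poly (l j) (real i) = (if i = j then 1 else 0))"
    using lagrange_basis_exists by blast
  then interpret poly_example m n k l using assms by unfold_locales (auto simp: k_def)
  have bin: "binary_points A b \<noteq> {}" using zero_binary by blast
  have "singularity_degree (n + 1) L = enat (min m (n - m))"
    using upper[OF A(1) rank b bin] singularity_degree_ge by (simp add: k_def)
  then show "\<exists>q A b. 0 < q \<and> A \<in> carrier_mat q n \<and> vec_space.rank q A = m \<and> b \<in> carrier_vec q \<and>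
            binary_points A b \<noteq> {} \<and>
            singularity_degree (n + 1) (rlt_affine A b) = enat (min m (n - m))"
    \<comment> \<open>The witness has \<open>q = m\<close> rows, so positivity of \<open>q\<close>
      is that of \<open>m\<close>.\<close>
    using assms(1) A(1) rank b bin by blast
qed

end
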